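(* Let $X$ be a locally compact topological space homeomorphic to a subspace of a manifold. Let $\Phi$ be a $C^0$ flow on $X$ with a globally asymptotically stable compact invariant set $A\subset X$. Then $(X,\Phi)$ is linearizable by a $C^0$ embedding if and only if both of the following hold: (1) $A$ has $C^0$ asymptotic phase; and (2) the restricted flow $\Phi|_{\mathbb{R}\times A}$ on $A$ is a $1$-parameter subgroup of a $C^0$ torus action on $A$ with finitely many orbit types. Moreover, any linearizing injective $C^0$ map $X\to\mathbb{R}^n$ (for any $n$) is proper, hence also a $C^0$ embedding.
   Context: Manifolds are, as usual, finite-dimensional, Hausdorff, second countable and without boundary. $C^0$ means continuous. A flow on $X$ is a group action $\Phi\colon \mathbb{R}\times X\to X$, $(t,x)\mapsto \Phi^t(x)$, of $(\mathbb{R},+)$ on $X$; it is $C^0$ if $\Phi$ is continuous. A set $A\subset X$ is invariant if $\Phi^t(A)=A$ for all $t\in\mathbb{R}$. A compact invariant set $A$ is asymptotically stable if every neighborhood $U$ of $A$ contains a neighborhood $V$ of $A$ with $\Phi^t(V)\subset U$ for all $t\geq 0$, and there is a neighborhood of $A$ all of whose points $x$ satisfy $\Phi^t(x)\to A$ as $t\to\infty$ (i.e. $\Phi^t(x)$ is eventually in every neighborhood of $A$); it is globally asymptotically stable if moreover $\Phi^t(x)\to A$ as $t\to\infty$ for every $x\in X$. A map $F\colon X\to\mathbb{R}^n$ is linearizing (for $\Phi$) if there is a matrix $B\in\mathbb{R}^{n\times n}$ such that $F\circ\Phi^t=e^{Bt}\circ F$ for all $t\in\mathbb{R}$. A $C^0$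 embedding is a homeomorphism onto its image (with the subspace topology). $(X,\Phi)$ is linearizable by a $C^0$ embedding if for some $n\in\mathbb{N}$ there is a linearizing $C^0$ embedding $F\colon X\to\mathbb{R}^n$. A map is proper if preimages of compact sets are compact. $A$ has $C^0$ asymptotic phase if there is a continuous map $P\colon X\to A$ with $P|_A=\mathrm{id}_A$ and $P\circ\Phi^t=\Phi^t\circ P$ for all $t\in\mathbb{R}$. A $C^0$ torus action on a space $Y$ is a continuous group action $\Theta\colon H\times Y\to Y$, $(h,y)\mapsto\Theta^h(y)$, of a torus $H=T^\ell=\mathbb{R}^\ell/\mathbb{Z}^\ell$ (for some $\ell\in\mathbb{N}$). It has finitely many orbit types if only finitely many subgroups of $H$ are of the form $\{g\in H\colon \Theta^g(y)=y\}$ for some $y\in Y$. A flow $\Psi$ on $Y$ is a $1$-parameter subgroup of $\Theta$ if there is $\boldsymbol\omega\in\mathbb{R}^\ell$ such that $\Psi^t=\Theta^{(\boldsymbol\omega t \bmod 1)}$ for all $t\in\mathbb{R}$, where "$\bmod\ 1$" is applied entrywise. *)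

theory Defs
  imports "HOL-Analysis.Analysis" "HOL-Algebra.Coset" "Jordan_Normal_Form.Matrix"
begin

definition topological_manifold :: "'a topology \<Rightarrow> bool" where
  "topological_manifold M \<longleftrightarrow>
     Hausdorff_space M \<and> second_countable M \<and>
     (\<exists>d. \<forall>x\<in>topspace M. \<exists>U V. openin M U \<and> x \<in> U \<and> openin (Euclidean_space d) V \<and>
        subtopology M U homeomorphic_space subtopology (Euclidean_space d) V)"

(* Neighbourhoods of a set need not be open. *)
definition nbhd_of_set :: "'a topology \<Rightarrow> 'a set \<Rightarrow> 'a set \<Rightarrow> bool" where
  "nbhd_of_set X A U \<longleftrightarrow> U \<subseteq> topspace X \<and> (\<exists>W. openin X W \<and> A \<subseteq> W \<and> W \<subseteq> U)"

definition continuous_action ::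
  "('g, 'm) monoid_scheme \<Rightarrow> 'g topology \<Rightarrow> 'a topology \<Rightarrow> ('g \<Rightarrow> 'a \<Rightarrow> 'a) \<Rightarrow> bool" where
  "continuous_action G T Y \<Theta> \<longleftrightarrow>
     continuous_map (prod_topology T Y) Y (\<lambda>(g, y). \<Theta> g y) \<and>
     (\<forall>y\<in>topspace Y. \<Theta> \<one>\<^bsub>G\<^esub> y = y) \<and>
     (\<forall>g\<in>carrier G. \<forall>h\<in>carrier G. \<forall>y\<in>topspace Y. \<Theta> (g \<otimes>\<^bsub>G\<^esub> h) y = \<Theta> g (\<Theta> h y))"

definition continuous_flow :: "'a topology \<Rightarrow> (real \<Rightarrow> 'a \<Rightarrow> 'a) \<Rightarrow> bool" where
  "continuous_flow X \<Phi> \<longleftrightarrow>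
     continuous_action \<lparr>carrier = UNIV, mult = (+), one = 0\<rparr> euclideanreal X \<Phi>"

definition compact_invariant :: "'a topology \<Rightarrow> (real \<Rightarrow> 'a \<Rightarrow> 'a) \<Rightarrow> 'a set \<Rightarrow> bool" where
  "compact_invariant X \<Phi> A \<longleftrightarrow> compactin X A \<and> (\<forall>t. \<Phi> t ` A = A)"

definition converges_to_set ::
  "'a topology \<Rightarrow> (real \<Rightarrow> 'a \<Rightarrow> 'a) \<Rightarrow> 'a set \<Rightarrow> 'a \<Rightarrow> bool" where
  "converges_to_set X \<Phi> A x \<longleftrightarrow>
     (\<forall>U. nbhd_of_set X A U \<longrightarrow> (\<forall>\<^sub>F t in at_top. \<Phi> t x \<in> U))"

definition asymptotically_stable :: "'a topology \<Rightarrow> (real \<Rightarrow> 'a \<Rightarrow> 'a) \<Rightarrow> 'a set \<Rightarrow> bool" where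
  "asymptotically_stable X \<Phi> A \<longleftrightarrow>
     (\<forall>U. nbhd_of_set X A U \<longrightarrow>
        (\<exists>V. nbhd_of_set X A V \<and> V \<subseteq> U \<and> (\<forall>t\<ge>0. \<Phi> t ` V \<subseteq> U))) \<and>
     (\<exists>N. nbhd_of_set X A N \<and> (\<forall>x\<in>N. converges_to_set X \<Phi> A x))"

definition globally_asymptotically_stable ::
  "'a topology \<Rightarrow> (real \<Rightarrow> 'a \<Rightarrow> 'a) \<Rightarrow> 'a set \<Rightarrow> bool" where
  "globally_asymptotically_stable X \<Phi> A \<longleftrightarrow>
     asymptotically_stable X \<Phi> A \<and> (\<forall>x\<in>topspace X. converges_to_set X \<Phi> A x)"

(* The entrywise exponential series of a square matrix; every entry converges absolutely. *)
definition mat_exp :: "real mat \<Rightarrow> real mat" where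
  "mat_exp B = Matrix.mat (dim_row B) (dim_col B) (\<lambda>ij. \<Sum>k. (B ^\<^sub>m k) $$ ij / fact k)"

(* A point of Euclidean_space n is a function vanishing from index n on; Matrix.vec n turns it
   into the column vector of its first n entries, and is injective on Euclidean_space n. *)
definition linearizing ::
  "'a topology \<Rightarrow> (real \<Rightarrow> 'a \<Rightarrow> 'a) \<Rightarrow> nat \<Rightarrow> ('a \<Rightarrow> nat \<Rightarrow> real) \<Rightarrow> bool" where
  "linearizing X \<Phi> n F \<longleftrightarrow>
     F \<in> topspace X \<rightarrow> topspace (Euclidean_space n) \<and>
     (\<exists>B\<in>carrier_mat n n. \<forall>t. \<forall>x\<in>topspace X.
        Matrix.vec n (F (\<Phi> t x)) = mat_exp (t \<cdot>\<^sub>m B) *\<^sub>v Matrix.vec n (F x))"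

definition linearizable_by_embedding :: "'a topology \<Rightarrow> (real \<Rightarrow> 'a \<Rightarrow> 'a) \<Rightarrow> bool" where
  "linearizable_by_embedding X \<Phi> \<longleftrightarrow>
     (\<exists>n F. linearizing X \<Phi> n F \<and> embedding_map X (Euclidean_space n) F)"

(* The library's proper_map (closed with compact fibres) is a different definition. *)
definition compact_preimages :: "'a topology \<Rightarrow> 'b topology \<Rightarrow> ('a \<Rightarrow> 'b) \<Rightarrow> bool" where
  "compact_preimages X Y f \<longleftrightarrow> (\<forall>K. compactin Y K \<longrightarrow> compactin X {x \<in> topspace X. f x \<in> K})"

definition has_asymptotic_phase :: "'a topology \<Rightarrow> (real \<Rightarrow> 'a \<Rightarrow> 'a) \<Rightarrow> 'a set \<Rightarrow> bool" where
  "has_asymptotic_phase X \<Phi> A \<longleftrightarrow>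
     (\<exists>P. continuous_map X (subtopology X A) P \<and> (\<forall>a\<in>A. P a = a) \<and>
        (\<forall>t. \<forall>x\<in>topspace X. P (\<Phi> t x) = \<Phi> t (P x)))"

definition quotient_topology :: "'a topology \<Rightarrow> ('a \<Rightarrow> 'b) \<Rightarrow> 'b topology" where
  "quotient_topology X q =
     topology (\<lambda>U. U \<subseteq> q ` topspace X \<and> openin X {x \<in> topspace X. q x \<in> U})"

lemma openin_quotient_topology:
  "openin (quotient_topology X q) U \<longleftrightarrow>
     U \<subseteq> q ` topspace X \<and> openin X {x \<in> topspace X. q x \<in> U}"
proof -
  have "istopology (\<lambda>U. U \<subseteq> q ` topspace X \<and> openin X {x \<in> topspace X. q x \<in> U})"
    unfolding istopology_def
  proof (intro conjI allI impI)
    fix S T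
    assume S: "S \<subseteq> q ` topspace X \<and> openin X {x \<in> topspace X. q x \<in> S}"
      and T: "T \<subseteq> q ` topspace X \<and> openin X {x \<in> topspace X. q x \<in> T}"
    show "S \<inter> T \<subseteq> q ` topspace X" using S by blast
    have "{x \<in> topspace X. q x \<in> S \<inter> T} = {x \<in> topspace X. q x \<in> S} \<inter> {x \<in> topspace X. q x \<in> T}"
      by blast
    then show "openin X {x \<in> topspace X. q x \<in> S \<inter> T}" using S T by auto
  next
    fix K
    assume K: "\<forall>S\<in>K. S \<subseteq> q ` topspace X \<and> openin X {x \<in> topspace X. q x \<in> S}"
    show "\<Union>K \<subseteq> q ` topspace X" using K by blast
    have "{x \<in> topspace X. q x \<in> \<Union>K} = (\<Union>S\<in>K. {x \<in> topspace X. q x \<in> S})"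
      by blast
    then show "openin X {x \<in> topspace X. q x \<in> \<Union>K}" using K by auto
  qed
  then show ?thesis
    by (simp add: quotient_topology_def topology_inverse')
qed

lemma topspace_quotient_topology [simp]: "topspace (quotient_topology X q) = q ` topspace X"
proof
  show "topspace (quotient_topology X q) \<subseteq> q ` topspace X"
    using openin_quotient_topology[of X q "topspace (quotient_topology X q)"] by simp
  have "{x \<in> topspace X. q x \<in> q ` topspace X} = topspace X" by blast
  then have "openin (quotient_topology X q) (q ` topspace X)"
    by (simp add: openin_quotient_topology)
  then show "q ` topspace X \<subseteq> topspace (quotient_topology X q)"
    by (rule openin_subset)
qed

lemma quotient_map_quotient_topology: "quotient_map X (quotient_topology X q) q"
  by (auto simp: quotient_map_def openin_quotient_topology)

definition real_vector_group :: "nat \<Rightarrow> (nat \<Rightarrow> real) monoid" where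
  "real_vector_group l =
     \<lparr>carrier = topspace (Euclidean_space l), mult = (\<lambda>x y i. x i + y i), one = (\<lambda>i. 0)\<rparr>"

definition integer_lattice :: "nat \<Rightarrow> (nat \<Rightarrow> real) set" where
  "integer_lattice l = {x \<in> topspace (Euclidean_space l). \<forall>i. x i \<in> \<int>}"

definition torus_group :: "nat \<Rightarrow> (nat \<Rightarrow> real) set monoid" where
  "torus_group l = real_vector_group l Mod integer_lattice l"

(* The class of x modulo 1. *)
definition torus_proj :: "nat \<Rightarrow> (nat \<Rightarrow> real) \<Rightarrow> (nat \<Rightarrow> real) set" where
  "torus_proj l x = integer_lattice l #>\<^bsub>real_vector_group l\<^esub> x"

definition torus_topology :: "nat \<Rightarrow> (nat \<Rightarrow> real) set topology" where
  "torus_topology l = quotient_topology (Euclidean_space l) (torus_proj l)"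

lemma topspace_torus_topology: "topspace (torus_topology l) = carrier (torus_group l)"
  by (auto simp: torus_topology_def torus_group_def torus_proj_def FactGroup_def RCOSETS_def
      real_vector_group_def)

definition torus_action ::
  "nat \<Rightarrow> 'a topology \<Rightarrow> ((nat \<Rightarrow> real) set \<Rightarrow> 'a \<Rightarrow> 'a) \<Rightarrow> bool" where
  "torus_action l Y \<Theta> \<longleftrightarrow> continuous_action (torus_group l) (torus_topology l) Y \<Theta>"

definition finitely_many_orbit_types ::
  "nat \<Rightarrow> 'a topology \<Rightarrow> ((nat \<Rightarrow> real) set \<Rightarrow> 'a \<Rightarrow> 'a) \<Rightarrow> bool" where
  "finitely_many_orbit_types l Y \<Theta> \<longleftrightarrow>
     finite ((\<lambda>y. {g \<in> carrier (torus_group l). \<Theta> g y = y}) ` topspace Y)"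

definition one_parameter_subgroup ::
  "nat \<Rightarrow> 'a topology \<Rightarrow> ((nat \<Rightarrow> real) set \<Rightarrow> 'a \<Rightarrow> 'a) \<Rightarrow> (real \<Rightarrow> 'a \<Rightarrow> 'a) \<Rightarrow> bool" where
  "one_parameter_subgroup l Y \<Theta> \<Psi> \<longleftrightarrow>
     (\<exists>\<omega>\<in>topspace (Euclidean_space l). \<forall>t. \<forall>y\<in>topspace Y.
        \<Psi> t y = \<Theta> (torus_proj l (\<lambda>i. \<omega> i * t)) y)"

end

theory Submission
  imports Defs "HOL-Computational_Algebra.Fundamental_Theorem_Algebra"
begin

text \<open>
  A function \<open>V \<ge> 0\<close> with \<open>V \<circ> \<Phi>\<^sup>t = e\<^sup>-\<^sup>t V\<close> and zero set \<open>A\<close> measures the approach to \<open>A\<close>. For a linearizing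
  injection \<open>F\<close>, finitely many orbits span all orbits, so \<open>\<Phi>\<^sup>t\<close> is uniformly Lipschitz in forward time with
  respect to \<open>F\<close>; recurrence along times \<open>s\<^sub>j \<rightarrow> \<infinity>\<close> then yields properness and the asymptotic phase as the
  limit of \<open>\<Phi>\<^sup>t\<close> along them. Bounded orbits of a linear flow are trigonometric polynomials, which turns \<open>F\<close> on \<open>A\<close> into
  finitely many eigenfunctions; by Kronecker's theorem the torus generated by their frequencies preserves \<open>A\<close>.
  Conversely, if a torus acts on \<open>A\<close> with finitely many stabilizers, then for each stabilizer and each character in
  a basis of those trivial on it, generic finite families of weight functions have no common zero on the stratum of
  that stabilizer, because the stratum is covered by countably many compact slices of bounded dimension. Such
  families rigidify the strata, so finitely many weight functions separate the points of \<open>A\<close>.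
  Pulled back by the phase map, and combined with \<open>V\<close> times an embedding of the
  level set \<open>V = 1\<close>, these embed \<open>X\<close>.
\<close>

text \<open>Properness is shown by contradiction: points with bounded \<open>F\<close> and unbounded
  \<open>V\<close>, pushed forward to the level set \<open>V = 1\<close>, accumulate at a recurrent
  point outside \<open>A\<close>, which attraction forbids. For the phase, the times must be almost
  periods on \<open>A\<close>; they are differences of times along which all orbits converge, and a
  Lipschitz bound on \<open>A\<close> in both time directions then makes the limit the identity
  there. In the converse direction, a single function of given weight without zeros on a stratum may
  not exist: it would trivialize a circle bundle. Hence \<open>N + 1\<close> functions per
  character, where \<open>N\<close> bounds the dimension of the ambient space: a Lipschitz image of
  an \<open>N\<close>-dimensional set misses points of \<open>N + 1\<close> dimensions. On a slice
  the values of a weight function can be prescribed freely, so it can be perturbed there. With one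
  nonzero function chosen per basis character, rotating its value to the positive axis singles out a
  point of the orbit, and the ambient coordinates of that point serve as invariant
  functions.\<close>

section \<open>Attraction, and a Lyapunov function that decays exactly exponentially\<close>

locale attracting_flow =
  fixes X :: "'a topology" and \<Phi> :: "real \<Rightarrow> 'a \<Rightarrow> 'a" and A :: "'a set"
  assumes lc: "locally_compact_space X" and hd: "Hausdorff_space X"
    and flow: "continuous_flow X \<Phi>" and inv: "compact_invariant X \<Phi> A"
    and gas: "globally_asymptotically_stable X \<Phi> A"
begin

lemma flow_continuous: "continuous_map (prod_topology euclideanreal X) X (\<lambda>(t, x). \<Phi> t x)"
  using flow unfolding continuous_flow_def continuous_action_def by simp

lemma flow_0 [simp]: "x \<in> topspace X \<Longrightarrow> \<Phi> 0 x = x"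
  using flow unfolding continuous_flow_def continuous_action_def by simp

lemma flow_add: "x \<in> topspace X \<Longrightarrow> \<Phi> (s + t) x = \<Phi> s (\<Phi> t x)"
  using flow unfolding continuous_flow_def continuous_action_def by simp

lemma flow_compose:
  assumes "continuous_map Z euclideanreal f" "continuous_map Z X g"
  shows "continuous_map Z X (\<lambda>z. \<Phi> (f z) (g z))"
proof -
  have "continuous_map Z (prod_topology euclideanreal X) (\<lambda>z. (f z, g z))"
    using assms by (simp add: continuous_map_pairwise o_def)
  from continuous_map_compose[OF this flow_continuous] show ?thesis by (simp add: o_def)
qed

lemma flow_in [simp]: "x \<in> topspace X \<Longrightarrow> \<Phi> t x \<in> topspace X"
  using flow_compose[of X "\<lambda>_. t" id] continuous_map_funspace[of X X] by fastforce

lemma flow_continuous_at: "continuous_map X X (\<Phi> t)"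
  using flow_compose[of X "\<lambda>_. t" id] by simp

lemma A_compact: "compactin X A" and A_invariant: "\<Phi> t ` A = A"
  using inv unfolding compact_invariant_def by auto

lemma A_subset: "A \<subseteq> topspace X"
  using A_compact compactin_subset_topspace by blast

lemma A_topspace: "x \<in> A \<Longrightarrow> x \<in> topspace X"
  using A_subset by blast

lemma flow_A: "x \<in> A \<Longrightarrow> \<Phi> t x \<in> A"
  using A_invariant by blast

lemma stable:
  assumes "openin X U" "A \<subseteq> U"
  obtains W where "openin X W" "A \<subseteq> W" "\<And>t x. \<lbrakk>t \<ge> 0; x \<in> W\<rbrakk> \<Longrightarrow> \<Phi> t x \<in> U"
proof -
  have "nbhd_of_set X A U"
    using assms openin_subset unfolding nbhd_of_set_def by blast
  moreover have "asymptotically_stable X \<Phi> A"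
    using gas unfolding globally_asymptotically_stable_def by (rule conjunct1)
  ultimately have "\<exists>V. nbhd_of_set X A V \<and> V \<subseteq> U \<and> (\<forall>t\<ge>0. \<Phi> t ` V \<subseteq> U)"
    unfolding asymptotically_stable_def by simp
  then obtain V W where W: "openin X W" "A \<subseteq> W" "W \<subseteq> V" "\<forall>t\<ge>0. \<Phi> t ` V \<subseteq> U"
    unfolding nbhd_of_set_def by auto
  show thesis
  proof
    show "\<Phi> t x \<in> U" if "t \<ge> 0" "x \<in> W" for t x
      using that \<open>W \<subseteq> V\<close> \<open>\<forall>t\<ge>0. \<Phi> t ` V \<subseteq> U\<close> by blast
  qed fact+
qed

lemma attracted:
  assumes "openin X U" "A \<subseteq> U" "x \<in> topspace X"
  shows "\<forall>\<^sub>F t in at_top. \<Phi> t x \<in> U"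
proof -
  have "nbhd_of_set X A U"
    using assms openin_subset unfolding nbhd_of_set_def by blast
  then show ?thesis
    using gas assms unfolding globally_asymptotically_stable_def converges_to_set_def by blast
qed

text \<open>Stability upgrades pointwise attraction: once \<open>x\<close> has entered a set
  \<open>W0\<close> that never leaves \<open>U\<close> in forward time, all points entering
  \<open>W0\<close> at that same time \<open>T\<close> form an open set.\<close>

lemma attracted_uniformly:
  assumes "openin X U" "A \<subseteq> U" "x \<in> topspace X"
  obtains T W where "T \<ge> 0" "openin X W" "x \<in> W" "\<And>t y. \<lbrakk>t \<ge> T; y \<in> W\<rbrakk> \<Longrightarrow> \<Phi> t y \<in> U"
proof -
  obtain W0 where W0: "openin X W0" "A \<subseteq> W0" "\<And>t x. \<lbrakk>t \<ge> 0; x \<in> W0\<rbrakk> \<Longrightarrow> \<Phi> t x \<in> U"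
    using stable assms by metis
  obtain T0 where T0: "\<And>t. t \<ge> T0 \<Longrightarrow> \<Phi> t x \<in> W0"
    using attracted[OF W0(1,2) assms(3)] by (auto simp: eventually_at_top_linorder)
  define T where "T = max T0 0"
  define W where "W = {y \<in> topspace X. \<Phi> T y \<in> W0}"
  show thesis
  proof
    show "T \<ge> 0" by (simp add: T_def)
    show "openin X W"
      unfolding W_def using flow_continuous_at W0(1) by (rule openin_continuous_map_preimage)
    show "x \<in> W" using T0[of T] assms(3) by (simp add: W_def T_def)
    fix t y assume "t \<ge> T" "y \<in> W"
    then show "\<Phi> t y \<in> U"
      using W0(3)[of "t - T" "\<Phi> T y"] flow_add[of y "t - T" T] by (simp add: W_def)
  qed
qed

text \<open>If the whole orbit stayed in \<open>K\<close>, its past would avoid a neighbourhood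
  \<open>W\<close> of \<open>A\<close> from which \<open>x\<close> cannot be reached again. But
  every point of \<open>K\<close> enters \<open>W\<close> at some natural time, and by compactness
  finitely many such times suffice, so a sufficiently early point of the past must enter
  \<open>W\<close> before time 0.\<close>

lemma leaves_compact:
  assumes K: "compactin X K" and x: "x \<in> topspace X" "x \<notin> A"
  obtains t where "\<Phi> t x \<notin> K"
proof (rule ccontr)
  assume "\<not> thesis"
  with that have stay: "\<Phi> t x \<in> K" for t by blast
  have "closedin X {x}"
    using hd x(1) by (simp add: closedin_Hausdorff_singleton)
  then have "openin X (topspace X - {x})" by blast
  then obtain W where W: "openin X W" "A \<subseteq> W"
      "\<And>t y. \<lbrakk>t \<ge> 0; y \<in> W\<rbrakk> \<Longrightarrow> \<Phi> t y \<in> topspace X - {x}"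
    using stable[of "topspace X - {x}"] x(2) A_subset by blast
  have notW: "\<Phi> (-t) x \<notin> W" if "t \<ge> 0" for t
  proof
    assume "\<Phi> (-t) x \<in> W"
    then have "\<Phi> t (\<Phi> (-t) x) \<noteq> x" using W(3) that by blast
    then show False using flow_add[of x t "-t"] x(1) by simp
  qed
  define O' where "O' n = {y \<in> topspace X. \<Phi> (real n) y \<in> W}" for n
  have "openin X (O' n)" for n
    unfolding O'_def using flow_continuous_at W(1) by (rule openin_continuous_map_preimage)
  moreover have "K \<subseteq> (\<Union>n. O' n)"
  proof
    fix y assume "y \<in> K"
    then have y: "y \<in> topspace X" using K compactin_subset_topspace by blast
    then obtain T where "\<And>t. t \<ge> T \<Longrightarrow> \<Phi> t y \<in> W"
      using attracted[OF W(1,2) y] by (auto simp: eventually_at_top_linorder)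
    then have "\<Phi> (real (nat \<lceil>T\<rceil>)) y \<in> W" by (simp add: of_nat_ceiling)
    then show "y \<in> (\<Union>n. O' n)" using y by (auto simp: O'_def)
  qed
  ultimately obtain \<F> where F: "finite \<F>" "\<F> \<subseteq> range O'" "K \<subseteq> \<Union>\<F>"
    using compactinD[OF K, of "range O'"] by blast
  then obtain N where N: "finite N" "\<F> = O' ` N"
    using finite_subset_image by metis
  \<comment> \<open>Starting at time \<open>-m\<close>, any of the finitely many entrance times
    \<open>n\<close> leads to the time \<open>n - m\<close>, which is still not positive.\<close>
  obtain m where m: "\<forall>n\<in>N. n \<le> m"
    using N(1) finite_nat_set_iff_bounded_le by blast
  obtain n where "n \<in> N" "\<Phi> (- real m) x \<in> O' n"
    using stay F(3) N(2) by blast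
  then have "\<Phi> (- (real m - real n)) x \<in> W"
    using flow_add[of x "real n" "- real m"] x(1) by (simp add: O'_def)
  moreover have "real m - real n \<ge> 0" using m \<open>n \<in> N\<close> by simp
  ultimately show False using notW by blast
qed

lemma completely_regular: "completely_regular_space X"
  using lc hd locally_compact_Hausdorff_imp_regular_space locally_compact_regular_imp_completely_regular_space
  by blast

lemma exists_bump:
  obtains h N K where "continuous_map X euclideanreal h" "\<And>x. x \<in> topspace X \<Longrightarrow> 0 \<le> h x \<and> h x \<le> 1"
    "openin X N" "A \<subseteq> N" "\<And>x. x \<in> N \<Longrightarrow> h x = 0"
    "compactin X K" "\<And>x. x \<in> topspace X - K \<Longrightarrow> h x = 1"
proof -
  obtain U K where UK: "openin X U" "compactin X K" "A \<subseteq> U" "U \<subseteq> K"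
    using lc hd A_compact locally_compact_space_compact_closed_compact[of X] by blast
  have "closedin X (topspace X - U)" "disjnt A (topspace X - U)"
    using UK by (auto simp: disjnt_def)
  then obtain f where f: "continuous_map X (top_of_set {0..1::real}) f" "f ` A \<subseteq> {0}"
      "f ` (topspace X - U) \<subseteq> {1}"
    using Urysohn_completely_regular_closed_compact[OF zero_le_one completely_regular _ A_compact, of "topspace X - U"]
      disjnt_sym by metis
  \<comment> \<open>The Urysohn function vanishes only on \<open>A\<close>; the truncation produces
    zeros on the open set \<open>f < 1/2\<close>, so that \<open>h\<close> along an orbit is
    eventually 0.\<close>
  define h where "h x = max 0 (2 * f x - 1)" for x
  have fc: "continuous_map X euclideanreal f" and f01: "x \<in> topspace X \<Longrightarrow> 0 \<le> f x \<and> f x \<le> 1" for x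
    using f(1) by (auto simp: continuous_map_in_subtopology)
  show thesis
  proof
    show "continuous_map X euclideanreal h"
      unfolding h_def by (intro continuous_intros fc)
    show "0 \<le> h x \<and> h x \<le> 1" if "x \<in> topspace X" for x
      using f01[OF that] by (auto simp: h_def)
    show "openin X {x \<in> topspace X. f x \<in> {..<1/2}}"
      by (rule openin_continuous_map_preimage[OF fc]) auto
    show "A \<subseteq> {x \<in> topspace X. f x \<in> {..<1/2}}"
      using f(2) A_subset by auto
    show "h x = 0" if "x \<in> {x \<in> topspace X. f x \<in> {..<1/2}}" for x
      using that by (auto simp: h_def)
    show "compactin X K" by fact
    show "h x = 1" if "x \<in> topspace X - K" for x
      using f(3) that UK by (fastforce simp: h_def image_subset_iff)
  qed
qed

text \<open>For a bump function \<open>h\<close> vanishing near \<open>A\<close>, the supremum of \<open>e\<^sup>t h(\<Phi>\<^sup>t x)\<close> over \<^emph>\<open>all\<close> real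
  \<open>t\<close> is automatically homogeneous along the flow.\<close>

theorem exponential_lyapunov_function:
  obtains V where "continuous_map X euclideanreal V" "\<And>x. x \<in> topspace X \<Longrightarrow> V x \<ge> 0"
    "\<And>x. x \<in> topspace X \<Longrightarrow> V x = 0 \<longleftrightarrow> x \<in> A"
    "\<And>t x. x \<in> topspace X \<Longrightarrow> V (\<Phi> t x) = exp (- t) * V x"
    "\<And>c. compactin X {x \<in> topspace X. V x \<le> c}"
proof -
  obtain h N K where h: "continuous_map X euclideanreal h"
      "\<And>x. x \<in> topspace X \<Longrightarrow> 0 \<le> h x \<and> h x \<le> 1"
    and N: "openin X N" "A \<subseteq> N" "\<And>x. x \<in> N \<Longrightarrow> h x = 0"
    and K: "compactin X K" "\<And>x. x \<in> topspace X - K \<Longrightarrow> h x = 1"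
    using exists_bump by blast
  define w where "w t x = exp t * h (\<Phi> t x)" for t x
  define V where "V x = (SUP t. w t x)" for x
  have w0: "0 \<le> w t x" if "x \<in> topspace X" for t x
    using h(2) that by (simp add: w_def)
  have wle: "w t x \<le> exp t" if "x \<in> topspace X" for t x
    using h(2)[of "\<Phi> t x"] that by (simp add: w_def mult_left_le)
  have tail: "\<exists>T W. T \<ge> 0 \<and> openin X W \<and> x \<in> W \<and> (\<forall>t\<ge>T. \<forall>y\<in>W. w t y = 0)"
    if x: "x \<in> topspace X" for x
  proof -
    obtain T W where "T \<ge> 0" "openin X W" "x \<in> W" "\<And>t y. \<lbrakk>t \<ge> T; y \<in> W\<rbrakk> \<Longrightarrow> \<Phi> t y \<in> N"
      using attracted_uniformly[OF N(1,2) x] by metis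
    then show ?thesis using N(3) unfolding w_def by (intro exI[of _ T] exI[of _ W]) simp
  qed
  have bdd: "bdd_above (range (\<lambda>t. w t x))" if x: "x \<in> topspace X" for x
  proof -
    obtain T where T: "\<And>t. t \<ge> T \<Longrightarrow> w t x = 0" using tail[OF x] by blast
    have "w t x \<le> exp T" for t
      using T[of t] wle[OF x, of t] by (cases "t \<ge> T") (auto intro: order_trans)
    then show ?thesis by (auto intro!: bdd_aboveI2)
  qed
  have wV: "w t x \<le> V x" if "x \<in> topspace X" for t x
    unfolding V_def using bdd[OF that] by (intro cSUP_upper) auto
  have V0: "V x \<ge> 0" if "x \<in> topspace X" for x
    using wV[OF that, of 0] w0[OF that, of 0] by simp
  have wcont: "continuous_map (prod_topology X euclideanreal) euclideanreal (\<lambda>(x, t). w t x)"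
  proof -
    have "continuous_map (prod_topology X euclideanreal) X (\<lambda>z. \<Phi> (snd z) (fst z))"
      by (intro flow_compose continuous_map_snd continuous_map_fst)
    from continuous_map_compose[OF this h(1)]
    have "continuous_map (prod_topology X euclideanreal) euclideanreal (\<lambda>z. exp (snd z) * h (\<Phi> (snd z) (fst z)))"
      using continuous_map_compose[OF continuous_map_snd[of X euclideanreal], of euclideanreal exp]
      by (intro continuous_map_real_mult) (auto simp: o_def continuous_on_exp)
    then show ?thesis by (simp add: w_def case_prod_unfold)
  qed
  have Vcont: "continuous_map X euclideanreal V"
  proof -
    have "openin X {x \<in> topspace X. V x > c}" for c
    proof -
      have eq: "{x \<in> topspace X. V x > c} = (\<Union>t. {x \<in> topspace X. w t x \<in> {c<..}})"
        using bdd less_cSUP_iff[of UNIV "\<lambda>t. w t _" c] unfolding V_def by auto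
      have "continuous_map X euclideanreal (w t)" for t
        using continuous_map_compose[of X _ "\<lambda>x. (x, t)", OF _ wcont]
        by (simp add: o_def continuous_map_pairwise )
      then have o: "openin X {x \<in> topspace X. w t x \<in> {c<..}}" for t
        by (rule openin_continuous_map_preimage) simp
      show ?thesis unfolding eq
      proof (rule openin_Union)
        fix S assume "S \<in> range (\<lambda>t. {x \<in> topspace X. w t x \<in> {c<..}})"
        then obtain t where "S = {x \<in> topspace X. w t x \<in> {c<..}}" by (rule imageE)
        then show "openin X S" using o[of t] by (rule ssubst)
      qed
    qed
    \<comment> \<open>Times beyond \<open>T\<close> contribute 0 and times before
      \<open>ln d\<close> at most \<open>d\<close>. Only the compact interval
      \<open>{ln d..T}\<close> remains, and the tube lemma controls it uniformly near
      \<open>x\<close>.\<close>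
    moreover have "openin X {x \<in> topspace X. V x < c}" for c
    proof (subst openin_subopen, clarify)
      fix x assume x: "x \<in> topspace X" "V x < c"
      obtain T W where TW: "T \<ge> 0" "openin X W" "x \<in> W" "\<forall>t\<ge>T. \<forall>y\<in>W. w t y = 0"
        using tail[OF x(1)] by blast
      obtain d where d: "V x < d" "d < c" using x(2) dense by blast
      have d0: "d > 0" using V0[OF x(1)] d by simp
      have "openin (prod_topology X euclideanreal) {z \<in> topspace (prod_topology X euclideanreal). (\<lambda>(x, t). w t x) z \<in> {..<d}}"
        by (rule openin_continuous_map_preimage[OF wcont]) auto
      moreover have "{x} \<times> {ln d..T} \<subseteq> {z \<in> topspace (prod_topology X euclideanreal). (\<lambda>(x, t). w t x) z \<in> {..<d}}"
        using wV[OF x(1)] d(1) x(1) by (auto intro: le_less_trans)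
      moreover have "compactin euclideanreal {ln d..T}" by simp
      ultimately have "\<exists>U1 U2. openin X U1 \<and> openin euclideanreal U2 \<and> x \<in> U1 \<and> {ln d..T} \<subseteq> U2 \<and>
          U1 \<times> U2 \<subseteq> {z \<in> topspace (prod_topology X euclideanreal). (\<lambda>(x, t). w t x) z \<in> {..<d}}"
        by (intro tube_lemma_right x(1))
      then obtain U1 U2 where U: "openin X U1" "x \<in> U1" "{ln d..T} \<subseteq> U2"
          "U1 \<times> U2 \<subseteq> {z \<in> topspace (prod_topology X euclideanreal). (\<lambda>(x, t). w t x) z \<in> {..<d}}"
        by blast
      have "V y < c" if y: "y \<in> W \<inter> U1" for y
      proof -
        have yX: "y \<in> topspace X" using y TW(2) openin_subset by blast
        have "w t y \<le> d" for t
        proof -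
          consider "t \<ge> T" | "t \<le> ln d" | "t \<in> {ln d..T}" by fastforce
          then show ?thesis
          proof cases
            case 1 then show ?thesis using TW(4) y d0 by auto
          next
            case 2
            then have "exp t \<le> exp (ln d)" by (simp only: exp_le_cancel_iff)
            then show ?thesis using wle[OF yX, of t] d0 by simp
          next
            case 3 then show ?thesis using U(3,4) y by force
          qed
        qed
        then have "V y \<le> d" unfolding V_def by (intro cSUP_least) auto
        then show ?thesis using d(2) by simp
      qed
      then show "\<exists>T. openin X T \<and> x \<in> T \<and> T \<subseteq> {x \<in> topspace X. V x < c}"
        using TW(2,3) U(1,2) openin_subset by (intro exI[of _ "W \<inter> U1"]) auto
    qed
    ultimately show ?thesis
      by (simp add: continuous_map_upper_lower_semicontinuous_lt)
  qed
  have Vflow: "V (\<Phi> s x) = exp (- s) * V x" if x: "x \<in> topspace X" for s x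
  proof -
    have le: "V (\<Phi> s y) \<le> exp (- s) * V y" if y: "y \<in> topspace X" for s y
    proof -
      have "w t (\<Phi> s y) \<le> exp (- s) * V y" for t
      proof -
        have "w t (\<Phi> s y) = exp (- s) * w (t + s) y"
          using flow_add[OF y, of t s] by (simp add: w_def exp_add exp_minus)
        then show ?thesis using wV[OF y, of "t + s"] by simp
      qed
      then show ?thesis by (subst V_def) (auto intro: cSUP_least)
    qed
    \<comment> \<open>The inequality \<open>le\<close> for the time \<open>-s\<close> is the reverse
      inequality for \<open>s\<close>.\<close>
    have "V (\<Phi> (-s) (\<Phi> s x)) \<le> exp s * V (\<Phi> s x)"
      using le[of "\<Phi> s x" "-s"] x by simp
    then have "V x \<le> exp s * V (\<Phi> s x)"
      using flow_add[OF x, of "-s" s] x by simp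
    then have "exp (- s) * V x \<le> V (\<Phi> s x)"
      by (simp add: exp_minus field_simps)
    then show ?thesis using le[OF x, of s] by simp
  qed
  have VA: "V x = 0 \<longleftrightarrow> x \<in> A" if x: "x \<in> topspace X" for x
  proof
    assume V: "V x = 0"
    show "x \<in> A"
    proof (rule ccontr)
      assume "x \<notin> A"
      then obtain t where "\<Phi> t x \<notin> K" using leaves_compact[OF K(1) x] by blast
      then have "w t x > 0" using K(2) x by (simp add: w_def)
      then show False using wV[OF x, of t] V by simp
    qed
  next
    assume "x \<in> A"
    then have "w t x = 0" for t using N(2,3) flow_A by (auto simp: w_def)
    then show "V x = 0" by (simp add: V_def)
  qed
  have Vcpt: "compactin X {x \<in> topspace X. V x \<le> c}" for c
  proof -
    \<comment> \<open>Time \<open>s\<close> divides \<open>V\<close> by \<open>2 * max c 1\<close>,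
      so values up to \<open>c\<close> fall below 1; there \<open>h\<close> is not 1, which forces
      the point into \<open>K\<close>.\<close>
    define s where "s = ln (2 * max c 1)"
    have sub: "{x \<in> topspace X. V x \<le> c} \<subseteq> \<Phi> (-s) ` K"
    proof clarify
      fix x assume x: "x \<in> topspace X" "V x \<le> c"
      have "V (\<Phi> s x) = V x / (2 * max c 1)"
        using Vflow[OF x(1), of s] by (simp add: s_def exp_minus field_simps)
      also have "\<dots> < 1" using x(2) by (simp add: divide_less_eq)
      finally have V1: "V (\<Phi> s x) < 1" .
      have "\<Phi> s x \<in> K"
      proof (rule ccontr)
        assume "\<Phi> s x \<notin> K"
        then have "w 0 (\<Phi> s x) = 1" using K(2) x by (simp add: w_def)
        then show False using wV[of "\<Phi> s x" 0] V1 x by simp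
      qed
      then show "x \<in> \<Phi> (-s) ` K"
        using flow_add[OF x(1), of "-s" s] x(1) by (intro image_eqI[of _ _ "\<Phi> s x"]) auto
    qed
    have "compactin X (\<Phi> (-s) ` K)"
      using image_compactin[OF K(1) flow_continuous_at] .
    moreover have "closedin X {x \<in> topspace X. V x \<in> {..c}}"
      by (rule closedin_continuous_map_preimage[OF Vcont]) auto
    ultimately show ?thesis
      using sub closed_compactin[of X "\<Phi> (-s) ` K" "{x \<in> topspace X. V x \<le> c}"] by simp
  qed
  show thesis using that Vcont V0 VA Vflow Vcpt by blast
qed

end

section \<open>Finite rank and uniform Lipschitz bounds for linear flows\<close>

text \<open>Records that a coefficient depends on \<open>x\<close> only through the row
  \<open>F x\<close>, and linearly; continuity and Lipschitz bounds of \<open>F\<close> then pass to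
  the coefficient.\<close>

definition linear_form :: "'k set \<Rightarrow> ('x \<Rightarrow> 'k \<Rightarrow> 'f::field) \<Rightarrow> ('x \<Rightarrow> 'f) \<Rightarrow> bool" where
  "linear_form J F c \<longleftrightarrow> (\<exists>\<gamma>. \<forall>x. c x = (\<Sum>j\<in>J. \<gamma> j * F x j))"

lemma linear_form_zero: "linear_form J F (\<lambda>x. 0)"
  unfolding linear_form_def by (rule exI[of _ "\<lambda>_. 0"]) simp

lemma linear_form_add:
  assumes "linear_form J F c" "linear_form J F d"
  shows "linear_form J F (\<lambda>x. c x + d x)"
proof -
  obtain \<gamma> \<delta> where "\<forall>x. c x = (\<Sum>j\<in>J. \<gamma> j * F x j)" "\<forall>x. d x = (\<Sum>j\<in>J. \<delta> j * F x j)"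
    using assms unfolding linear_form_def by blast
  then show ?thesis unfolding linear_form_def
    by (intro exI[of _ "\<lambda>j. \<gamma> j + \<delta> j"]) (simp add: algebra_simps sum.distrib)
qed

lemma linear_form_scale:
  assumes "linear_form J F c"
  shows "linear_form J F (\<lambda>x. r * c x)"
proof -
  obtain \<gamma> where "\<forall>x. c x = (\<Sum>j\<in>J. \<gamma> j * F x j)"
    using assms unfolding linear_form_def by blast
  then show ?thesis unfolding linear_form_def
    by (intro exI[of _ "\<lambda>j. r * \<gamma> j"]) (simp add: sum_distrib_left mult.assoc)
qed

lemma linear_form_sum:
  assumes "\<And>p. p \<in> P \<Longrightarrow> linear_form J F (c p)"
  shows "linear_form J F (\<lambda>x. \<Sum>p\<in>P. c p x)"
  using assms
proof (induction P rule: infinite_finite_induct)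
  case (insert p P)
  then show ?case using linear_form_add[of J F "c p"] by simp
qed (auto simp: linear_form_zero)

lemma linear_form_coord:
  assumes "finite J" "j \<in> J"
  shows "linear_form J F (\<lambda>x. F x j)"
  unfolding linear_form_def using assms
  by (intro exI[of _ "\<lambda>i. if i = j then 1 else 0"]) (simp add: if_distrib[of "\<lambda>z. z * _"] cong: if_cong)

text \<open>Gaussian elimination on a possibly infinite family of rows with finitely many columns.
  If column \<open>j\<close> is not zero on \<open>Y\<close>, a pivot row \<open>x1\<close> clears
  it, and the cleared rows \<open>F'\<close> are handled by induction. The basis rows
  \<open>P\<close> are rows of the family itself, so later they are honest orbits.\<close>

lemma rank_factorization:
  fixes F :: "'x \<Rightarrow> 'k \<Rightarrow> 'f::field"
  assumes "finite J"
  shows "\<exists>P c. finite P \<and> P \<subseteq> Y \<and> (\<forall>p\<in>P. linear_form J F (c p)) \<and>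
           (\<forall>x\<in>Y. \<forall>k\<in>J. F x k = (\<Sum>p\<in>P. c p x * F p k))"
  using assms
proof (induction J arbitrary: F rule: finite_induct)
  case empty
  then show ?case by (intro exI[of _ "{}"]) auto
next
  case (insert j J F)
  show ?case
  proof (cases "\<forall>x\<in>Y. F x j = 0")
    case True
    obtain P c where P: "finite P" "P \<subseteq> Y" "\<forall>p\<in>P. linear_form J F (c p)"
        "\<forall>x\<in>Y. \<forall>k\<in>J. F x k = (\<Sum>p\<in>P. c p x * F p k)"
      using insert.IH[of F] by blast
    have "linear_form (insert j J) F (c p)" if p: "p \<in> P" for p
    proof -
      obtain \<gamma> where "\<forall>x. c p x = (\<Sum>j\<in>J. \<gamma> j * F x j)"
        using P(3) p unfolding linear_form_def by blast
      then show ?thesis unfolding linear_form_def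
        using insert.hyps
        by (intro exI[of _ "\<lambda>i. if i = j then 0 else \<gamma> i"]) (auto intro!: sum.cong)
    qed
    moreover have "F x k = (\<Sum>p\<in>P. c p x * F p k)" if "x \<in> Y" "k \<in> insert j J" for x k
    proof (cases "k = j")
      case True
      then show ?thesis using \<open>\<forall>x\<in>Y. F x j = 0\<close> that P(2) by (simp add: subset_iff)
    next
      case False
      then show ?thesis using P(4) that by blast
    qed
    ultimately show ?thesis using P(1,2) by blast
  next
    case False
    then obtain x1 where x1: "x1 \<in> Y" "F x1 j \<noteq> 0" by blast
    define F' where "F' x k = F x k - F x j / F x1 j * F x1 k" for x k
    obtain P c where P: "finite P" "P \<subseteq> Y" "\<forall>p\<in>P. linear_form J F' (c p)"
        "\<forall>x\<in>Y. \<forall>k\<in>J. F' x k = (\<Sum>p\<in>P. c p x * F' p k)"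
      using insert.IH[of F'] by blast
    let ?J = "insert j J"
    have fJ: "finite ?J" using insert.hyps by simp
    have F': "linear_form ?J F (\<lambda>x. F' x k)" if "k \<in> J" for k
    proof -
      have "(\<lambda>x. F' x k) = (\<lambda>x. F x k + (- F x1 k / F x1 j) * F x j)"
        by (auto simp: F'_def)
      then show ?thesis
        using linear_form_add[OF linear_form_coord linear_form_scale[OF linear_form_coord], of ?J k j F "- F x1 k / F x1 j"]
          fJ that by simp
    qed
    have c: "linear_form ?J F (c p)" if p: "p \<in> P" for p
    proof -
      obtain \<gamma> where "\<forall>x. c p x = (\<Sum>j\<in>J. \<gamma> j * F' x j)"
        using P(3) p unfolding linear_form_def by blast
      then have "c p = (\<lambda>x. \<Sum>j\<in>J. \<gamma> j * F' x j)" by auto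
      then show ?thesis using F' by (simp add: linear_form_sum linear_form_scale)
    qed
    \<comment> \<open>The coefficient of the pivot row: its share in row \<open>x\<close>, minus
      what reappears when the cleared rows \<open>F' q\<close> are replaced by the rows
      \<open>F q\<close>.\<close>
    define e where "e x = F x j / F x1 j - (\<Sum>q\<in>P. c q x * (F q j / F x1 j))" for x
    have e: "linear_form ?J F e"
    proof -
      have "e = (\<lambda>x. inverse (F x1 j) * F x j + (\<Sum>q\<in>P. (- F q j / F x1 j) * c q x))"
        by (auto simp: e_def sum_negf divide_inverse algebra_simps)
      then show ?thesis
        using fJ c by (simp only:) (intro linear_form_add linear_form_sum linear_form_scale linear_form_coord, auto)
    qed
    \<comment> \<open>The induction may already have put \<open>x1\<close> into \<open>P\<close>;
      adding the two contributions covers both situations.\<close>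
    define c' where "c' p x = (if p \<in> P then c p x else 0) + (if p = x1 then e x else 0)" for p x
    have "linear_form ?J F (c' p)" for p
      unfolding c'_def using c[of p] e linear_form_zero[of ?J F]
      by (intro linear_form_add) (cases "p \<in> P"; cases "p = x1"; simp)+
    moreover have "F x k = (\<Sum>p\<in>insert x1 P. c' p x * F p k)" if x: "x \<in> Y" and k: "k \<in> ?J" for x k
    proof -
      have "(\<Sum>p\<in>insert x1 P. c' p x * F p k) =
          (\<Sum>p\<in>insert x1 P. (if p \<in> P then c p x * F p k else 0)) + (\<Sum>p\<in>insert x1 P. (if p = x1 then e x * F p k else 0))"
        unfolding sum.distrib[symmetric] c'_def by (intro sum.cong) (auto simp: algebra_simps)
      also have "(\<Sum>p\<in>insert x1 P. (if p \<in> P then c p x * F p k else 0)) = (\<Sum>p\<in>P. c p x * F p k)"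
        using P(1) by (intro sum.mono_neutral_cong_right) auto
      also have "(\<Sum>p\<in>insert x1 P. (if p = x1 then e x * F p k else 0)) = e x * F x1 k"
        using P(1) by (simp add: sum.delta)
      also have "(\<Sum>p\<in>P. c p x * F p k) + e x * F x1 k =
          F x j / F x1 j * F x1 k + (\<Sum>p\<in>P. c p x * F' p k)"
        by (simp add: e_def F'_def algebra_simps sum_subtractf sum_distrib_right sum_distrib_left)
      also have "(\<Sum>p\<in>P. c p x * F' p k) = F' x k"
      proof (cases "k = j")
        case True
        then show ?thesis using x1 by (simp add: F'_def)
      next
        case False
        then show ?thesis using P(4) x k by auto
      qed
      also have "F x j / F x1 j * F x1 k + F' x k = F x k" by (simp add: F'_def)
      finally show ?thesis by simp
    qed
    ultimately show ?thesis
      using P(1,2) x1(1) by (intro exI[of _ "insert x1 P"] exI[of _ c']) auto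
  qed
qed

lemma bounded_imp_convergent_subseq_finite:
  fixes f :: "nat \<Rightarrow> 'j \<Rightarrow> real"
  assumes "finite J" "\<And>j. j \<in> J \<Longrightarrow> \<exists>M. \<forall>i. \<bar>f i j\<bar> \<le> M"
  shows "\<exists>r::nat\<Rightarrow>nat. strict_mono r \<and> (\<forall>j\<in>J. convergent (\<lambda>i. f (r i) j))"
  using assms
proof (induction J rule: finite_induct)
  case empty
  then show ?case by (intro exI[of _ id]) (simp add: strict_mono_def)
next
  case (insert j J)
  then obtain r :: "nat \<Rightarrow> nat" where r: "strict_mono r" "\<forall>j\<in>J. convergent (\<lambda>i. f (r i) j)" by auto
  obtain M where "\<forall>i. \<bar>f i j\<bar> \<le> M" using insert.prems by blast
  then have "bounded (range (\<lambda>i. f (r i) j))" by (auto simp: bounded_iff)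
  then obtain l s where s: "strict_mono (s::nat\<Rightarrow>nat)" "((\<lambda>i. f (r i) j) \<circ> s) \<longlonglongrightarrow> l"
    using bounded_imp_convergent_subsequence[of "\<lambda>i. f (r i) j"] by metis
  have "convergent (\<lambda>i. f ((r \<circ> s) i) k)" if "k \<in> insert j J" for k
  proof (cases "k = j")
    case True then show ?thesis using s(2) by (auto simp: convergent_def o_def)
  next
    case False
    then have "convergent (\<lambda>i. f (r i) k)" using r(2) that by auto
    from convergent_subseq_convergent[OF this s(1)] show ?thesis by (simp add: o_def)
  qed
  then show ?case using strict_mono_o[OF r(1) s(1)] by blast
qed

text \<open>An \<open>l1\<close> distance on the first \<open>n\<close> coordinates; linear
  estimates can be read off it directly, unlike from the metric of the infinite product.\<close>

definition sumdist :: "nat \<Rightarrow> (nat \<Rightarrow> real) \<Rightarrow> (nat \<Rightarrow> real) \<Rightarrow> real" where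
  "sumdist n u v = (\<Sum>k<n. \<bar>u k - v k\<bar>)"

lemma sumdist_nonneg: "0 \<le> sumdist n u v"
  unfolding sumdist_def by (simp add: sum_nonneg)

lemma sumdist_commute: "sumdist n u v = sumdist n v u"
  unfolding sumdist_def by (simp add: abs_minus_commute)

lemma sumdist_triangle: "sumdist n u w \<le> sumdist n u v + sumdist n v w"
  unfolding sumdist_def sum.distrib[symmetric] by (rule sum_mono) linarith

lemma sumdist_eq_0: "sumdist n u v = 0 \<longleftrightarrow> (\<forall>k<n. u k = v k)"
  unfolding sumdist_def by (subst sum_nonneg_eq_0_iff) auto

lemma sumdist_tendsto_0:
  assumes "\<And>k. k < n \<Longrightarrow> ((\<lambda>i. f i k) \<longlongrightarrow> l k) G"
  shows "((\<lambda>i. sumdist n (f i) l) \<longlongrightarrow> 0) G"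
proof -
  have "((\<lambda>i. \<Sum>k<n. \<bar>f i k - l k\<bar>) \<longlongrightarrow> (\<Sum>k<n. \<bar>l k - l k\<bar>)) G"
    using assms by (intro tendsto_intros) auto
  then show ?thesis by (simp add: sumdist_def)
qed

lemma linear_form_lipschitz:
  assumes "linear_form {..<n} (F::'x \<Rightarrow> nat \<Rightarrow> real) c"
  obtains L where "L \<ge> 0" "\<And>x y. \<bar>c x - c y\<bar> \<le> L * sumdist n (F x) (F y)"
proof -
  obtain \<gamma> where g: "\<forall>x. c x = (\<Sum>j<n. \<gamma> j * F x j)"
    using assms unfolding linear_form_def by blast
  define L where "L = (\<Sum>j<n. \<bar>\<gamma> j\<bar>)"
  show thesis
  proof
    show "L \<ge> 0" by (simp add: L_def sum_nonneg)
    fix x y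
    have "\<bar>c x - c y\<bar> = \<bar>\<Sum>j<n. \<gamma> j * (F x j - F y j)\<bar>"
      using g by (simp add: sum_subtractf right_diff_distrib)
    also have "\<dots> \<le> (\<Sum>j<n. \<bar>\<gamma> j\<bar> * \<bar>F x j - F y j\<bar>)"
      by (rule order_trans[OF sum_abs]) (simp add: abs_mult)
    also have "\<dots> \<le> (\<Sum>j<n. L * \<bar>F x j - F y j\<bar>)"
      unfolding L_def by (intro sum_mono mult_right_mono member_le_sum) auto
    also have "\<dots> = L * sumdist n (F x) (F y)"
      by (simp add: sumdist_def sum_distrib_left)
    finally show "\<bar>c x - c y\<bar> \<le> L * sumdist n (F x) (F y)" .
  qed
qed

text \<open>Since the span of the values \<open>G 0 x\<close> has a finite basis of such values, pointwise bounds along the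
  orbits of a linear flow become a uniform Lipschitz bound.\<close>

lemma linear_flow_equicontinuous:
  fixes G :: "real \<Rightarrow> 'x \<Rightarrow> nat \<Rightarrow> real"
  assumes rep: "\<And>t x k. \<lbrakk>x \<in> Y; k < n\<rbrakk> \<Longrightarrow> G t x k = (\<Sum>p\<in>P. c p x * G t p k)"
    and P: "finite P" "P \<subseteq> Y" and c: "\<And>p. p \<in> P \<Longrightarrow> linear_form {..<n} (G 0) (c p)"
    and bdd: "\<And>x k. \<lbrakk>x \<in> Y; k < n\<rbrakk> \<Longrightarrow> \<exists>M. \<forall>t\<in>T. \<bar>G t x k\<bar> \<le> M"
  obtains M where "M \<ge> 0"
    "\<And>t x y. \<lbrakk>t \<in> T; x \<in> Y; y \<in> Y\<rbrakk> \<Longrightarrow> sumdist n (G t x) (G t y) \<le> M * sumdist n (G 0 x) (G 0 y)"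
proof -
  have "\<forall>p\<in>P. \<forall>k\<in>{..<n}. \<exists>M. \<forall>t\<in>T. \<bar>G t p k\<bar> \<le> M" using bdd P by auto
  then obtain B where B: "\<And>p k t. \<lbrakk>p \<in> P; k < n; t \<in> T\<rbrakk> \<Longrightarrow> \<bar>G t p k\<bar> \<le> B p k"
    by (auto simp: Ball_def) metis
  have "\<forall>p\<in>P. \<exists>L. L \<ge> 0 \<and> (\<forall>x y. \<bar>c p x - c p y\<bar> \<le> L * sumdist n (G 0 x) (G 0 y))"
    using linear_form_lipschitz[OF c] by metis
  then obtain L where L: "\<And>p. p \<in> P \<Longrightarrow> L p \<ge> 0"
      "\<And>p x y. p \<in> P \<Longrightarrow> \<bar>c p x - c p y\<bar> \<le> L p * sumdist n (G 0 x) (G 0 y)"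
    by metis
  define M where "M = (\<Sum>k<n. \<Sum>p\<in>P. L p * \<bar>B p k\<bar>)"
  show thesis
  proof
    show "M \<ge> 0" unfolding M_def using L(1) by (intro sum_nonneg mult_nonneg_nonneg) auto
    fix t x y assume t: "t \<in> T" and xy: "x \<in> Y" "y \<in> Y"
    have "\<bar>G t x k - G t y k\<bar> \<le> (\<Sum>p\<in>P. L p * \<bar>B p k\<bar>) * sumdist n (G 0 x) (G 0 y)" if k: "k < n" for k
    proof -
      have "\<bar>G t x k - G t y k\<bar> = \<bar>\<Sum>p\<in>P. (c p x - c p y) * G t p k\<bar>"
        using rep[OF xy(1) k] rep[OF xy(2) k] by (simp add: sum_subtractf left_diff_distrib)
      also have "\<dots> \<le> (\<Sum>p\<in>P. \<bar>c p x - c p y\<bar> * \<bar>G t p k\<bar>)"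
        by (rule order_trans[OF sum_abs]) (simp add: abs_mult)
      also have "\<dots> \<le> (\<Sum>p\<in>P. (L p * sumdist n (G 0 x) (G 0 y)) * \<bar>B p k\<bar>)"
        using L B[OF _ k t] by (intro sum_mono mult_mono) (auto intro: order_trans[OF B[OF _ k t]] simp: sumdist_nonneg)
      also have "\<dots> = (\<Sum>p\<in>P. L p * \<bar>B p k\<bar>) * sumdist n (G 0 x) (G 0 y)"
        by (simp add: sum_distrib_left mult_ac)
      finally show ?thesis .
    qed
    then have "sumdist n (G t x) (G t y) \<le> (\<Sum>k<n. (\<Sum>p\<in>P. L p * \<bar>B p k\<bar>) * sumdist n (G 0 x) (G 0 y))"
      unfolding sumdist_def[of n "G t x"] by (intro sum_mono) auto
    then show "sumdist n (G t x) (G t y) \<le> M * sumdist n (G 0 x) (G 0 y)"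
      by (simp add: M_def sum_distrib_right)
  qed
qed

lemma tendsto_fun_coordinatewise:
  fixes f :: "'i \<Rightarrow> 'a \<Rightarrow> 'b::topological_space"
  assumes "\<And>k. ((\<lambda>i. f i k) \<longlongrightarrow> l k) G"
  shows "(f \<longlongrightarrow> l) G"
proof -
  have "limitin (product_topology (\<lambda>_. euclidean) UNIV) f l G"
    using assms by (simp add: limitin_componentwise)
  then show ?thesis by (simp add: euclidean_product_topology)
qed

section \<open>Linearizing injections are proper\<close>

text \<open>\<open>E t\<close> is kept as a mere family of matrices, because properness and phase
  rest on linearity in \<open>F x\<close> alone. It is specialized to the matrix exponential when
  frequencies are extracted.\<close>

locale linearized_flow = attracting_flow +
  fixes n :: nat and F :: "'a \<Rightarrow> nat \<Rightarrow> real" and E :: "real \<Rightarrow> nat \<Rightarrow> nat \<Rightarrow> real"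
  assumes F_cont: "continuous_map X euclidean F"
    and F_zero: "\<And>x k. \<lbrakk>x \<in> topspace X; k \<ge> n\<rbrakk> \<Longrightarrow> F x k = 0"
    and F_inj: "inj_on F (topspace X)"
    and F_flow: "\<And>t x k. \<lbrakk>x \<in> topspace X; k < n\<rbrakk> \<Longrightarrow> F (\<Phi> t x) k = (\<Sum>j<n. E t k j * F x j)"
begin

lemma F_coord: "continuous_map X euclideanreal (\<lambda>x. F x k)"
proof -
  have "continuous_map euclidean euclideanreal (\<lambda>f::nat \<Rightarrow> real. f k)"
    by (simp add: continuous_on_product_coordinates)
  from continuous_map_compose[OF F_cont this] show ?thesis by (simp add: o_def)
qed

lemma F_eqI: "\<lbrakk>x \<in> topspace X; y \<in> topspace X; \<And>k. k < n \<Longrightarrow> F x k = F y k\<rbrakk> \<Longrightarrow> x = y"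
  using F_inj F_zero unfolding inj_on_def by (metis ext not_le)

lemma sumdist_F_cont: "continuous_map X euclideanreal (\<lambda>x. sumdist n (F x) u)"
  unfolding sumdist_def by (intro continuous_intros F_coord) auto

lemma linear_form_F_cont:
  assumes "linear_form {..<n} F c" shows "continuous_map X euclideanreal c"
proof -
  obtain \<gamma> where "\<forall>x. c x = (\<Sum>j<n. \<gamma> j * F x j)"
    using assms unfolding linear_form_def by blast
  then have "c = (\<lambda>x. \<Sum>j<n. \<gamma> j * F x j)" by auto
  then show ?thesis by (simp only:) (intro continuous_intros F_coord, auto)
qed

text \<open>A linear relation between values of \<open>F\<close> at time 0 is carried to time
  \<open>t\<close> by the linear map \<open>E t\<close>, so the coefficients do not depend on
  \<open>t\<close>.\<close>

lemma finite_orbit_basis: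
  assumes "Y \<subseteq> topspace X"
  obtains P c where "finite P" "P \<subseteq> Y" "\<And>p. p \<in> P \<Longrightarrow> linear_form {..<n} F (c p)"
    "\<And>t x k. \<lbrakk>x \<in> Y; k < n\<rbrakk> \<Longrightarrow> F (\<Phi> t x) k = (\<Sum>p\<in>P. c p x * F (\<Phi> t p) k)"
proof -
  obtain P c where P: "finite P" "P \<subseteq> Y" "\<forall>p\<in>P. linear_form {..<n} F (c p)"
      "\<forall>x\<in>Y. \<forall>k\<in>{..<n}. F x k = (\<Sum>p\<in>P. c p x * F p k)"
    using rank_factorization[of "{..<n}" Y F] by auto
  have rep: "F (\<Phi> t x) k = (\<Sum>p\<in>P. c p x * F (\<Phi> t p) k)" if x: "x \<in> Y" and k: "k < n" for t x k
  proof -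
    have "F (\<Phi> t x) k = (\<Sum>j<n. E t k j * (\<Sum>p\<in>P. c p x * F p j))"
      using F_flow[of x k t] x k assms P(4) by (auto intro!: sum.cong)
    also have "\<dots> = (\<Sum>p\<in>P. c p x * (\<Sum>j<n. E t k j * F p j))"
      unfolding sum_distrib_left by (subst sum.swap) (simp add: mult_ac)
    also have "\<dots> = (\<Sum>p\<in>P. c p x * F (\<Phi> t p) k)"
    proof (rule sum.cong[OF refl])
      fix p assume "p \<in> P"
      then show "c p x * (\<Sum>j<n. E t k j * F p j) = c p x * F (\<Phi> t p) k"
        using F_flow[of p k t] P(2) assms k by (simp add: subset_iff)
    qed
    finally show ?thesis .
  qed
  show thesis by (rule that[OF P(1,2) _ rep]) (use P(3) in auto)
qed

lemma F_bounded_compact: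
  assumes "compactin X C"
  obtains M where "\<And>x k. x \<in> C \<Longrightarrow> \<bar>F x k\<bar> \<le> M"
proof -
  have "\<exists>M. \<forall>x\<in>C. \<bar>F x k\<bar> \<le> M" for k
  proof -
    have "compact ((\<lambda>x. F x k) ` C)"
      using image_compactin[OF assms F_coord[of k]] by simp
    then show ?thesis using compact_imp_bounded by (fastforce simp: bounded_iff)
  qed
  then obtain M where M: "\<And>k x. x \<in> C \<Longrightarrow> \<bar>F x k\<bar> \<le> M k" by metis
  have C: "C \<subseteq> topspace X" using assms compactin_subset_topspace by blast
  show thesis
  proof
    fix x k assume x: "x \<in> C"
    show "\<bar>F x k\<bar> \<le> (\<Sum>k<n. \<bar>M k\<bar>)"
    proof (cases "k < n")
      case True
      have "\<bar>F x k\<bar> \<le> \<bar>M k\<bar>" using M[OF x, of k] by linarith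
      also have "\<dots> \<le> (\<Sum>k<n. \<bar>M k\<bar>)" using True by (intro member_le_sum) auto
      finally show ?thesis .
    next
      case False
      then show ?thesis using F_zero[of x k] x C by (auto intro: sum_nonneg)
    qed
  qed
qed

text \<open>\<open>V\<close> does not increase in forward time, so the forward orbit stays in a
  compact sublevel set.\<close>

lemma F_bounded_forward:
  assumes "x \<in> topspace X"
  obtains M where "\<And>t k. t \<ge> 0 \<Longrightarrow> \<bar>F (\<Phi> t x) k\<bar> \<le> M"
proof -
  obtain V where V: "\<And>x. x \<in> topspace X \<Longrightarrow> V x \<ge> 0"
    "\<And>t x. x \<in> topspace X \<Longrightarrow> V (\<Phi> t x) = exp (- t) * V x"
    "\<And>c. compactin X {x \<in> topspace X. V x \<le> c}"
    using exponential_lyapunov_function by metis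
  obtain M where M: "\<And>y k. y \<in> {y \<in> topspace X. V y \<le> V x} \<Longrightarrow> \<bar>F y k\<bar> \<le> M"
    using F_bounded_compact[OF V(3)] by metis
  show thesis
  proof
    fix t :: real and k assume "t \<ge> 0"
    then have "V (\<Phi> t x) \<le> V x" using V(1,2) assms by (simp add: mult_le_cancel_right1 mult_left_le_one_le)
    then show "\<bar>F (\<Phi> t x) k\<bar> \<le> M" using M assms by simp
  qed
qed

lemma equicontinuous_forward:
  obtains M where "M \<ge> 0" "\<And>t x y. \<lbrakk>t \<ge> 0; x \<in> topspace X; y \<in> topspace X\<rbrakk> \<Longrightarrow>
    sumdist n (F (\<Phi> t x)) (F (\<Phi> t y)) \<le> M * sumdist n (F x) (F y)"
proof -
  obtain P c where P: "finite P" "P \<subseteq> topspace X" "\<And>p. p \<in> P \<Longrightarrow> linear_form {..<n} F (c p)"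
    "\<And>t x k. \<lbrakk>x \<in> topspace X; k < n\<rbrakk> \<Longrightarrow> F (\<Phi> t x) k = (\<Sum>p\<in>P. c p x * F (\<Phi> t p) k)"
    using finite_orbit_basis[of "topspace X"] by auto
  \<comment> \<open>Outside \<open>topspace X\<close> the value is \<open>F x\<close>, so that
    \<open>G 0 = F\<close> as functions: \<open>linear_form\<close> speaks about all points of the
    type.\<close>
  define G where "G t x = (if x \<in> topspace X then F (\<Phi> t x) else F x)" for t x
  have G0: "G 0 = F" by (auto simp: G_def)
  obtain M where "M \<ge> 0"
    "\<And>t x y. \<lbrakk>t \<in> {0..}; x \<in> topspace X; y \<in> topspace X\<rbrakk> \<Longrightarrow> sumdist n (G t x) (G t y) \<le> M * sumdist n (G 0 x) (G 0 y)"
  proof (rule linear_flow_equicontinuous[where Y = "topspace X" and n = n and G = G and P = P and c = c and T = "{0..}"])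
    show "G t x k = (\<Sum>p\<in>P. c p x * G t p k)" if "x \<in> topspace X" "k < n" for t x k
      using P(4)[OF that] P(2) that by (auto simp: G_def subset_iff intro!: sum.cong)
    show "\<exists>M. \<forall>t\<in>{0..}. \<bar>G t x k\<bar> \<le> M" if "x \<in> topspace X" "k < n" for x k
      using F_bounded_forward[OF that(1)] that(1) by (metis G_def atLeast_iff)
  qed (use P G0 in auto)
  then show thesis using that[of M] by (auto simp: G_def)
qed

text \<open>On the compact invariant set \<open>A\<close> orbits are bounded for all real times, so
  the bound also holds for negative \<open>t\<close>; this is what makes almost periods on
  \<open>A\<close> possible.\<close>

lemma equicontinuous_on_A:
  obtains M where "M \<ge> 0" "\<And>t x y. \<lbrakk>x \<in> A; y \<in> A\<rbrakk> \<Longrightarrow>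
    sumdist n (F (\<Phi> t x)) (F (\<Phi> t y)) \<le> M * sumdist n (F x) (F y)"
proof -
  obtain P c where P: "finite P" "P \<subseteq> A" "\<And>p. p \<in> P \<Longrightarrow> linear_form {..<n} F (c p)"
    "\<And>t x k. \<lbrakk>x \<in> A; k < n\<rbrakk> \<Longrightarrow> F (\<Phi> t x) k = (\<Sum>p\<in>P. c p x * F (\<Phi> t p) k)"
    using finite_orbit_basis[of A] A_subset by metis
  define G where "G t x = (if x \<in> topspace X then F (\<Phi> t x) else F x)" for t x
  have G0: "G 0 = F" by (auto simp: G_def)
  obtain B where B: "\<And>x k. x \<in> A \<Longrightarrow> \<bar>F x k\<bar> \<le> B"
    using F_bounded_compact[OF A_compact] by metis
  obtain M where "M \<ge> 0"
    "\<And>t x y. \<lbrakk>t \<in> UNIV; x \<in> A; y \<in> A\<rbrakk> \<Longrightarrow> sumdist n (G t x) (G t y) \<le> M * sumdist n (G 0 x) (G 0 y)"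
  proof (rule linear_flow_equicontinuous[where Y = A and n = n and G = G and P = P and c = c and T = UNIV])
    show "G t x k = (\<Sum>p\<in>P. c p x * G t p k)" if "x \<in> A" "k < n" for t x k
      using P(4)[OF that] P(2) that A_subset by (auto simp: G_def subset_iff intro!: sum.cong)
    show "\<exists>M. \<forall>t\<in>UNIV. \<bar>G t x k\<bar> \<le> M" if "x \<in> A" "k < n" for x k
      using B flow_A[OF that(1)] A_topspace[OF that(1)] by (auto simp: G_def)
  qed (use P G0 in auto)
  then show thesis using that[of M] A_topspace by (auto simp: G_def)
qed

text \<open>Suppose \<open>V (x i)\<close> is unbounded while \<open>F (x i)\<close> is bounded. The
  time \<open>t i = ln (V (x i))\<close> moves \<open>x i\<close> to a point \<open>y i\<close> with
  \<open>V = 1\<close>. Along a subsequence \<open>F (x i)\<close> converges and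
  \<open>F (y i)\<close> tends to \<open>F z\<close> with \<open>V z = 1\<close>. The forward
  Lipschitz bound makes \<open>z\<close> recurrent, although \<open>z\<close> lies outside
  \<open>A\<close> and must be attracted to it.\<close>

lemma lyapunov_bounded_on_preimage:
  assumes V: "\<And>x. x \<in> topspace X \<Longrightarrow> V x = 0 \<longleftrightarrow> x \<in> A"
    "\<And>t x. x \<in> topspace X \<Longrightarrow> V (\<Phi> t x) = exp (- t) * V x"
    "\<And>c. compactin X {x \<in> topspace X. V x \<le> c}"
    and Vc: "continuous_map X euclideanreal V"
  shows "\<exists>c. \<forall>x\<in>topspace X. (\<forall>k<n. \<bar>F x k\<bar> \<le> C) \<longrightarrow> V x \<le> (c::real)"
proof (rule ccontr)
  assume "\<not> ?thesis"
  then have "\<forall>i. \<exists>x. x \<in> topspace X \<and> (\<forall>k<n. \<bar>F x k\<bar> \<le> C) \<and> V x > real i + 1"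
    by (meson not_le)
  then obtain x where x: "\<And>i. x i \<in> topspace X" "\<And>i k. k < n \<Longrightarrow> \<bar>F (x i) k\<bar> \<le> C" "\<And>i. V (x i) > real i + 1"
    by metis
  define t where "t i = ln (V (x i))" for i
  define y where "y i = \<Phi> (t i) (x i)" for i
  have Vpos: "V (x i) > 0" for i using x(3)[of i] by linarith
  have t_pos: "exp (t i) = V (x i)" for i using Vpos by (simp add: t_def)
  have y: "y i \<in> topspace X" "V (y i) = 1" for i
    using x(1)[of i] V(2)[OF x(1), of "t i" i] Vpos[of i] by (simp_all add: y_def exp_minus t_pos field_simps)
  define L where "L = {x \<in> topspace X. V x = 1}"
  have Lc: "compactin X L"
  proof -
    have "closedin X {x \<in> topspace X. V x \<in> {1}}"
      by (rule closedin_continuous_map_preimage[OF Vc]) auto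
    then show ?thesis using closed_compactin[OF V(3)[of 1], of L] unfolding L_def by force
  qed
  have "compact (F ` L)" using image_compactin[OF Lc F_cont] by simp
  moreover have "F (y i) \<in> F ` L" for i using y by (auto simp: L_def)
  ultimately obtain l r0 where r0: "l \<in> F ` L" "strict_mono (r0::nat\<Rightarrow>nat)" "((\<lambda>i. F (y i)) \<circ> r0) \<longlonglongrightarrow> l"
    unfolding compact_eq_seq_compact_metric seq_compact_def by metis
  obtain z where z: "z \<in> L" "l = F z" using r0(1) by blast
  obtain r1 :: "nat \<Rightarrow> nat" where r1: "strict_mono r1" "\<forall>k\<in>{..<n}. convergent (\<lambda>i. F (x (r0 (r1 i))) k)"
    using bounded_imp_convergent_subseq_finite[of "{..<n}" "\<lambda>i k. F (x (r0 i)) k"] x(2) by auto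
  define r where "r = r0 \<circ> r1"
  have r: "strict_mono r" unfolding r_def using strict_mono_o r0(2) r1(1) by blast
  have "(\<lambda>i. F (y (r i)) k) \<longlonglongrightarrow> F z k" for k
  proof -
    have "(\<lambda>i. F (y (r i))) \<longlonglongrightarrow> F z"
      using LIMSEQ_subseq_LIMSEQ[OF r0(3) r1(1)] by (simp add: r_def o_def z(2))
    from continuous_on_tendsto_compose[OF continuous_on_product_coordinates this, of k] show ?thesis by simp
  qed
  then have ylim: "(\<lambda>i. sumdist n (F (y (r i))) (F z)) \<longlonglongrightarrow> 0"
    by (intro sumdist_tendsto_0)
  obtain u where "\<And>k. k < n \<Longrightarrow> (\<lambda>i. F (x (r i)) k) \<longlonglongrightarrow> u k"
    using r1(2) unfolding convergent_def r_def by (auto simp: Ball_def) metis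
  then have xlim: "(\<lambda>i. sumdist n (F (x (r i))) u) \<longlonglongrightarrow> 0"
    by (intro sumdist_tendsto_0)
  have zX: "z \<in> topspace X" "V z = 1" using z(1) by (auto simp: L_def)
  obtain M where M: "M \<ge> 0" "\<And>t x y. \<lbrakk>t \<ge> 0; x \<in> topspace X; y \<in> topspace X\<rbrakk> \<Longrightarrow>
      sumdist n (F (\<Phi> t x)) (F (\<Phi> t y)) \<le> M * sumdist n (F x) (F y)"
    using equicontinuous_forward by blast
  have t_tendsto: "filterlim (\<lambda>i. t (r i)) at_top sequentially"
  proof -
    have "filterlim t at_top sequentially"
    proof (rule filterlim_at_top_mono)
      show "filterlim (\<lambda>i. ln (real i + 1)) at_top sequentially" by real_asymp
      show "\<forall>\<^sub>F i in sequentially. ln (real i + 1) \<le> t i"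
        unfolding t_def using x(3) by (intro always_eventually allI, subst ln_le_cancel_iff) (auto simp: Vpos intro: less_imp_le)
    qed
    from filterlim_compose[OF this filterlim_subseq[OF r]] show ?thesis .
  qed
  have recur: "\<exists>s\<ge>S. sumdist n (F (\<Phi> s z)) (F z) < e" if e: "e > 0" for e S
  proof -
    \<comment> \<open>With this choice the total error \<open>2 * M * d + d\<close> below is at most
      \<open>3 * e / 4\<close>.\<close>
    define d where "d = e / (4 * (M + 1))"
    have d: "d > 0" "M * d \<le> e / 4" "d \<le> e / 4"
      using e M(1) by (auto simp: d_def field_simps)
    have "\<forall>\<^sub>F i in sequentially. sumdist n (F (y (r i))) (F z) < d \<and> sumdist n (F (x (r i))) u < d / 2"
      using order_tendstoD(2)[OF ylim, of d] order_tendstoD(2)[OF xlim, of "d/2"] d(1)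
      by (intro eventually_conj) auto
    then obtain i0 where i0: "\<And>i. i \<ge> i0 \<Longrightarrow> sumdist n (F (y (r i))) (F z) < d \<and> sumdist n (F (x (r i))) u < d / 2"
      unfolding eventually_sequentially by blast
    have "\<forall>\<^sub>F j in sequentially. t (r j) \<ge> t (r i0) + max S 0"
      using t_tendsto by (simp add: filterlim_at_top)
    then obtain j where j: "j \<ge> i0" "t (r j) \<ge> t (r i0) + max S 0"
      unfolding eventually_sequentially by (meson nle_le)
    define s where "s = t (r j) - t (r i0)"
    have s: "s \<ge> 0" "s \<ge> S" using j(2) by (auto simp: s_def)
    have tj: "t (r j) \<ge> 0" using x(3)[of "r j"] by (simp add: t_def)
    have eq: "\<Phi> s (y (r i0)) = \<Phi> (t (r j)) (x (r i0))"
      using flow_add[OF x(1), of s "t (r i0)" "r i0"] by (simp add: s_def y_def)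
    \<comment> \<open>The link between \<open>\<Phi> s z\<close> and \<open>z\<close> is the orbit
      of \<open>x (r i0)\<close> at time \<open>t (r j)\<close>. It equals
      \<open>\<Phi> s (y (r i0))\<close>, which is close to \<open>\<Phi> s z\<close>; and it is
      close to \<open>y (r j)\<close>, hence to \<open>z\<close>, because \<open>x (r i0)\<close>
      and \<open>x (r j)\<close> have nearly equal images.\<close>
    have "sumdist n (F (\<Phi> s z)) (F z) \<le> sumdist n (F (\<Phi> s z)) (F (\<Phi> s (y (r i0)))) +
        (sumdist n (F (\<Phi> (t (r j)) (x (r i0)))) (F (y (r j))) + sumdist n (F (y (r j))) (F z))"
      unfolding eq[symmetric]
      by (meson add_left_mono order_trans sumdist_triangle)
    also have "sumdist n (F (\<Phi> s z)) (F (\<Phi> s (y (r i0)))) \<le> M * sumdist n (F (y (r i0))) (F z)"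
      using M(2)[OF s(1) zX(1) y(1)] by (simp add: sumdist_commute)
    also have "M * sumdist n (F (y (r i0))) (F z) \<le> M * d"
      using i0[of i0] M(1) by (intro mult_left_mono) auto
    also have "sumdist n (F (\<Phi> (t (r j)) (x (r i0)))) (F (y (r j))) \<le> M * sumdist n (F (x (r i0))) (F (x (r j)))"
      unfolding y_def using M(2)[OF tj x(1) x(1)] .
    also have "sumdist n (F (x (r i0))) (F (x (r j))) \<le> sumdist n (F (x (r i0))) u + sumdist n (F (x (r j))) u"
      using sumdist_triangle[of n "F (x (r i0))" "F (x (r j))" u] by (simp add: sumdist_commute)
    also have "\<dots> \<le> d" using i0[of i0] i0[OF j(1)] by simp
    also have "sumdist n (F (y (r j))) (F z) \<le> d" using i0[OF j(1)] by simp
    finally have "sumdist n (F (\<Phi> s z)) (F z) \<le> M * d + (M * d + d)"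
      using M(1) by (simp add: mult_left_mono)
    also have "\<dots> < e" using d e by linarith
    finally show ?thesis using s(2) by blast
  qed
  have zA: "z \<notin> A" using V(1)[OF zX(1)] zX(2) by simp
  have pos: "sumdist n (F a) (F z) > 0" if "a \<in> A" for a
  proof -
    have "sumdist n (F a) (F z) \<noteq> 0"
      using F_eqI[OF A_topspace[OF that] zX(1)] that zA unfolding sumdist_eq_0 by blast
    then show ?thesis using sumdist_nonneg[of n "F a" "F z"] by simp
  qed
  have "compact ((\<lambda>a. sumdist n (F a) (F z)) ` A)"
    using image_compactin[OF A_compact sumdist_F_cont] by simp
  then have cpt: "compact ((\<lambda>a. sumdist n (F a) (F z)) ` A)" .
  \<comment> \<open>By compactness \<open>F z\<close> has a positive distance from \<open>F\<close>
    on \<open>A\<close>, so an orbit attracted to \<open>A\<close> cannot keep returning near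
    \<open>z\<close>.\<close>
  have "\<exists>e>0. \<forall>a\<in>A. e < sumdist n (F a) (F z)"
  proof (cases "A = {}")
    case True then show ?thesis by (intro exI[of _ 1]) simp
  next
    case False
    then obtain a where a: "a \<in> A" "\<forall>b\<in>A. sumdist n (F a) (F z) \<le> sumdist n (F b) (F z)"
      using compact_attains_inf[OF cpt] by auto
    show ?thesis
    proof (intro exI conjI ballI)
      show "sumdist n (F a) (F z) / 2 > 0" using pos[OF a(1)] by simp
      show "sumdist n (F a) (F z) / 2 < sumdist n (F b) (F z)" if "b \<in> A" for b
        using pos[OF a(1)] a(2)[rule_format, OF that] by linarith
    qed
  qed
  then obtain e where e: "e > 0" "\<And>a. a \<in> A \<Longrightarrow> e < sumdist n (F a) (F z)" by blast
  have "openin X {x \<in> topspace X. sumdist n (F x) (F z) \<in> {e<..}}"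
    by (rule openin_continuous_map_preimage[OF sumdist_F_cont]) auto
  moreover have "A \<subseteq> {x \<in> topspace X. sumdist n (F x) (F z) \<in> {e<..}}"
    using e(2) A_subset by auto
  ultimately have "\<forall>\<^sub>F s in at_top. \<Phi> s z \<in> {x \<in> topspace X. sumdist n (F x) (F z) \<in> {e<..}}"
    using attracted zX(1) by blast
  then obtain S where "\<And>s. s \<ge> S \<Longrightarrow> e < sumdist n (F (\<Phi> s z)) (F z)"
    unfolding eventually_at_top_linorder by auto
  then show False using recur[OF e(1), of S] by force
qed

lemma preimage_compact:
  assumes "compact K"
  shows "compactin X {x \<in> topspace X. F x \<in> K}"
proof -
  obtain V where V: "continuous_map X euclideanreal V" "\<And>x. x \<in> topspace X \<Longrightarrow> V x \<ge> 0"
    "\<And>x. x \<in> topspace X \<Longrightarrow> V x = 0 \<longleftrightarrow> x \<in> A"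
    "\<And>t x. x \<in> topspace X \<Longrightarrow> V (\<Phi> t x) = exp (- t) * V x"
    "\<And>c. compactin X {x \<in> topspace X. V x \<le> c}"
    by (rule exponential_lyapunov_function) (rule that)
  have "\<exists>C. \<forall>u\<in>K. \<bar>u k\<bar> \<le> C" for k
  proof -
    have "continuous_on K (\<lambda>u. u k)"
      by (rule continuous_on_subset[OF continuous_on_product_coordinates]) simp
    then have "compact ((\<lambda>u. u k) ` K)" using assms compact_continuous_image by blast
    then show ?thesis using compact_imp_bounded by (fastforce simp: bounded_iff)
  qed
  then obtain C0 where C0: "\<And>k u. u \<in> K \<Longrightarrow> \<bar>u k\<bar> \<le> C0 k" by metis
  define C where "C = (\<Sum>k<n. \<bar>C0 k\<bar>)"
  have C: "\<bar>u k\<bar> \<le> C" if "u \<in> K" "k < n" for u k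
  proof -
    have "\<bar>u k\<bar> \<le> \<bar>C0 k\<bar>" using C0[OF that(1), of k] by linarith
    also have "\<dots> \<le> C" unfolding C_def using that(2) by (intro member_le_sum) auto
    finally show ?thesis .
  qed
  obtain c where c: "\<And>x. \<lbrakk>x \<in> topspace X; \<forall>k<n. \<bar>F x k\<bar> \<le> C\<rbrakk> \<Longrightarrow> V x \<le> c"
    using lyapunov_bounded_on_preimage[OF V(3,4,5,1), of C] by blast
  have "closedin X {x \<in> topspace X. F x \<in> K}"
    by (rule closedin_continuous_map_preimage[OF F_cont]) (simp add: assms compact_imp_closed)
  moreover have "{x \<in> topspace X. F x \<in> K} \<subseteq> {x \<in> topspace X. V x \<le> c}" using c C by auto
  ultimately show ?thesis using closed_compactin[OF V(5)] by blast
qed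

lemma embedding: "embedding_map X euclidean F"
proof -
  have "closed_map X euclidean F"
    by (rule proper_imp_closed_map[OF compact_imp_proper_map])
      (use F_cont preimage_compact in \<open>auto intro: k_space_euclideanreal Hausdorff_imp_kc_space\<close>)
  then show ?thesis
    using injective_closed_imp_embedding_map[OF F_cont _ F_inj] by blast
qed

end

section \<open>The asymptotic phase as a limit of the flow\<close>

context linearized_flow begin

lemma asymptotic_phase: "has_asymptotic_phase X \<Phi> A"
proof -
  obtain P c where P: "finite P" "P \<subseteq> topspace X" "\<And>p. p \<in> P \<Longrightarrow> linear_form {..<n} F (c p)"
    "\<And>t x k. \<lbrakk>x \<in> topspace X; k < n\<rbrakk> \<Longrightarrow> F (\<Phi> t x) k = (\<Sum>p\<in>P. c p x * F (\<Phi> t p) k)"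
    using finite_orbit_basis[of "topspace X"] by auto
  have subseq: "\<exists>r::nat\<Rightarrow>nat. strict_mono r \<and> (\<forall>x\<in>topspace X. \<forall>k<n. convergent (\<lambda>i. F (\<Phi> (s (r i)) x) k))"
    if s: "\<And>i. s i \<ge> 0" for s :: "nat \<Rightarrow> real"
  proof -
    have "\<exists>M. \<forall>i. \<bar>F (\<Phi> (s i) p) k\<bar> \<le> M" if "p \<in> P" for p k
      using F_bounded_forward[of p] s P(2) that by (metis subsetD)
    then obtain r :: "nat \<Rightarrow> nat" where r: "strict_mono r"
        "\<And>p k. \<lbrakk>p \<in> P; k < n\<rbrakk> \<Longrightarrow> convergent (\<lambda>i. F (\<Phi> (s (r i)) p) k)"
      using bounded_imp_convergent_subseq_finite[of "P \<times> {..<n}" "\<lambda>i (p, k). F (\<Phi> (s i) p) k"] P(1) by auto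
    have "convergent (\<lambda>i. F (\<Phi> (s (r i)) x) k)" if x: "x \<in> topspace X" and k: "k < n" for x k
      unfolding P(4)[OF x k] using r(2)[OF _ k]
      by (intro convergent_sum convergent_mult convergent_const)
    then show ?thesis using r(1) by blast
  qed
  obtain r :: "nat \<Rightarrow> nat" where r: "strict_mono r"
      "\<And>x k. \<lbrakk>x \<in> topspace X; k < n\<rbrakk> \<Longrightarrow> convergent (\<lambda>i. F (\<Phi> (real (r i)) x) k)"
    using subseq[of real] by auto
  \<comment> \<open>The difference of two late times of a convergent sequence is an almost period on
    \<open>A\<close>. Comparing the indices \<open>2 * i\<close> and \<open>i\<close> forces the
    differences to infinity.\<close>
  define s where "s i = real (r (2 * i)) - real (r i)" for i
  have s_ge: "s i \<ge> real i" for i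
  proof -
    have "r i + m \<le> r (i + m)" for m
    proof (induction m)
      case (Suc m)
      have "r (i + m) < r (i + Suc m)" using r(1) by (simp add: strict_mono_def)
      then show ?case using Suc by linarith
    qed simp
    from this[of i] show ?thesis unfolding s_def mult_2 by linarith
  qed
  have s_pos: "s i \<ge> 0" for i using s_ge[of i] by linarith
  obtain q :: "nat \<Rightarrow> nat" where q: "strict_mono q"
      "\<And>x k. \<lbrakk>x \<in> topspace X; k < n\<rbrakk> \<Longrightarrow> convergent (\<lambda>i. F (\<Phi> (s (q i)) x) k)"
    using subseq[of s, OF s_pos] by blast
  define Q where "Q x k = (if k < n then lim (\<lambda>i. F (\<Phi> (s (q i)) x) k) else 0)" for x k
  have Q: "(\<lambda>i. F (\<Phi> (s (q i)) x) k) \<longlonglongrightarrow> Q x k" if "x \<in> topspace X" "k < n" for x k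
    using q(2)[OF that] that(2) by (simp add: Q_def convergent_LIMSEQ_iff)
  have Q0: "Q x k = 0" if "\<not> k < n" for x k using that by (simp add: Q_def)
  have F0: "F x k = 0" if "\<not> k < n" "x \<in> topspace X" for x k using that F_zero by simp
  have Q_lim: "(\<lambda>i. F (\<Phi> (s (q i)) x)) \<longlonglongrightarrow> Q x" if x: "x \<in> topspace X" for x
  proof (rule tendsto_fun_coordinatewise)
    show "(\<lambda>i. F (\<Phi> (s (q i)) x) k) \<longlonglongrightarrow> Q x k" for k
      using Q[OF x, of k] F0[OF _ flow_in[OF x]] Q0[of k] by (cases "k < n") auto
  qed
  obtain M where M: "M \<ge> 0" "\<And>t x y. \<lbrakk>x \<in> A; y \<in> A\<rbrakk> \<Longrightarrow>
    sumdist n (F (\<Phi> t x)) (F (\<Phi> t y)) \<le> M * sumdist n (F x) (F y)"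
    using equicontinuous_on_A by blast
  have Q_A: "Q a = F a" if a: "a \<in> A" for a
  proof -
    have aX: "a \<in> topspace X" using A_topspace a .
    obtain u where u: "\<And>k. k < n \<Longrightarrow> (\<lambda>i. F (\<Phi> (real (r i)) a) k) \<longlonglongrightarrow> u k"
      using r(2)[OF aX] unfolding convergent_def by metis
    have ulim: "(\<lambda>i. sumdist n (F (\<Phi> (real (r i)) a)) u) \<longlonglongrightarrow> 0"
      using sumdist_tendsto_0[OF u] .
    have le: "sumdist n (F (\<Phi> (s i) a)) (F a) \<le>
        M * (sumdist n (F (\<Phi> (real (r (2 * i))) a)) u + sumdist n (F (\<Phi> (real (r i)) a)) u)" for i
    proof -
      \<comment> \<open>The two-sided bound on \<open>A\<close> is used for the backward time
        \<open>- real (r i)\<close>, which brings the nearby points at times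
        \<open>r (2 * i)\<close> and \<open>r i\<close> back to \<open>\<Phi> (s i) a\<close> and
        \<open>a\<close>.\<close>
      have "sumdist n (F (\<Phi> (- real (r i)) (\<Phi> (real (r (2 * i))) a))) (F (\<Phi> (- real (r i)) (\<Phi> (real (r i)) a)))
          \<le> M * sumdist n (F (\<Phi> (real (r (2 * i))) a)) (F (\<Phi> (real (r i)) a))"
        using M(2) flow_A a by blast
      moreover have "\<Phi> (- real (r i)) (\<Phi> (real (r (2 * i))) a) = \<Phi> (s i) a"
        using flow_add[OF aX, of "- real (r i)" "real (r (2 * i))"] by (simp add: s_def)
      moreover have "\<Phi> (- real (r i)) (\<Phi> (real (r i)) a) = a"
        using flow_add[OF aX, of "- real (r i)" "real (r i)"] aX by simp
      moreover have "sumdist n (F (\<Phi> (real (r (2 * i))) a)) (F (\<Phi> (real (r i)) a)) \<le>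
          sumdist n (F (\<Phi> (real (r (2 * i))) a)) u + sumdist n (F (\<Phi> (real (r i)) a)) u"
        using sumdist_triangle[of n "F (\<Phi> (real (r (2 * i))) a)" "F (\<Phi> (real (r i)) a)" u]
        by (simp add: sumdist_commute[of n u])
      ultimately show ?thesis
        using mult_left_mono[OF _ M(1), of "sumdist n (F (\<Phi> (real (r (2 * i))) a)) (F (\<Phi> (real (r i)) a))"] by fastforce
    qed
    have "(\<lambda>i. sumdist n (F (\<Phi> (real (r (2 * i))) a)) u) \<longlonglongrightarrow> 0"
      using LIMSEQ_subseq_LIMSEQ[OF ulim, of "\<lambda>i. 2 * i"] by (simp add: strict_mono_def o_def)
    then have "(\<lambda>i. M * (sumdist n (F (\<Phi> (real (r (2 * i))) a)) u + sumdist n (F (\<Phi> (real (r i)) a)) u)) \<longlonglongrightarrow> M * (0 + 0)"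
      using ulim by (intro tendsto_intros)
    then have to0: "(\<lambda>i. M * (sumdist n (F (\<Phi> (real (r (2 * i))) a)) u + sumdist n (F (\<Phi> (real (r i)) a)) u)) \<longlonglongrightarrow> 0"
      by simp
    have "(\<lambda>i. sumdist n (F (\<Phi> (s i) a)) (F a)) \<longlonglongrightarrow> 0"
      by (rule Lim_null_comparison[OF _ to0]) (simp add: sumdist_nonneg le)
    from LIMSEQ_subseq_LIMSEQ[OF this q(1)]
    have lim0: "(\<lambda>i. sumdist n (F (\<Phi> (s (q i)) a)) (F a)) \<longlonglongrightarrow> 0" by (simp add: o_def)
    have "Q a k = F a k" if k: "k < n" for k
    proof (rule LIMSEQ_unique[OF Q[OF aX k]])
      have "norm (F (\<Phi> (s (q i)) a) k - F a k) \<le> sumdist n (F (\<Phi> (s (q i)) a)) (F a)" for i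
        unfolding sumdist_def real_norm_def using k
        by (intro member_le_sum[of k "{..<n}" "\<lambda>k. \<bar>F (\<Phi> (s (q i)) a) k - F a k\<bar>"]) auto
      then have "(\<lambda>i. F (\<Phi> (s (q i)) a) k - F a k) \<longlonglongrightarrow> 0"
        by (intro Lim_null_comparison[OF _ lim0]) auto
      then show "(\<lambda>i. F (\<Phi> (s (q i)) a) k) \<longlonglongrightarrow> F a k"
        by (rule LIM_zero_cancel)
    qed
    then show ?thesis using Q0 F0[OF _ aX] by (metis ext)
  qed
  have Q_in: "Q x \<in> F ` A" if x: "x \<in> topspace X" for x
  proof (rule ccontr)
    assume nin: "Q x \<notin> F ` A"
    have "compact (F ` A)" using image_compactin[OF A_compact F_cont] by simp
    then have cl: "closed (F ` A)" by (rule compact_imp_closed)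
    then obtain U W where UW: "open U" "open W" "Q x \<in> U" "F ` A \<subseteq> W" "U \<inter> W = {}"
      using t3_space[OF cl nin] by blast
    have "openin X {y \<in> topspace X. F y \<in> W}"
      by (rule openin_continuous_map_preimage[OF F_cont]) (simp add: UW)
    moreover have "A \<subseteq> {y \<in> topspace X. F y \<in> W}" using UW(4) A_subset by auto
    ultimately have "\<forall>\<^sub>F t in at_top. \<Phi> t x \<in> {y \<in> topspace X. F y \<in> W}"
      using x by (rule attracted)
    then have ev: "\<forall>\<^sub>F t in at_top. F (\<Phi> t x) \<in> W" by (rule eventually_mono) simp
    have "filterlim (\<lambda>i. s (q i)) at_top sequentially"
    proof (rule filterlim_at_top_mono)
      show "filterlim (\<lambda>i. real (q i)) at_top sequentially"
        using filterlim_compose[OF filterlim_real_sequentially filterlim_subseq[OF q(1)]] .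
    qed (use s_ge in auto)
    from filterlim_iff[THEN iffD1, OF this, rule_format, OF ev]
    have "\<forall>\<^sub>F i in sequentially. F (\<Phi> (s (q i)) x) \<in> W" .
    moreover have "\<forall>\<^sub>F i in sequentially. F (\<Phi> (s (q i)) x) \<in> U"
      using topological_tendstoD[OF Q_lim[OF x] UW(1,3)] .
    ultimately have "\<forall>\<^sub>F i in sequentially. False"
      by eventually_elim (use UW(5) in auto)
    then show False by simp
  qed
  define p where "p x = inv_into A F (Q x)" for x
  have p: "p x \<in> A" "F (p x) = Q x" if "x \<in> topspace X" for x
    using Q_in[OF that] by (auto simp: p_def inv_into_into f_inv_into_f)
  have p_unique: "p x = a" if "x \<in> topspace X" "a \<in> A" "Q x = F a" for x a
    using F_inj p[OF that(1)] that A_topspace by (simp add: inj_on_def)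
  \<comment> \<open>\<open>Q\<close> was obtained as a pointwise limit. Its continuity comes from
    its being a combination of the finitely many limits \<open>Q p\<close> with continuous
    coefficients \<open>c p\<close>.\<close>
  have Q_cont: "continuous_map X euclidean Q"
  proof -
    have "continuous_map X euclideanreal (\<lambda>x. Q x k)" for k
    proof (cases "k < n")
      case True
      have "Q x k = (\<Sum>p\<in>P. c p x * Q p k)" if x: "x \<in> topspace X" for x
      proof (rule LIMSEQ_unique[OF Q[OF x True]])
        show "(\<lambda>i. F (\<Phi> (s (q i)) x) k) \<longlonglongrightarrow> (\<Sum>p\<in>P. c p x * Q p k)"
          unfolding P(4)[OF x True] using P(2) by (intro tendsto_intros Q True) auto
      qed
      moreover have "continuous_map X euclideanreal (\<lambda>x. \<Sum>p\<in>P. c p x * Q p k)"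
        using P(1,3) by (intro continuous_intros linear_form_F_cont) auto
      ultimately show ?thesis using continuous_map_eq[of X euclideanreal _ "\<lambda>x. Q x k"] by simp
    next
      case False
      then show ?thesis using Q0 by simp
    qed
    then show ?thesis
      unfolding euclidean_product_topology[symmetric] by (simp add: continuous_map_componentwise_UNIV)
  qed
  have "continuous_map X (subtopology X A) p"
  proof -
    have "continuous_map X X p"
      unfolding continuous_map_closedin
    proof (intro conjI allI impI)
      show "p \<in> topspace X \<rightarrow> topspace X" using p(1) A_topspace by blast
      fix C assume C: "closedin X C"
      have "compactin X (C \<inter> A)" using closed_Int_compactin[OF C A_compact] .
      then have "compact (F ` (C \<inter> A))" using image_compactin[OF _ F_cont] by simp
      then have "closed (F ` (C \<inter> A))" by (rule compact_imp_closed)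
      then have "closedin X {x \<in> topspace X. Q x \<in> F ` (C \<inter> A)}"
        by (intro closedin_continuous_map_preimage[OF Q_cont]) simp
      moreover have "{x \<in> topspace X. Q x \<in> F ` (C \<inter> A)} = {x \<in> topspace X. p x \<in> C}"
        using p p_unique by (auto intro!: image_eqI)
      ultimately show "closedin X {x \<in> topspace X. p x \<in> C}" by simp
    qed
    then show ?thesis using p(1) by (auto simp: continuous_map_in_subtopology)
  qed
  moreover have "p a = a" if "a \<in> A" for a
    using p_unique[OF A_topspace] Q_A that by blast
  moreover have "p (\<Phi> t x) = \<Phi> t (p x)" if x: "x \<in> topspace X" for t x
  proof (rule p_unique)
    show "Q (\<Phi> t x) = F (\<Phi> t (p x))"
    proof
      fix k show "Q (\<Phi> t x) k = F (\<Phi> t (p x)) k"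
      proof (cases "k < n")
        case True
        have "(\<lambda>i. F (\<Phi> (s (q i)) (\<Phi> t x)) k) \<longlonglongrightarrow> (\<Sum>j<n. E t k j * Q x j)"
        proof -
          have "F (\<Phi> (s (q i)) (\<Phi> t x)) k = (\<Sum>j<n. E t k j * F (\<Phi> (s (q i)) x) j)" for i
            using F_flow[OF flow_in[OF x, of "s (q i)"] True, of t] flow_add[OF x, of "s (q i)" t] flow_add[OF x, of t "s (q i)"]
            by (simp add: add.commute)
          then show ?thesis by (simp only:) (intro tendsto_intros Q[OF x], simp)
        qed
        from LIMSEQ_unique[OF Q[OF flow_in[OF x] True] this]
        show ?thesis using F_flow[OF A_topspace[OF p(1)[OF x]] True] p(2)[OF x] by simp
      qed (use F0 Q0 x A_topspace[OF p(1)[OF x]] in auto)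
    qed
  qed (use x p(1) flow_A in auto)
  ultimately show ?thesis unfolding has_asymptotic_phase_def by blast
qed

end

section \<open>Bounded orbits of a matrix exponential are trigonometric polynomials\<close>

definition trig_poly :: "(real \<Rightarrow> complex) \<Rightarrow> bool" where
  "trig_poly u \<longleftrightarrow> (\<exists>\<Omega> a. finite \<Omega> \<and> (\<forall>t. u t = (\<Sum>\<omega>\<in>\<Omega>. a \<omega> * cis (\<omega> * t))))"

lemma trig_polyI: "\<lbrakk>finite \<Omega>; \<And>t. u t = (\<Sum>\<omega>\<in>\<Omega>. a \<omega> * cis (\<omega> * t))\<rbrakk> \<Longrightarrow> trig_poly u"
  unfolding trig_poly_def by blast

lemma trig_poly_zero: "trig_poly (\<lambda>_. 0)"
  by (rule trig_polyI[of "{}"]) auto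

lemma trig_poly_cis: "trig_poly (\<lambda>t. c * cis (\<omega> * t))"
  by (rule trig_polyI[of "{\<omega>}" _ "\<lambda>_. c"]) auto

lemma sum_extend:
  fixes g :: "real \<Rightarrow> complex"
  assumes "finite T" "S \<subseteq> T"
  shows "(\<Sum>\<omega>\<in>S. a \<omega> * g \<omega>) = (\<Sum>\<omega>\<in>T. (if \<omega> \<in> S then a \<omega> else 0) * g \<omega>)"
  using assms by (intro sum.mono_neutral_cong_left) auto

lemma trig_poly_add:
  assumes "trig_poly u" "trig_poly v"
  shows "trig_poly (\<lambda>t. u t + v t)"
proof -
  obtain S a T b where S: "finite S" "\<And>t. u t = (\<Sum>\<omega>\<in>S. a \<omega> * cis (\<omega> * t))"
    and T: "finite T" "\<And>t. v t = (\<Sum>\<omega>\<in>T. b \<omega> * cis (\<omega> * t))"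
    using assms unfolding trig_poly_def by metis
  have fin: "finite (S \<union> T)" using S T by simp
  show ?thesis
  proof (rule trig_polyI[OF fin])
    fix t
    show "u t + v t = (\<Sum>\<omega>\<in>S \<union> T. ((if \<omega> \<in> S then a \<omega> else 0) + (if \<omega> \<in> T then b \<omega> else 0)) * cis (\<omega> * t))"
      unfolding S(2) T(2) distrib_right sum.distrib
      using sum_extend[OF fin, of S a "\<lambda>\<omega>. cis (\<omega> * t)"] sum_extend[OF fin, of T b "\<lambda>\<omega>. cis (\<omega> * t)"] by simp
  qed
qed

lemma cis_has_vector_derivative:
  "((\<lambda>t. cis (\<omega> * t)) has_vector_derivative (\<i> * of_real \<omega> * cis (\<omega> * t))) (at t)"
proof -
  have "((\<lambda>t. exp (of_real t * (\<i> * of_real \<omega>))) has_vector_derivative (\<i> * of_real \<omega>) * exp (of_real t * (\<i> * of_real \<omega>))) (at t)"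
    by (auto intro!: derivative_eq_intros has_vector_derivative_real_field)
  then show ?thesis by (simp add: cis_conv_exp mult_ac)
qed

text \<open>Differentiating and subtracting \<open>\<i> * \<omega>0\<close> times the sum removes
  the frequency \<open>\<omega>0\<close> and multiplies each other coefficient by the nonzero number
  \<open>\<omega> - \<omega>0\<close>, up to a common factor.\<close>

lemma trig_poly_independent:
  assumes "finite \<Omega>" "\<And>t. (\<Sum>\<omega>\<in>\<Omega>. a \<omega> * cis (\<omega> * t)) = 0" "\<omega> \<in> \<Omega>"
  shows "a \<omega> = 0"
  using assms
proof (induction \<Omega> arbitrary: a \<omega> rule: finite_induct)
  case (insert \<omega>0 \<Omega>)
  let ?f = "\<lambda>t. \<Sum>\<omega>\<in>insert \<omega>0 \<Omega>. a \<omega> * cis (\<omega> * t)"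
  have "(?f has_vector_derivative (\<Sum>\<omega>\<in>insert \<omega>0 \<Omega>. a \<omega> * (\<i> * of_real \<omega> * cis (\<omega> * t)))) (at t)" for t
    by (intro has_vector_derivative_sum has_vector_derivative_mult_right cis_has_vector_derivative)
  moreover have "?f = (\<lambda>_. 0)" using insert.prems by blast
  then have "(?f has_vector_derivative 0) (at t)" for t by simp
  ultimately have d: "(\<Sum>\<omega>\<in>insert \<omega>0 \<Omega>. a \<omega> * (\<i> * of_real \<omega> * cis (\<omega> * t))) = 0" for t
    using vector_derivative_unique_at by blast
  have "(\<Sum>\<omega>\<in>\<Omega>. (a \<omega> * (of_real \<omega> - of_real \<omega>0)) * cis (\<omega> * t)) = 0" for t
  proof -
    have "0 = (\<Sum>\<omega>\<in>insert \<omega>0 \<Omega>. a \<omega> * (\<i> * of_real \<omega> * cis (\<omega> * t))) - \<i> * of_real \<omega>0 * ?f t"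
      using d insert.prems(1) by simp
    also have "\<dots> = (\<Sum>\<omega>\<in>insert \<omega>0 \<Omega>. \<i> * ((a \<omega> * (of_real \<omega> - of_real \<omega>0)) * cis (\<omega> * t)))"
      unfolding sum_distrib_left sum_subtractf[symmetric] by (intro sum.cong) (auto simp: algebra_simps)
    also have "\<dots> = \<i> * (\<Sum>\<omega>\<in>\<Omega>. (a \<omega> * (of_real \<omega> - of_real \<omega>0)) * cis (\<omega> * t))"
      using insert.hyps by (simp add: sum_distrib_left)
    finally show ?thesis by simp
  qed
  then have z: "a \<omega> = 0" if "\<omega> \<in> \<Omega>" for \<omega>
    using insert.IH[of "\<lambda>\<omega>. a \<omega> * (of_real \<omega> - of_real \<omega>0)" \<omega>] that insert.hyps by auto
  then have "a \<omega>0 * cis (\<omega>0 * 0) = 0" using insert.prems(1)[of 0] insert.hyps by simp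
  then show ?case using z insert.prems(2) by auto
qed simp

text \<open>Variation of constants: \<open>p\<close> solves the equation for the non-resonant
  frequencies \<open>I\<close>. The remainder \<open>w\<close>, multiplied by the integrating
  factor, has constant derivative \<open>c\<close>, since every resonant term becomes constant.
  Boundedness excludes linear and exponential growth.\<close>

lemma bounded_first_order_trig_poly:
  assumes deriv: "\<And>t. (u has_vector_derivative (\<mu> * u t + v t)) (at t)"
    and v: "trig_poly v" and bdd: "\<And>t. norm (u t) \<le> M"
  shows "trig_poly u"
proof -
  obtain \<Omega> a where \<Omega>: "finite \<Omega>" "\<And>t. v t = (\<Sum>\<omega>\<in>\<Omega>. a \<omega> * cis (\<omega> * t))"
    using v unfolding trig_poly_def by blast
  define I where "I = {\<omega> \<in> \<Omega>. \<i> * of_real \<omega> \<noteq> \<mu>}"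
  define p where "p t = (\<Sum>\<omega>\<in>I. a \<omega> / (\<i> * of_real \<omega> - \<mu>) * cis (\<omega> * t))" for t
  have finI: "finite I" using \<Omega>(1) by (simp add: I_def)
  have p_trig: "trig_poly p" by (rule trig_polyI[OF finI, of _ "\<lambda>\<omega>. a \<omega> / (\<i> * of_real \<omega> - \<mu>)"]) (simp add: p_def)
  have p_bdd: "norm (p t) \<le> (\<Sum>\<omega>\<in>I. norm (a \<omega> / (\<i> * of_real \<omega> - \<mu>)))" for t
    unfolding p_def by (rule order_trans[OF norm_sum]) (simp add: norm_mult norm_divide)
  define c where "c = (\<Sum>\<omega>\<in>\<Omega> - I. a \<omega>)"
  define w where "w t = u t - p t" for t
  define N where "N = M + (\<Sum>\<omega>\<in>I. norm (a \<omega> / (\<i> * of_real \<omega> - \<mu>)))"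
  have w_bdd: "norm (w t) \<le> N" for t
    unfolding w_def N_def using norm_triangle_ineq4[of "u t" "p t"] bdd[of t] p_bdd[of t] by linarith
  define z where "z t = exp (- (of_real t * \<mu>)) * w t" for t
  have exp_cis: "exp (- (of_real t * \<mu>)) * cis (\<omega> * t) = 1" if "\<omega> \<in> \<Omega> - I" for t \<omega>
  proof -
    have "\<mu> = \<i> * of_real \<omega>" using that by (auto simp: I_def)
    then show ?thesis by (simp add: cis_conv_exp flip: exp_add)
  qed
  have alg: "r / (x - m) * (x * e) - m * (r / (x - m) * e) = r * e" if "x - m \<noteq> 0" for r x m e :: complex
  proof -
    have "q * (x * e) - m * (q * e) = q * (x - m) * e" for q by (simp add: algebra_simps)
    from this[of "r / (x - m)"]
    have "r / (x - m) * (x * e) - m * (r / (x - m) * e) = r / (x - m) * (x - m) * e" .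
    then show ?thesis using that by simp
  qed
  have dz: "(z has_vector_derivative c) (at t)" for t
  proof -
    have dp: "(p has_vector_derivative (\<Sum>\<omega>\<in>I. a \<omega> / (\<i> * of_real \<omega> - \<mu>) * (\<i> * of_real \<omega> * cis (\<omega> * t)))) (at t)"
      unfolding p_def by (intro has_vector_derivative_sum has_vector_derivative_mult_right cis_has_vector_derivative)
    have "(\<Sum>\<omega>\<in>I. a \<omega> / (\<i> * of_real \<omega> - \<mu>) * (\<i> * of_real \<omega> * cis (\<omega> * t))) - \<mu> * p t = (\<Sum>\<omega>\<in>I. a \<omega> * cis (\<omega> * t))"
      unfolding p_def sum_distrib_left sum_subtractf[symmetric]
    proof (rule sum.cong[OF refl])
      fix \<omega> assume "\<omega> \<in> I"
      then have "\<i> * of_real \<omega> - \<mu> \<noteq> 0" by (simp add: I_def)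
      then show "a \<omega> / (\<i> * of_real \<omega> - \<mu>) * (\<i> * of_real \<omega> * cis (\<omega> * t)) - \<mu> * (a \<omega> / (\<i> * of_real \<omega> - \<mu>) * cis (\<omega> * t)) = a \<omega> * cis (\<omega> * t)"
        using alg by metis
    qed
    then have eq: "(\<Sum>\<omega>\<in>I. a \<omega> / (\<i> * of_real \<omega> - \<mu>) * (\<i> * of_real \<omega> * cis (\<omega> * t))) = \<mu> * p t + (\<Sum>\<omega>\<in>I. a \<omega> * cis (\<omega> * t))"
      by (simp add: algebra_simps)
    have dp': "(p has_vector_derivative (\<mu> * p t + (\<Sum>\<omega>\<in>I. a \<omega> * cis (\<omega> * t)))) (at t)"
      using dp unfolding eq .
    have dw: "(w has_vector_derivative ((\<mu> * u t + v t) - (\<mu> * p t + (\<Sum>\<omega>\<in>I. a \<omega> * cis (\<omega> * t))))) (at t)"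
      unfolding w_def by (intro has_vector_derivative_diff deriv dp')
    have split: "v t = (\<Sum>\<omega>\<in>I. a \<omega> * cis (\<omega> * t)) + (\<Sum>\<omega>\<in>\<Omega> - I. a \<omega> * cis (\<omega> * t))"
      unfolding \<Omega>(2) using \<Omega>(1) by (subst sum.subset_diff[of I \<Omega>]) (auto simp: I_def)
    have dw': "(w has_vector_derivative (\<mu> * w t + (\<Sum>\<omega>\<in>\<Omega> - I. a \<omega> * cis (\<omega> * t)))) (at t)"
      using dw unfolding split by (simp add: w_def algebra_simps)
    have de: "((\<lambda>t. exp (- (of_real t * \<mu>))) has_vector_derivative (- \<mu> * exp (- (of_real t * \<mu>)))) (at t)"
      by (rule has_vector_derivative_real_field) (auto intro!: derivative_eq_intros)
    have "(z has_vector_derivative (exp (- (of_real t * \<mu>)) * (\<mu> * w t + (\<Sum>\<omega>\<in>\<Omega> - I. a \<omega> * cis (\<omega> * t)))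
        + (- \<mu> * exp (- (of_real t * \<mu>))) * w t)) (at t)"
      unfolding z_def by (intro has_vector_derivative_mult de dw')
    moreover have "exp (- (of_real t * \<mu>)) * (\<mu> * w t + (\<Sum>\<omega>\<in>\<Omega> - I. a \<omega> * cis (\<omega> * t)))
        + (- \<mu> * exp (- (of_real t * \<mu>))) * w t = (\<Sum>\<omega>\<in>\<Omega> - I. a \<omega> * (exp (- (of_real t * \<mu>)) * cis (\<omega> * t)))"
      by (simp add: algebra_simps sum_distrib_left)
    moreover have "\<dots> = c" unfolding c_def by (intro sum.cong refl) (simp only: exp_cis mult_1_right)
    ultimately show ?thesis by simp
  qed
  have "((\<lambda>t. z t - of_real t * c) has_vector_derivative 0) (at t within UNIV)" for t
  proof -
    have "((\<lambda>t. of_real t * c) has_vector_derivative c) (at t)"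
      by (rule has_vector_derivative_real_field) (auto intro!: derivative_eq_intros)
    from has_vector_derivative_diff[OF dz this] show ?thesis by simp
  qed
  then obtain k where "\<And>t. t \<in> UNIV \<Longrightarrow> z t - of_real t * c = k"
    using has_vector_derivative_zero_constant[OF convex_UNIV, of "\<lambda>t. z t - of_real t * c"] by blast
  then have k: "z t = k + of_real t * c" for t by (metis UNIV_I diff_add_cancel)
  have w: "w t = exp (of_real t * \<mu>) * (k + of_real t * c)" for t
  proof -
    have "w t = exp (of_real t * \<mu>) * z t"
      by (simp add: z_def exp_minus)
    then show ?thesis by (simp add: k)
  qed
  have nw: "norm (w t) = exp (t * Re \<mu>) * norm (k + of_real t * c)" for t
    unfolding w norm_mult norm_exp_eq_Re by simp
  \<comment> \<open>A nonzero \<open>c\<close> requires a resonant frequency, hence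
    \<open>Re \<mu> = 0\<close>; then \<open>k + t * c\<close> would be bounded in
    \<open>t\<close>.\<close>
  have "c = 0"
  proof (rule ccontr)
    assume c: "c \<noteq> 0"
    have "\<Omega> - I \<noteq> {}"
    proof
      assume "\<Omega> - I = {}"
      then have "c = 0" unfolding c_def by (simp only: sum.empty)
      then show False using c by contradiction
    qed
    then have "Re \<mu> = 0" by (auto simp: I_def)
    then have le: "norm (k + of_real t * c) \<le> N" for t using nw[of t] w_bdd[of t] by simp
    define t where "t = (N + norm k + 1) / norm c"
    have N0: "N \<ge> 0" using w_bdd[of 0] norm_ge_zero order_trans by blast
    have "norm (of_real t * c) = N + norm k + 1"
      unfolding norm_mult norm_of_real using c N0 by (simp add: t_def)
    moreover have "norm (of_real t * c) \<le> norm (k + of_real t * c) + norm k"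
      using norm_triangle_ineq4[of "k + of_real t * c" k] by simp
    ultimately show False using le[of t] by linarith
  qed
  have "trig_poly w"
  proof (cases "k = 0")
    case True
    then have "w = (\<lambda>_. 0)" using w \<open>c = 0\<close> by auto
    then show ?thesis using trig_poly_zero by simp
  next
    case False
    have le: "exp (t * Re \<mu>) \<le> N / norm k" for t
      using nw[of t] w_bdd[of t] False \<open>c = 0\<close> by (simp add: field_simps)
    have "Re \<mu> = 0"
    proof (rule ccontr)
      assume "Re \<mu> \<noteq> 0"
      \<comment> \<open>The time is chosen so that the exponent equals the alleged bound, which
        contradicts \<open>x < exp x\<close>.\<close>
      then have "exp (N / norm k) \<le> N / norm k" using le[of "N / norm k / Re \<mu>"] by simp
      then show False using exp_gt_self[of "N / norm k"] by linarith
    qed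
    then have eq: "of_real t * \<mu> = \<i> * of_real (Im \<mu> * t)" for t by (simp add: complex_eq_iff)
    have "w t = k * cis (Im \<mu> * t)" for t
      unfolding w eq cis_conv_exp using \<open>c = 0\<close> by simp
    then have "w = (\<lambda>t. k * cis (Im \<mu> * t))" by blast
    then show ?thesis using trig_poly_cis by simp
  qed
  then have "trig_poly (\<lambda>t. w t + p t)" using p_trig by (rule trig_poly_add)
  then show ?thesis by (simp add: w_def)
qed

text \<open>\<open>u i\<close> stands for the \<open>i\<close>-th derivative. A root
  \<open>z\<close> of the characteristic polynomial splits off a first-order factor:
  \<open>u' - z * u\<close> solves the equation of the quotient \<open>r\<close>, so it is a
  trigonometric polynomial by induction, and \<open>u\<close> is recovered from a first-order
  equation.\<close>

lemma bounded_ode_trig_poly: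
  fixes u :: "nat \<Rightarrow> real \<Rightarrow> complex" and q :: "complex poly"
  assumes "\<And>i t. (u i has_vector_derivative u (Suc i) t) (at t)"
    and "\<And>i. \<exists>M. \<forall>t. norm (u i t) \<le> M" and "q \<noteq> 0" and "degree q = N"
    and "\<And>i t. (\<Sum>k\<le>N. coeff q k * u (k + i) t) = 0"
  shows "trig_poly (u i)"
  using assms
proof (induction N arbitrary: u q i)
  case 0
  then have "coeff q 0 \<noteq> 0" by (metis leading_coeff_0_iff)
  then have "u i = (\<lambda>_. 0)" using 0(5)[of i] by auto
  then show ?case using trig_poly_zero by simp
next
  case (Suc N)
  have "\<not> constant (poly q)" using Suc.prems(4) by (simp add: constant_degree)
  then obtain z where "poly q z = 0" using fundamental_theorem_of_algebra by blast
  then obtain r where r: "q = [:-z, 1:] * r" using poly_eq_0_iff_dvd by (meson dvdE)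
  have r0: "r \<noteq> 0" using r Suc.prems(3) by auto
  have deg: "degree r = N"
    using Suc.prems(4) r0 unfolding r by (subst (asm) degree_mult_eq) auto
  have cq: "coeff q k = (if k = 0 then 0 else coeff r (k - 1)) - z * coeff r k" for k
    unfolding r by (cases k) (auto simp: coeff_pCons)
  define v where "v i t = u (Suc i) t - z * u i t" for i t
  have "trig_poly (v i)" for i
  proof (rule Suc.IH[of v r])
    show "(v i has_vector_derivative v (Suc i) t) (at t)" for i t
      unfolding v_def by (intro has_vector_derivative_diff has_vector_derivative_mult_right Suc.prems(1))
    show "\<exists>M. \<forall>t. norm (v i t) \<le> M" for i
    proof -
      obtain M M' where "\<forall>t. norm (u i t) \<le> M" "\<forall>t. norm (u (Suc i) t) \<le> M'"
        using Suc.prems(2) by metis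
      then have "norm (v i t) \<le> M' + norm z * M" for t
        unfolding v_def by (intro order_trans[OF norm_triangle_ineq4] add_mono) (auto simp: norm_mult mult_left_mono)
      then show ?thesis by blast
    qed
    show "(\<Sum>k\<le>N. coeff r k * v (k + i) t) = 0" for i t
    proof -
      have rS: "coeff r (Suc N) = 0" using deg by (simp add: coeff_eq_0)
      have "0 = (\<Sum>k\<le>Suc N. coeff q k * u (k + i) t)" using Suc.prems(5) by simp
      also have "\<dots> = (\<Sum>k\<le>Suc N. (if k = 0 then 0 else coeff r (k - 1)) * u (k + i) t) - z * (\<Sum>k\<le>Suc N. coeff r k * u (k + i) t)"
        unfolding cq sum_distrib_left sum_subtractf[symmetric] by (intro sum.cong) (auto simp: algebra_simps)
      also have "(\<Sum>k\<le>Suc N. (if k = 0 then 0 else coeff r (k - 1)) * u (k + i) t) = (\<Sum>k\<le>N. coeff r k * u (Suc (k + i)) t)"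
        by (subst sum.atMost_Suc_shift) simp
      also have "(\<Sum>k\<le>Suc N. coeff r k * u (k + i) t) = (\<Sum>k\<le>N. coeff r k * u (k + i) t)"
        using rS by simp
      also have "(\<Sum>k\<le>N. coeff r k * u (Suc (k + i)) t) - z * (\<Sum>k\<le>N. coeff r k * u (k + i) t) = (\<Sum>k\<le>N. coeff r k * v (k + i) t)"
        unfolding v_def sum_distrib_left sum_subtractf[symmetric] by (intro sum.cong) (auto simp: algebra_simps)
      finally show ?thesis by simp
    qed
  qed (use r0 deg in auto)
  moreover obtain M where "\<And>t. norm (u i t) \<le> M" using Suc.prems(2) by metis
  moreover have "(u i has_vector_derivative (z * u i t + v i t)) (at t)" for t
    using Suc.prems(1)[of i t] by (simp add: v_def)
  ultimately show ?case using bounded_first_order_trig_poly by blast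
qed

lemma pow_mat_entry_Suc:
  assumes "B \<in> carrier_mat n n" "i < n" "j < n"
  shows "(B ^\<^sub>m Suc k) $$ (i, j) = (\<Sum>l<n. (B ^\<^sub>m k) $$ (i, l) * B $$ (l, j))"
  using assms by (simp add: scalar_prod_def lessThan_atLeast0)

lemma pow_mat_entry_add:
  assumes "B \<in> carrier_mat n n" "i < n" "j < n"
  shows "(B ^\<^sub>m (k + m)) $$ (i, j) = (\<Sum>l<n. (B ^\<^sub>m k) $$ (i, l) * (B ^\<^sub>m m) $$ (l, j))"
  using assms(3)
proof (induction m arbitrary: j)
  case 0
  then have "(\<Sum>l<n. (B ^\<^sub>m k) $$ (i, l) * (B ^\<^sub>m 0) $$ (l, j)) = (\<Sum>l<n. if l = j then (B ^\<^sub>m k) $$ (i, l) else 0)"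
    using assms by (intro sum.cong) auto
  then show ?case using 0 by simp
next
  case (Suc m)
  have "(B ^\<^sub>m (k + Suc m)) $$ (i, j) = (\<Sum>p<n. (\<Sum>l<n. (B ^\<^sub>m k) $$ (i, l) * (B ^\<^sub>m m) $$ (l, p)) * B $$ (p, j))"
    using pow_mat_entry_Suc[OF assms(1,2) Suc.prems, of "k + m"] Suc.IH by simp
  also have "\<dots> = (\<Sum>l<n. (B ^\<^sub>m k) $$ (i, l) * (\<Sum>p<n. (B ^\<^sub>m m) $$ (l, p) * B $$ (p, j)))"
    unfolding sum_distrib_left sum_distrib_right by (subst sum.swap) (simp add: mult.assoc)
  also have "\<dots> = (\<Sum>l<n. (B ^\<^sub>m k) $$ (i, l) * (B ^\<^sub>m Suc m) $$ (l, j))"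
    using pow_mat_entry_Suc[OF assms(1) _ Suc.prems] by (intro sum.cong) auto
  finally show ?case .
qed

lemma pow_smult_mat_entry:
  fixes B :: "real mat"
  assumes "B \<in> carrier_mat n n" "i < n" "j < n"
  shows "((t \<cdot>\<^sub>m B) ^\<^sub>m k) $$ (i, j) = t ^ k * (B ^\<^sub>m k) $$ (i, j)"
  using assms(3)
proof (induction k arbitrary: j)
  case 0
  then show ?case using assms by simp
next
  case (Suc k)
  have "t \<cdot>\<^sub>m B \<in> carrier_mat n n" using assms by simp
  from pow_mat_entry_Suc[OF this assms(2) Suc.prems, of k]
  show ?case unfolding pow_mat_entry_Suc[OF assms(1,2) Suc.prems]
    using Suc.IH assms Suc.prems by (simp add: sum_distrib_left mult_ac)
qed

lemma pow_mat_entry_bound: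
  fixes B :: "real mat"
  assumes "B \<in> carrier_mat n n" "i < n" "j < n"
  shows "\<bar>(B ^\<^sub>m k) $$ (i, j)\<bar> \<le> (\<Sum>i<n. \<Sum>j<n. \<bar>B $$ (i, j)\<bar>) ^ k"
  using assms(3)
proof (induction k arbitrary: j)
  case 0
  then show ?case using assms by simp
next
  case (Suc k)
  let ?b = "\<Sum>i<n. \<Sum>j<n. \<bar>B $$ (i, j)\<bar>"
  have "\<bar>(B ^\<^sub>m Suc k) $$ (i, j)\<bar> \<le> (\<Sum>l<n. \<bar>(B ^\<^sub>m k) $$ (i, l)\<bar> * \<bar>B $$ (l, j)\<bar>)"
    unfolding pow_mat_entry_Suc[OF assms(1,2) Suc.prems] by (rule order_trans[OF sum_abs]) (simp add: abs_mult)
  also have "\<dots> \<le> (\<Sum>l<n. ?b ^ k * (\<Sum>j<n. \<bar>B $$ (l, j)\<bar>))"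
    using Suc.IH Suc.prems
    by (intro sum_mono mult_mono member_le_sum[of j "{..<n}" "\<lambda>j. \<bar>B $$ (_, j)\<bar>"]) (auto intro!: zero_le_power sum_nonneg)
  also have "\<dots> = ?b ^ Suc k" by (simp add: sum_distrib_left[symmetric])
  finally show ?case .
qed

text \<open>This is the entry of the \<open>m\<close>-th power of \<open>B\<close> times the
  exponential of \<open>t * B\<close>, in other words the \<open>m\<close>-th derivative of the
  exponential, written as a power series in \<open>t\<close>.\<close>

definition mat_exp_deriv :: "real mat \<Rightarrow> nat \<Rightarrow> real \<Rightarrow> nat \<Rightarrow> nat \<Rightarrow> real" where
  "mat_exp_deriv B m t i j = (\<Sum>k. (B ^\<^sub>m (k + m)) $$ (i, j) / fact k * t ^ k)"

lemma mat_exp_entry: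
  assumes "B \<in> carrier_mat n n" "i < n" "j < n"
  shows "mat_exp (t \<cdot>\<^sub>m B) $$ (i, j) = mat_exp_deriv B 0 t i j"
  using assms pow_smult_mat_entry[OF assms] by (simp add: mat_exp_def mat_exp_deriv_def mult.commute)

lemma mat_exp_deriv_summable:
  fixes B :: "real mat"
  assumes "B \<in> carrier_mat n n" "i < n" "j < n"
  shows "summable (\<lambda>k. (B ^\<^sub>m (k + m)) $$ (i, j) / fact k * t ^ k)"
proof (rule summable_comparison_test)
  define b where "b = (\<Sum>i<n. \<Sum>j<n. \<bar>B $$ (i, j)\<bar>)"
  have "norm ((B ^\<^sub>m (k + m)) $$ (i, j) / fact k * t ^ k) \<le> b ^ m * (inverse (fact k) * (b * \<bar>t\<bar>) ^ k)" for k
  proof -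
    have "norm ((B ^\<^sub>m (k + m)) $$ (i, j) / fact k * t ^ k) = \<bar>(B ^\<^sub>m (k + m)) $$ (i, j)\<bar> * (inverse (fact k) * \<bar>t\<bar> ^ k)"
      by (simp add: abs_mult power_abs divide_inverse)
    also have "\<dots> \<le> b ^ (k + m) * (inverse (fact k) * \<bar>t\<bar> ^ k)"
      using pow_mat_entry_bound[OF assms, of "k + m"] unfolding b_def by (intro mult_right_mono) auto
    finally show ?thesis by (simp add: power_add power_mult_distrib mult_ac)
  qed
  then show "\<exists>N. \<forall>k\<ge>N. norm ((B ^\<^sub>m (k + m)) $$ (i, j) / fact k * t ^ k) \<le> b ^ m * (inverse (fact k) * (b * \<bar>t\<bar>) ^ k)"
    by blast
  show "summable (\<lambda>k. b ^ m * (inverse (fact k) * (b * \<bar>t\<bar>) ^ k))"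
    by (intro summable_mult summable_exp)
qed

lemma mat_exp_deriv_has_derivative:
  fixes B :: "real mat"
  assumes "B \<in> carrier_mat n n" "i < n" "j < n"
  shows "((\<lambda>t. mat_exp_deriv B m t i j) has_field_derivative mat_exp_deriv B (Suc m) t i j) (at t)"
proof -
  have "((\<lambda>t. \<Sum>k. (B ^\<^sub>m (k + m)) $$ (i, j) / fact k * t ^ k) has_field_derivative
     (\<Sum>k. diffs (\<lambda>k. (B ^\<^sub>m (k + m)) $$ (i, j) / fact k) k * t ^ k)) (at t)"
    by (rule termdiffs_strong_converges_everywhere[OF mat_exp_deriv_summable[OF assms]])
  moreover have "diffs (\<lambda>k. (B ^\<^sub>m (k + m)) $$ (i, j) / fact k) k = (B ^\<^sub>m (k + Suc m)) $$ (i, j) / fact k" for k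
    by (simp add: diffs_def del: pow_mat.simps)
  ultimately show ?thesis unfolding mat_exp_deriv_def by simp
qed

lemma mat_exp_deriv_shift:
  fixes B :: "real mat"
  assumes "B \<in> carrier_mat n n" "i < n" "j < n"
  shows "mat_exp_deriv B (m + p) t i j = (\<Sum>l<n. (B ^\<^sub>m m) $$ (i, l) * mat_exp_deriv B p t l j)"
proof -
  have "(B ^\<^sub>m (k + (m + p))) $$ (i, j) / fact k * t ^ k = (\<Sum>l<n. (B ^\<^sub>m m) $$ (i, l) * ((B ^\<^sub>m (k + p)) $$ (l, j) / fact k * t ^ k))" for k
    using pow_mat_entry_add[OF assms, of m "k + p"]
    by (simp add: sum_divide_distrib sum_distrib_left sum_distrib_right add.left_commute mult_ac)
  then have "mat_exp_deriv B (m + p) t i j = (\<Sum>k. \<Sum>l<n. (B ^\<^sub>m m) $$ (i, l) * ((B ^\<^sub>m (k + p)) $$ (l, j) / fact k * t ^ k))"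
    unfolding mat_exp_deriv_def by simp
  also have "\<dots> = (\<Sum>l<n. \<Sum>k. (B ^\<^sub>m m) $$ (i, l) * ((B ^\<^sub>m (k + p)) $$ (l, j) / fact k * t ^ k))"
    using assms by (intro suminf_sum summable_mult mat_exp_deriv_summable) auto
  also have "\<dots> = (\<Sum>l<n. (B ^\<^sub>m m) $$ (i, l) * mat_exp_deriv B p t l j)"
    unfolding mat_exp_deriv_def using assms
    by (intro sum.cong refl suminf_mult mat_exp_deriv_summable) auto
  finally show ?thesis .
qed

text \<open>Takes the place of the Cayley-Hamilton theorem: finitely many powers span all of them,
  and any exponent \<open>N\<close> above those gives a monic relation.\<close>

lemma pow_mat_dependent:
  fixes B :: "real mat"
  assumes B: "B \<in> carrier_mat n n"
  obtains N c where "\<And>i j. \<lbrakk>i < n; j < n\<rbrakk> \<Longrightarrow> (B ^\<^sub>m N) $$ (i, j) = (\<Sum>p<N. c p * (B ^\<^sub>m p) $$ (i, j))"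
proof -
  obtain P c where P: "finite P" "P \<subseteq> (UNIV :: nat set)"
      "\<forall>m\<in>UNIV. \<forall>ij\<in>{..<n} \<times> {..<n}. (B ^\<^sub>m m) $$ ij = (\<Sum>p\<in>P. c p m * (B ^\<^sub>m p) $$ ij)"
    using rank_factorization[of "{..<n} \<times> {..<n}" UNIV "\<lambda>m ij. (B ^\<^sub>m m) $$ ij"] by auto
  obtain N where N: "P \<subseteq> {..<N}" using P(1) finite_nat_iff_bounded by blast
  show thesis
  proof
    fix i j assume "i < n" "j < n"
    then have "(B ^\<^sub>m N) $$ (i, j) = (\<Sum>p\<in>P. c p N * (B ^\<^sub>m p) $$ (i, j))" using P(3) by auto
    also have "\<dots> = (\<Sum>p<N. (if p \<in> P then c p N else 0) * (B ^\<^sub>m p) $$ (i, j))"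
      using N by (intro sum.mono_neutral_cong_left) auto
    finally show "(B ^\<^sub>m N) $$ (i, j) = (\<Sum>p<N. (if p \<in> P then c p N else 0) * (B ^\<^sub>m p) $$ (i, j))" .
  qed
qed

text \<open>The relation between powers of \<open>B\<close> is a scalar differential equation with
  constant coefficients for each component of the orbit. All derivatives \<open>w i\<close> are
  bounded too, as fixed linear combinations of the components of the orbit.\<close>

theorem bounded_mat_exp_orbit_trig_poly:
  fixes B :: "real mat" and x :: "nat \<Rightarrow> real"
  assumes B: "B \<in> carrier_mat n n"
    and bdd: "\<And>k. k < n \<Longrightarrow> \<exists>M. \<forall>t. \<bar>\<Sum>j<n. mat_exp (t \<cdot>\<^sub>m B) $$ (k, j) * x j\<bar> \<le> M"
    and k: "k < n"
  shows "trig_poly (\<lambda>t. of_real (\<Sum>j<n. mat_exp (t \<cdot>\<^sub>m B) $$ (k, j) * x j))"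
proof -
  define w where "w m k t = (\<Sum>j<n. mat_exp_deriv B m t k j * x j)" for m k t
  have w0: "w 0 k t = (\<Sum>j<n. mat_exp (t \<cdot>\<^sub>m B) $$ (k, j) * x j)" if "k < n" for k t
    using mat_exp_entry[OF B that] by (simp add: w_def)
  have wshift: "w (m + p) k t = (\<Sum>l<n. (B ^\<^sub>m m) $$ (k, l) * w p l t)" if "k < n" for m p k t
  proof -
    have "w (m + p) k t = (\<Sum>j<n. (\<Sum>l<n. (B ^\<^sub>m m) $$ (k, l) * mat_exp_deriv B p t l j) * x j)"
      unfolding w_def using mat_exp_deriv_shift[OF B that, of _ m p t] by (intro sum.cong) auto
    also have "\<dots> = (\<Sum>l<n. (B ^\<^sub>m m) $$ (k, l) * w p l t)"
      unfolding w_def sum_distrib_left sum_distrib_right by (subst sum.swap) (simp add: mult.assoc)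
    finally show ?thesis .
  qed
  obtain N c where N: "\<And>i j. \<lbrakk>i < n; j < n\<rbrakk> \<Longrightarrow> (B ^\<^sub>m N) $$ (i, j) = (\<Sum>p<N. c p * (B ^\<^sub>m p) $$ (i, j))"
    using pow_mat_dependent[OF B] by blast
  have wdep: "w (N + i) k t = (\<Sum>p<N. c p * w (p + i) k t)" for i t
  proof -
    have "w (N + i) k t = (\<Sum>l<n. (\<Sum>p<N. c p * (B ^\<^sub>m p) $$ (k, l)) * w i l t)"
      unfolding wshift[OF k] using N[OF k] by (intro sum.cong) auto
    also have "\<dots> = (\<Sum>p<N. \<Sum>l<n. c p * (B ^\<^sub>m p) $$ (k, l) * w i l t)"
      unfolding sum_distrib_right by (rule sum.swap)
    also have "\<dots> = (\<Sum>p<N. c p * w (p + i) k t)"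
      unfolding wshift[OF k] sum_distrib_left by (simp only: mult.assoc)
    finally show ?thesis .
  qed
  define q where "q = monom 1 N - (\<Sum>p<N. monom (complex_of_real (c p)) p)"
  have cq: "coeff q i = (if i = N then 1 else if i < N then - complex_of_real (c i) else 0)" for i
    unfolding q_def by (auto simp: coeff_sum)
  have degq: "degree q = N"
    using cq by (intro antisym degree_le le_degree) auto
  have "trig_poly (\<lambda>t. of_real (w 0 k t))"
  proof (rule bounded_ode_trig_poly[of "\<lambda>i t. of_real (w i k t)" q N 0])
    show "((\<lambda>t. of_real (w i k t)) has_vector_derivative complex_of_real (w (Suc i) k t)) (at t)" for i t
      unfolding w_def
      by (intro has_vector_derivative_of_real has_real_derivative_iff_has_vector_derivative[THEN iffD1]
          DERIV_sum DERIV_cmult_right mat_exp_deriv_has_derivative[OF B k]) auto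
    show "\<exists>M. \<forall>t. norm (complex_of_real (w i k t)) \<le> M" for i
    proof -
      have "\<forall>l\<in>{..<n}. \<exists>M. \<forall>t. \<bar>w 0 l t\<bar> \<le> M" using bdd w0 by auto
      then obtain M where M: "\<And>l t. l < n \<Longrightarrow> \<bar>w 0 l t\<bar> \<le> M l" by (auto simp: Ball_def) metis
      have "\<bar>w i k t\<bar> \<le> (\<Sum>l<n. \<bar>(B ^\<^sub>m i) $$ (k, l)\<bar> * M l)" for t
        using wshift[OF k, of i 0 t] M
        by (auto simp: abs_mult intro!: order_trans[OF sum_abs] sum_mono mult_left_mono)
      then show ?thesis unfolding norm_of_real by blast
    qed
    show "q \<noteq> 0" using cq[of N] by auto
    show "degree q = N" by fact
    show "(\<Sum>l\<le>N. coeff q l * complex_of_real (w (l + i) k t)) = 0" for i t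
    proof -
      have "(\<Sum>l\<le>N. coeff q l * complex_of_real (w (l + i) k t)) =
          (\<Sum>l<N. coeff q l * complex_of_real (w (l + i) k t)) + complex_of_real (w (N + i) k t)"
        by (simp add: lessThan_Suc_atMost[symmetric] cq)
      also have "(\<Sum>l<N. coeff q l * complex_of_real (w (l + i) k t)) = - complex_of_real (\<Sum>p<N. c p * w (p + i) k t)"
        unfolding of_real_sum sum_negf[symmetric] by (intro sum.cong) (auto simp: cq)
      finally show ?thesis unfolding wdep by simp
    qed
  qed
  then show ?thesis by (simp add: w0[OF k])
qed

section \<open>Tools: periodic integrals, integer lattices, Lipschitz maps\<close>

lemma integral_periodic_shift:
  fixes w :: "real \<Rightarrow> complex"
  assumes w: "continuous_on UNIV w" and per: "\<And>s. w (s + 1) = w s"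
  shows "integral {0..1} (\<lambda>s. w (s + a)) = integral {0..1} w"
proof -
  have nat_per: "w (s + real k) = w s" for s k
  proof (induction k)
    case (Suc k)
    then show ?case using per[of "s + real k"] by (simp add: algebra_simps)
  qed simp
  have int_per: "w (s + of_int k) = w s" for s k
  proof (cases "k \<ge> 0")
    case True
    then show ?thesis using nat_per[of s "nat k"] by simp
  next
    case False
    then show ?thesis using nat_per[of "s + of_int k" "nat (- k)"] by simp
  qed
  define b where "b = frac a"
  have b: "0 \<le> b" "b \<le> 1" unfolding b_def using frac_lt_1[of a] by auto
  have "w (s + a) = w (s + b)" for s
    using int_per[of "s + b" "\<lfloor>a\<rfloor>"] by (simp add: b_def frac_def)
  then have "integral {0..1} (\<lambda>s. w (s + a)) = integral {0..1} (\<lambda>s. w (s + b))" by simp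
  also have "\<dots> = integral {b..1 + b} w"
    using integral_shift_real_ivl[of b b "1 + b" w] by simp
  also have "\<dots> = integral {b..1} w + integral {1..1 + b} w"
    using b w by (subst Henstock_Kurzweil_Integration.integral_combine)
      (auto intro!: integrable_continuous_real continuous_on_subset[OF w])
  also have "integral {1..1 + b} w = integral {0..b} (\<lambda>s. w (s + 1))"
    using integral_shift_real_ivl[of 1 1 "1 + b" w] by simp
  also have "\<dots> = integral {0..b} w" by (simp add: per)
  also have "integral {b..1} w + integral {0..b} w = integral {0..1} w"
    using b w Henstock_Kurzweil_Integration.integral_combine[of 0 b 1 w]
    by (auto intro!: integrable_continuous_real continuous_on_subset[OF w] simp: add.commute)
  finally show ?thesis .
qed

text \<open>A triangular basis by induction on the number of coordinates. To a basis of the vectors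
  with last coordinate 0 is added a vector \<open>b\<close> whose last coordinate is the least
  positive one; division with remainder shows that these generate \<open>\<Lambda>\<close>.\<close>

lemma lattice_dual_basis:
  fixes \<Lambda> :: "(nat \<Rightarrow> int) set"
  assumes "\<And>n i. \<lbrakk>n \<in> \<Lambda>; i \<ge> l\<rbrakk> \<Longrightarrow> n i = 0" and "(\<lambda>_. 0) \<in> \<Lambda>"
    and "\<And>n m. \<lbrakk>n \<in> \<Lambda>; m \<in> \<Lambda>\<rbrakk> \<Longrightarrow> (\<lambda>i. n i - m i) \<in> \<Lambda>"
  shows "\<exists>B. finite B \<and> B \<subseteq> \<Lambda> \<and>
    (\<forall>\<theta>::nat \<Rightarrow> real. (\<forall>n\<in>B. (\<Sum>i<l. of_int (n i) * \<theta> i) \<in> \<int>) \<longrightarrow> (\<forall>n\<in>\<Lambda>. (\<Sum>i<l. of_int (n i) * \<theta> i) \<in> \<int>)) \<and>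
    (\<forall>t. \<exists>\<theta>::nat \<Rightarrow> real. \<forall>n\<in>B. (\<Sum>i<l. of_int (n i) * \<theta> i) = t n)"
  using assms
proof (induction l arbitrary: \<Lambda>)
  case 0
  then show ?case by (intro exI[of _ "{}"]) auto
next
  case (Suc l)
  have zero: "(\<lambda>_. 0) \<in> \<Lambda>" by fact
  have diff: "(\<lambda>i. n i - m i) \<in> \<Lambda>" if "n \<in> \<Lambda>" "m \<in> \<Lambda>" for n m using Suc.prems(3) that by blast
  have neg: "(\<lambda>i. - n i) \<in> \<Lambda>" if "n \<in> \<Lambda>" for n using diff[OF zero that] by simp
  have add: "(\<lambda>i. n i + m i) \<in> \<Lambda>" if "n \<in> \<Lambda>" "m \<in> \<Lambda>" for n m using diff[OF that(1) neg[OF that(2)]] by simp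
  have mul_nat: "(\<lambda>i. int k * n i) \<in> \<Lambda>" if "n \<in> \<Lambda>" for n k
  proof (induction k)
    case 0 then show ?case using zero by simp
  next
    case (Suc k) then show ?case using add[OF that Suc] by (simp add: algebra_simps)
  qed
  have mul: "(\<lambda>i. k * n i) \<in> \<Lambda>" if "n \<in> \<Lambda>" for n k
  proof (cases "k \<ge> 0")
    case True then show ?thesis using mul_nat[OF that, of "nat k"] by simp
  next
    case False then show ?thesis using neg[OF mul_nat[OF that, of "nat (- k)"]] by simp
  qed
  define \<Lambda>0 where "\<Lambda>0 = {n \<in> \<Lambda>. n l = 0}"
  have "\<exists>B. finite B \<and> B \<subseteq> \<Lambda>0 \<and>
    (\<forall>\<theta>::nat \<Rightarrow> real. (\<forall>n\<in>B. (\<Sum>i<l. of_int (n i) * \<theta> i) \<in> \<int>) \<longrightarrow> (\<forall>n\<in>\<Lambda>0. (\<Sum>i<l. of_int (n i) * \<theta> i) \<in> \<int>)) \<and>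
    (\<forall>t. \<exists>\<theta>::nat \<Rightarrow> real. \<forall>n\<in>B. (\<Sum>i<l. of_int (n i) * \<theta> i) = t n)"
  proof (rule Suc.IH)
    show "n i = 0" if "n \<in> \<Lambda>0" "i \<ge> l" for n i
      using Suc.prems(1)[of n i] that by (cases "i = l") (auto simp: \<Lambda>0_def)
  qed (use zero diff in \<open>auto simp: \<Lambda>0_def\<close>)
  then obtain B where B: "finite B" "B \<subseteq> \<Lambda>0"
    "\<And>\<theta>::nat \<Rightarrow> real. \<lbrakk>\<forall>n\<in>B. (\<Sum>i<l. of_int (n i) * \<theta> i) \<in> \<int>\<rbrakk> \<Longrightarrow> \<forall>n\<in>\<Lambda>0. (\<Sum>i<l. of_int (n i) * \<theta> i) \<in> \<int>"
    "\<And>t. \<exists>\<theta>::nat \<Rightarrow> real. \<forall>n\<in>B. (\<Sum>i<l. of_int (n i) * \<theta> i) = t n"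
    by auto
  show ?case
  proof (cases "\<Lambda>0 = \<Lambda>")
    case True
    then have z: "n l = 0" if "n \<in> \<Lambda>" for n using that by (auto simp: \<Lambda>0_def)
    have eq: "(\<Sum>i<Suc l. of_int (n i) * \<theta> i) = (\<Sum>i<l. of_int (n i) * \<theta> i)" if "n \<in> \<Lambda>" for n and \<theta> :: "nat \<Rightarrow> real"
      using z[OF that] by simp
    have BL: "B \<subseteq> \<Lambda>" using B(2) True by simp
    show ?thesis
    proof (intro exI[of _ B] conjI allI impI ballI B(1) BL)
      fix \<theta> :: "nat \<Rightarrow> real" and n
      assume "\<forall>n\<in>B. (\<Sum>i<Suc l. of_int (n i) * \<theta> i) \<in> \<int>" "n \<in> \<Lambda>"
      then show "(\<Sum>i<Suc l. of_int (n i) * \<theta> i) \<in> \<int>"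
        using B(3)[of \<theta>] eq BL True by (metis subsetD)
    next
      fix t :: "(nat \<Rightarrow> int) \<Rightarrow> real"
      obtain \<theta> :: "nat \<Rightarrow> real" where "\<forall>n\<in>B. (\<Sum>i<l. of_int (n i) * \<theta> i) = t n" using B(4) by blast
      then show "\<exists>\<theta>::nat \<Rightarrow> real. \<forall>n\<in>B. (\<Sum>i<Suc l. of_int (n i) * \<theta> i) = t n"
        using eq BL by (metis subsetD)
    qed
  next
    case False
    define Q where "Q c \<longleftrightarrow> (\<exists>n\<in>\<Lambda>. n l = int c \<and> c > 0)" for c
    obtain m where m: "m \<in> \<Lambda>" "m l \<noteq> 0" using False by (auto simp: \<Lambda>0_def)
    have "\<exists>c. Q c"
    proof (cases "m l > 0")
      case True
      then show ?thesis using m unfolding Q_def by (intro exI[of _ "nat (m l)"]) auto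
    next
      case False
      then show ?thesis using m neg[OF m(1)] unfolding Q_def
        by (intro exI[of _ "nat (- m l)"] conjI bexI[of _ "\<lambda>i. - m i"]) auto
    qed
    then have QL: "Q (LEAST c. Q c)" by (rule LeastI_ex)
    define c where "c = (LEAST c. Q c)"
    obtain b where b: "b \<in> \<Lambda>" "b l = int c" "c > 0" using QL unfolding Q_def c_def by blast
    have red: "(\<lambda>i. n i - (n l div int c) * b i) \<in> \<Lambda>0" if n: "n \<in> \<Lambda>" for n
    proof -
      let ?n = "\<lambda>i. n i - (n l div int c) * b i"
      have nL: "?n \<in> \<Lambda>" using diff[OF n mul[OF b(1)]] .
      have "?n l = n l mod int c" using b(2) by (simp add: minus_div_mult_eq_mod)
      moreover have "n l mod int c = 0"
      proof (rule ccontr)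
        assume ne: "n l mod int c \<noteq> 0"
        have "0 \<le> n l mod int c" "n l mod int c < int c" using b(3) by auto
        with ne have "Q (nat (n l mod int c))"
          unfolding Q_def using nL \<open>?n l = n l mod int c\<close> by (intro bexI[of _ ?n]) auto
        then have "c \<le> nat (n l mod int c)" unfolding c_def by (rule Least_le)
        then show False using \<open>n l mod int c < int c\<close> \<open>0 \<le> n l mod int c\<close> by linarith
      qed
      ultimately show ?thesis using nL by (simp add: \<Lambda>0_def)
    qed
    have B0: "n l = 0" if "n \<in> B" for n using that B(2) by (auto simp: \<Lambda>0_def)
    have bB: "b \<notin> B" using B0[of b] b by auto
    show ?thesis
    proof (intro exI[of _ "insert b B"] conjI allI impI ballI)
      show "finite (insert b B)" using B(1) by simp
      show "insert b B \<subseteq> \<Lambda>" using b(1) B(2) by (auto simp: \<Lambda>0_def)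
    next
      fix \<theta> :: "nat \<Rightarrow> real" and n
      assume A: "\<forall>n\<in>insert b B. (\<Sum>i<Suc l. of_int (n i) * \<theta> i) \<in> \<int>" and n: "n \<in> \<Lambda>"
      define k where "k = n l div int c"
      define n' where "n' i = n i - k * b i" for i
      have n': "n' \<in> \<Lambda>0" using red[OF n] by (simp add: n'_def[abs_def] k_def)
      have "\<forall>n\<in>B. (\<Sum>i<l. of_int (n i) * \<theta> i) \<in> \<int>"
      proof
        fix m assume m: "m \<in> B"
        then have "(\<Sum>i<Suc l. of_int (m i) * \<theta> i) \<in> \<int>" using A by blast
        then show "(\<Sum>i<l. of_int (m i) * \<theta> i) \<in> \<int>" using B0[OF m] by simp
      qed
      from B(3)[OF this] n' have "(\<Sum>i<l. of_int (n' i) * \<theta> i) \<in> \<int>" by (rule bspec)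
      moreover have "n' l = 0" using n' by (simp add: \<Lambda>0_def)
      ultimately have n'Z: "(\<Sum>i<Suc l. of_int (n' i) * \<theta> i) \<in> \<int>" by simp
      have bZ: "(\<Sum>i<Suc l. of_int (b i) * \<theta> i) \<in> \<int>" using A by blast
      have "(\<Sum>i<Suc l. of_int (n i) * \<theta> i) =
          (\<Sum>i<Suc l. of_int (n' i) * \<theta> i) + of_int k * (\<Sum>i<Suc l. of_int (b i) * \<theta> i)"
        unfolding sum_distrib_left sum.distrib[symmetric] by (intro sum.cong) (auto simp: n'_def algebra_simps)
      also have "\<dots> \<in> \<int>" by (intro Ints_add Ints_mult Ints_of_int n'Z bZ)
      finally show "(\<Sum>i<Suc l. of_int (n i) * \<theta> i) \<in> \<int>" .
    next
      fix t :: "(nat \<Rightarrow> int) \<Rightarrow> real"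
      obtain \<theta> :: "nat \<Rightarrow> real" where \<theta>: "\<forall>n\<in>B. (\<Sum>i<l. of_int (n i) * \<theta> i) = t n" using B(4) by blast
      \<comment> \<open>The vectors of \<open>B\<close> do not see coordinate \<open>l\<close>, so
        it is free to correct the value on \<open>b\<close>.\<close>
      define \<theta>' where "\<theta>' = \<theta>(l := (t b - (\<Sum>i<l. of_int (b i) * \<theta> i)) / real c)"
      have "(\<Sum>i<Suc l. of_int (n i) * \<theta>' i) = t n" if "n \<in> insert b B" for n
      proof (cases "n = b")
        case True
        then show ?thesis using b by (simp add: \<theta>'_def)
      next
        case False
        then show ?thesis using \<theta> B0 that by (simp add: \<theta>'_def)
      qed
      then show "\<exists>\<theta>::nat \<Rightarrow> real. \<forall>n\<in>insert b B. (\<Sum>i<Suc l. of_int (n i) * \<theta> i) = t n" by blast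
    qed
  qed
qed

text \<open>A Lipschitz map from \<open>N\<close> to \<open>N + 1\<close> dimensions cannot hit all points of a fine grid, since a grid of
  mesh \<open>1/q\<close> has about \<open>q\<^sup>N\<^sup>+\<^sup>1\<close> points but the source is covered by only \<open>O(q\<^sup>N)\<close> small cells.\<close>

lemma lipschitz_avoids_small_vector:
  fixes e p :: "'x \<Rightarrow> nat \<Rightarrow> real"
  assumes bdd: "\<And>x i. \<lbrakk>x \<in> S; i < N\<rbrakk> \<Longrightarrow> \<bar>e x i\<bar> \<le> R"
    and lip: "\<And>x y d j. \<lbrakk>x \<in> S; y \<in> S; d \<ge> 0; \<forall>i<N. \<bar>e x i - e y i\<bar> \<le> d; j \<le> N\<rbrakk> \<Longrightarrow> \<bar>p x j - p y j\<bar> \<le> L * d"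
    and L: "L \<ge> 0" and \<epsilon>: "\<epsilon> > 0"
  obtains v :: "nat \<Rightarrow> real" where "\<And>j. 0 \<le> v j \<and> v j \<le> \<epsilon>" "\<And>x. x \<in> S \<Longrightarrow> \<exists>j\<le>N. p x j \<noteq> v j"
proof (rule ccontr)
  note avoid = that
  assume no: "\<not> thesis"
  have hit: "\<exists>x\<in>S. \<forall>j\<le>N. p x j = v j" if v: "\<And>j. 0 \<le> v j \<and> v j \<le> \<epsilon>" for v
  proof (rule ccontr)
    assume "\<not> ?thesis"
    then have "thesis" by (intro avoid[of v] v) blast
    then show False using no by contradiction
  qed
  \<comment> \<open>The mesh \<open>h\<close> makes images within one cell differ by less than the
    grid width \<open>\<epsilon> / q\<close>. The cell indices are bounded by \<open>C * q\<close>,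
    the summand 3 leaving room for rounding. Finally \<open>q\<close> is such that the number of
    cells, at most \<open>((2 * C + 1) * (q + 1)) ^ N\<close>, is below the number
    \<open>(q + 1) ^ (N + 1)\<close> of grid points.\<close>
  define C :: nat where "C = nat \<lceil>2 * \<bar>R\<bar> * (L + 1) / \<epsilon>\<rceil> + 3"
  define q :: nat where "q = (2 * C + 1) ^ N"
  have q: "q > 0" by (simp add: q_def)
  define h where "h = \<epsilon> / real q / 2 / (L + 1)"
  have h: "h > 0" using \<epsilon> L q by (simp add: h_def)
  have Lh: "L * h < \<epsilon> / real q"
  proof -
    have "L * h \<le> (L + 1) * h" using h by simp
    also have "(L + 1) * h = \<epsilon> / real q / 2" unfolding h_def using L by simp
    also have "\<dots> < \<epsilon> / real q"
    proof -
      have half: "x / 2 < x" if "x > 0" for x :: real using that by simp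
      show ?thesis by (rule half) (use \<epsilon> q in simp)
    qed
    finally show ?thesis .
  qed
  have Rh: "\<bar>R\<bar> / h + 1 \<le> real (C * q)"
  proof -
    have "\<bar>R\<bar> / h = (2 * \<bar>R\<bar> * (L + 1) / \<epsilon>) * real q" using L q \<epsilon> by (simp add: h_def field_simps)
    also have "\<dots> \<le> real (C - 3) * real q"
      using q unfolding C_def by (intro mult_right_mono) (auto intro: real_nat_ceiling_ge)
    also have "\<dots> = real C * real q - 3 * real q" by (simp add: C_def algebra_simps of_nat_diff)
    finally show ?thesis using q by simp
  qed
  define G where "G = PiE {..N} (\<lambda>_. {..q})"
  have "\<exists>x. \<forall>w\<in>G. x w \<in> S \<and> (\<forall>j\<le>N. p (x w) j = \<epsilon> * real (w j) / real q)"
  proof (rule bchoice, rule ballI)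
    fix w assume w: "w \<in> G"
    define v where "v j = (if j \<le> N then \<epsilon> * real (w j) / real q else 0)" for j
    have "0 \<le> v j \<and> v j \<le> \<epsilon>" for j
    proof (cases "j \<le> N")
      case True
      then have "w j \<le> q" using w by (auto simp: G_def PiE_iff)
      then have "\<epsilon> * real (w j) \<le> \<epsilon> * real q" using \<epsilon> by simp
      then show ?thesis using True \<epsilon> q by (simp add: v_def divide_le_eq)
    qed (use \<epsilon> in \<open>simp add: v_def\<close>)
    from hit[of v, OF this] show "\<exists>x. x \<in> S \<and> (\<forall>j\<le>N. p x j = \<epsilon> * real (w j) / real q)"
      by (auto simp: v_def)
  qed
  then obtain x where x: "\<And>w. w \<in> G \<Longrightarrow> x w \<in> S" "\<And>w j. \<lbrakk>w \<in> G; j \<le> N\<rbrakk> \<Longrightarrow> p (x w) j = \<epsilon> * real (w j) / real q"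
    by blast
  define cell where "cell w = (\<lambda>i\<in>{..<N}. \<lfloor>e (x w) i / h\<rfloor>)" for w
  have inj: "inj_on cell G"
  proof (rule inj_onI)
    fix w w' assume w: "w \<in> G" "w' \<in> G" and eq: "cell w = cell w'"
    have close: "\<bar>e (x w) i - e (x w') i\<bar> \<le> h" if "i < N" for i
    proof -
      have "\<lfloor>e (x w) i / h\<rfloor> = \<lfloor>e (x w') i / h\<rfloor>"
        using fun_cong[OF eq, of i] that by (simp add: cell_def)
      then have "\<bar>e (x w) i / h - e (x w') i / h\<bar> \<le> 1" by linarith
      then show ?thesis using h by (simp add: abs_le_iff field_simps)
    qed
    have "w j = w' j" if "j \<le> N" for j
    proof -
      have "\<bar>p (x w) j - p (x w') j\<bar> \<le> L * h"
        using lip[OF x(1)[OF w(1)] x(1)[OF w(2)]] close h that by simp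
      then have "\<bar>\<epsilon> * real (w j) / real q - \<epsilon> * real (w' j) / real q\<bar> < \<epsilon> / real q"
        using Lh x(2)[OF w(1) that] x(2)[OF w(2) that] by simp
      moreover have "\<epsilon> * real (w j) / real q - \<epsilon> * real (w' j) / real q = (\<epsilon> / real q) * (real (w j) - real (w' j))"
        by (simp add: right_diff_distrib)
      ultimately have "(\<epsilon> / real q) * \<bar>real (w j) - real (w' j)\<bar> < (\<epsilon> / real q) * 1"
        using \<epsilon> q by (simp add: abs_mult)
      then have "\<bar>real (w j) - real (w' j)\<bar> < 1"
        using \<epsilon> q by (subst (asm) mult_less_cancel_left_pos) auto
      then show ?thesis by linarith
    qed
    then show "w = w'" using w unfolding G_def by (intro PiE_ext) auto
  qed
  have sub: "cell ` G \<subseteq> PiE {..<N} (\<lambda>_. {- int (C * q)..int (C * q)})"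
  proof clarify
    fix w assume w: "w \<in> G"
    have "- int (C * q) \<le> \<lfloor>e (x w) i / h\<rfloor> \<and> \<lfloor>e (x w) i / h\<rfloor> \<le> int (C * q)" if "i < N" for i
    proof -
      have "\<bar>e (x w) i\<bar> \<le> \<bar>R\<bar>" using bdd[OF x(1)[OF w] that] by linarith
      then have "\<bar>e (x w) i / h\<bar> \<le> \<bar>R\<bar> / h" using h by (simp add: divide_right_mono)
      then have "\<bar>e (x w) i / h\<bar> \<le> of_int (int (C * q)) - 1" using Rh by simp
      then show ?thesis by linarith
    qed
    then show "cell w \<in> PiE {..<N} (\<lambda>_. {- int (C * q)..int (C * q)})" by (simp add: cell_def)
  qed
  have "card G \<le> card (PiE {..<N} (\<lambda>_. {- int (C * q)..int (C * q)}))"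
    using card_inj_on_le[OF inj sub] by (simp add: finite_PiE)
  then have "(q + 1) ^ (N + 1) \<le> (2 * C * q + 1) ^ N"
    by (simp add: G_def card_PiE nat_add_distrib nat_mult_distrib algebra_simps)
  also have "\<dots> \<le> ((2 * C + 1) * (q + 1)) ^ N" by (intro power_mono) auto
  also have "\<dots> = q * (q + 1) ^ N" by (simp only: power_mult_distrib q_def)
  finally have "q + 1 \<le> q" by simp
  then show False by simp
qed

definition coord_lipschitz :: "nat \<Rightarrow> (nat \<Rightarrow> real) set \<Rightarrow> real \<Rightarrow> ((nat \<Rightarrow> real) \<Rightarrow> real) \<Rightarrow> bool" where
  "coord_lipschitz N S L f \<longleftrightarrow> L \<ge> 0 \<and>
     (\<forall>x\<in>S. \<forall>y\<in>S. \<forall>d\<ge>0. (\<forall>i<N. \<bar>x i - y i\<bar> \<le> d) \<longrightarrow> \<bar>f x - f y\<bar> \<le> L * d)"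

text \<open>Continuous maps may raise dimension, so weight functions must be made Lipschitz before
  values can be avoided. The Stone-Weierstrass theorem applies to Lipschitz functions: boundedness
  on the compact set makes products Lipschitz, and coordinates separate points.\<close>

lemma lipschitz_approximation:
  fixes S :: "(nat \<Rightarrow> real) set"
  assumes S: "compact S" and fin: "\<And>x i. \<lbrakk>x \<in> S; i \<ge> N\<rbrakk> \<Longrightarrow> x i = 0"
    and g: "continuous_on S g" and \<epsilon>: "\<epsilon> > 0"
  obtains p L where "coord_lipschitz N S L p" "continuous_on S p" "\<And>x. x \<in> S \<Longrightarrow> \<bar>g x - p x\<bar> < \<epsilon>"
proof -
  define R where "R = {f. continuous_on S f \<and> (\<exists>L. coord_lipschitz N S L f)}"
  interpret function_ring_on R S
  proof
    show "compact S" by fact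
    show "continuous_on S f" if "f \<in> R" for f using that by (simp add: R_def)
    show "(\<lambda>x. f x + g x) \<in> R" if fg: "f \<in> R" "g \<in> R" for f g
    proof -
      obtain L L' where L: "coord_lipschitz N S L f" "coord_lipschitz N S L' g" using fg by (auto simp: R_def)
      have "coord_lipschitz N S (L + L') (\<lambda>x. f x + g x)"
        unfolding coord_lipschitz_def
      proof (intro conjI ballI allI impI)
        show "0 \<le> L + L'" using L by (simp add: coord_lipschitz_def)
        fix x y d assume "x \<in> S" "y \<in> S" "0 \<le> (d::real)" "\<forall>i<N. \<bar>x i - y i\<bar> \<le> d"
        then have "\<bar>f x - f y\<bar> \<le> L * d" "\<bar>g x - g y\<bar> \<le> L' * d" using L by (auto simp: coord_lipschitz_def)
        then show "\<bar>f x + g x - (f y + g y)\<bar> \<le> (L + L') * d" unfolding distrib_right by linarith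
      qed
      then show ?thesis using fg by (auto simp: R_def intro!: continuous_intros)
    qed
    show "(\<lambda>x. f x * g x) \<in> R" if fg: "f \<in> R" "g \<in> R" for f g
    proof -
      obtain L L' where L: "coord_lipschitz N S L f" "coord_lipschitz N S L' g" using fg by (auto simp: R_def)
      have "\<exists>B. \<forall>x\<in>S. \<bar>f x\<bar> \<le> B" if "f \<in> R" for f
        using compact_imp_bounded[OF compact_continuous_image[OF _ S], of f] that
        by (auto simp: R_def bounded_iff)
      then obtain B B' where B: "\<And>x. x \<in> S \<Longrightarrow> \<bar>f x\<bar> \<le> B" "\<And>x. x \<in> S \<Longrightarrow> \<bar>g x\<bar> \<le> B'" using fg by metis
      have "coord_lipschitz N S (\<bar>B\<bar> * L' + L * \<bar>B'\<bar>) (\<lambda>x. f x * g x)"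
        unfolding coord_lipschitz_def
      proof (intro conjI ballI allI impI)
        show "0 \<le> \<bar>B\<bar> * L' + L * \<bar>B'\<bar>" using L by (simp add: coord_lipschitz_def)
        fix x y d assume x: "x \<in> S" "y \<in> S" "0 \<le> (d::real)" "\<forall>i<N. \<bar>x i - y i\<bar> \<le> d"
        then have le: "\<bar>f x - f y\<bar> \<le> L * d" "\<bar>g x - g y\<bar> \<le> L' * d" using L by (auto simp: coord_lipschitz_def)
        have "f x * g x - f y * g y = f x * (g x - g y) + (f x - f y) * g y" by (simp add: algebra_simps)
        then have "\<bar>f x * g x - f y * g y\<bar> \<le> \<bar>f x\<bar> * \<bar>g x - g y\<bar> + \<bar>f x - f y\<bar> * \<bar>g y\<bar>"
          by (metis abs_mult abs_triangle_ineq)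
        also have "\<dots> \<le> \<bar>B\<bar> * (L' * d) + (L * d) * \<bar>B'\<bar>"
          using le B(1)[OF x(1)] B(2)[OF x(2)] x(3) L
          by (intro add_mono mult_mono) (auto simp: coord_lipschitz_def)
        finally show "\<bar>f x * g x - f y * g y\<bar> \<le> (\<bar>B\<bar> * L' + L * \<bar>B'\<bar>) * d" by (simp add: algebra_simps)
      qed
      then show ?thesis using fg by (auto simp: R_def intro!: continuous_intros)
    qed
    show "(\<lambda>_. c) \<in> R" for c
      by (auto simp: R_def coord_lipschitz_def intro!: exI[of _ 0])
    show "\<exists>f\<in>R. f x \<noteq> f y" if xy: "x \<in> S" "y \<in> S" "x \<noteq> y" for x y
    proof -
      obtain i where i: "x i \<noteq> y i" using xy(3) by auto
      then have iN: "i < N" using fin xy by (metis not_le)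
      have "continuous_on S (\<lambda>x. x i)"
        by (rule continuous_on_subset[OF continuous_on_product_coordinates]) simp
      moreover have "coord_lipschitz N S 1 (\<lambda>x. x i)"
        using iN unfolding coord_lipschitz_def by simp
      ultimately have "(\<lambda>x. x i) \<in> R" unfolding R_def by blast
      then show ?thesis using i by (intro bexI[of _ "\<lambda>x. x i"])
    qed
  qed
  from Stone_Weierstrass_basic[OF g \<epsilon>] obtain p where p: "p \<in> R" "\<forall>x\<in>S. \<bar>g x - p x\<bar> < \<epsilon>"
    by (rule bexE)
  from p(1) have "continuous_on S p" "\<exists>L. coord_lipschitz N S L p" unfolding R_def by simp_all
  then obtain L where L: "coord_lipschitz N S L p" by blast
  show thesis by (rule that[OF L \<open>continuous_on S p\<close>]) (use p(2) in blast)
qed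

section \<open>Torus actions on compact sets: averaging and extension of weight functions\<close>

definition torus_char :: "nat \<Rightarrow> (nat \<Rightarrow> int) \<Rightarrow> (nat \<Rightarrow> real) \<Rightarrow> complex" where
  "torus_char l n \<theta> = cis (2 * pi * (\<Sum>i<l. of_int (n i) * \<theta> i))"

lemma torus_char_add: "torus_char l n (\<lambda>i. \<theta> i + \<eta> i) = torus_char l n \<theta> * torus_char l n \<eta>"
  by (simp add: torus_char_def cis_mult distrib_left sum.distrib algebra_simps)

lemma norm_torus_char [simp]: "norm (torus_char l n \<theta>) = 1"
  by (simp add: torus_char_def)

lemma torus_char_zero [simp]: "torus_char l n (\<lambda>_. 0) = 1"
  by (simp add: torus_char_def)

lemma cis_2pi_eq_1_iff: "cis (2 * pi * x) = 1 \<longleftrightarrow> x \<in> \<int>"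
proof
  assume "cis (2 * pi * x) = 1"
  then have "cos (2 * pi * x) = 1" by (metis cis.sel(1) one_complex.sel(1))
  then obtain k :: int where "2 * pi * x = of_int k * (2 * pi)" by (auto simp: cos_one_2pi_int)
  then have "x = of_int k" by simp
  then show "x \<in> \<int>" by simp
next
  assume "x \<in> \<int>"
  then show "cis (2 * pi * x) = 1" using cis_multiple_2pi by blast
qed

lemma torus_char_eq_1_iff: "torus_char l n \<theta> = 1 \<longleftrightarrow> (\<Sum>i<l. of_int (n i) * \<theta> i) \<in> \<int>"
  unfolding torus_char_def by (rule cis_2pi_eq_1_iff)

lemma torus_char_int: "(\<And>i. i < l \<Longrightarrow> \<theta> i \<in> \<int>) \<Longrightarrow> torus_char l n \<theta> = 1"
  unfolding torus_char_eq_1_iff by (intro Ints_sum Ints_mult) auto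

lemma torus_char_cong: "(\<And>i. i < l \<Longrightarrow> \<theta> i = \<eta> i) \<Longrightarrow> torus_char l n \<theta> = torus_char l n \<eta>"
  unfolding torus_char_def by (intro arg_cong[of _ _ cis] arg_cong2[of _ _ _ _ "(*)"] sum.cong) auto

definition coord_vec :: "nat \<Rightarrow> real \<Rightarrow> nat \<Rightarrow> real" where
  "coord_vec i s = (\<lambda>j. if j = i then s else 0)"

lemma torus_char_axis:
  assumes "i < l" shows "torus_char l n (coord_vec i s) = cis (2 * pi * of_int (n i) * s)"
proof -
  have "(\<Sum>j<l. of_int (n j) * coord_vec i s j) = (\<Sum>j<l. if j = i then of_int (n i) * s else 0)"
    by (intro sum.cong) (auto simp: coord_vec_def)
  then show ?thesis using assms by (simp add: torus_char_def mult_ac)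
qed

text \<open>The torus action is lifted to parameter vectors in
  \<open>nat \<Rightarrow> real\<close>. By \<open>\<alpha>_int\<close> vectors that are integral in
  the first \<open>l\<close> coordinates act trivially, whatever the other coordinates are, so no
  quotient group appears in the analysis.\<close>

locale torus_on_compact =
  fixes l N :: nat and K :: "(nat \<Rightarrow> real) set" and \<alpha> :: "(nat \<Rightarrow> real) \<Rightarrow> (nat \<Rightarrow> real) \<Rightarrow> (nat \<Rightarrow> real)"
  assumes K: "compact K" and K_fin: "\<And>y i. \<lbrakk>y \<in> K; i \<ge> N\<rbrakk> \<Longrightarrow> y i = 0"
    and \<alpha>_cont: "continuous_on (UNIV \<times> K) (\<lambda>(\<theta>, y). \<alpha> \<theta> y)"
    and \<alpha>_in [simp]: "\<And>\<theta> y. y \<in> K \<Longrightarrow> \<alpha> \<theta> y \<in> K"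
    and \<alpha>_add: "\<And>\<theta> \<eta> y. y \<in> K \<Longrightarrow> \<alpha> (\<lambda>i. \<theta> i + \<eta> i) y = \<alpha> \<theta> (\<alpha> \<eta> y)"
    and \<alpha>_int: "\<And>\<theta> y. \<lbrakk>y \<in> K; \<And>i. i < l \<Longrightarrow> \<theta> i \<in> \<int>\<rbrakk> \<Longrightarrow> \<alpha> \<theta> y = y"
begin

abbreviation \<xi> where "\<xi> \<equiv> torus_char l"

lemma \<alpha>_zero: "y \<in> K \<Longrightarrow> \<alpha> (\<lambda>_. 0) y = y" by (rule \<alpha>_int) auto

lemma \<alpha>_commute: "y \<in> K \<Longrightarrow> \<alpha> \<theta> (\<alpha> \<eta> y) = \<alpha> \<eta> (\<alpha> \<theta> y)"
  using \<alpha>_add[of y \<theta> \<eta>] \<alpha>_add[of y \<eta> \<theta>] by (simp add: add.commute)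

lemma \<alpha>_uminus: "y \<in> K \<Longrightarrow> \<alpha> (\<lambda>i. - \<theta> i) (\<alpha> \<theta> y) = y"
  using \<alpha>_add[of y "\<lambda>i. - \<theta> i" \<theta>] \<alpha>_zero[of y] by simp

lemma \<alpha>_cong_int:
  assumes "y \<in> K" "\<And>i. i < l \<Longrightarrow> \<theta> i - \<eta> i \<in> \<int>"
  shows "\<alpha> \<theta> y = \<alpha> \<eta> y"
proof -
  have "\<alpha> \<theta> y = \<alpha> (\<lambda>i. (\<theta> i - \<eta> i) + \<eta> i) y" by simp
  also have "\<dots> = \<alpha> (\<lambda>i. \<theta> i - \<eta> i) (\<alpha> \<eta> y)" by (rule \<alpha>_add[OF assms(1)])
  also have "\<dots> = \<alpha> \<eta> y" using assms by (intro \<alpha>_int) auto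
  finally show ?thesis .
qed

lemma \<alpha>_compose_cont:
  assumes "continuous_on Z f" "continuous_on Z g" "\<And>z. z \<in> Z \<Longrightarrow> g z \<in> K"
  shows "continuous_on Z (\<lambda>z. \<alpha> (f z) (g z))"
proof -
  have "continuous_on Z (\<lambda>z. (f z, g z))" by (intro continuous_intros assms)
  then show ?thesis using continuous_on_compose2[OF \<alpha>_cont, of Z "\<lambda>z. (f z, g z)"] assms(3) by auto
qed

lemma coord_vec_cont: "continuous_on Z f \<Longrightarrow> continuous_on Z (\<lambda>z. coord_vec i (f z))"
proof (rule continuous_on_coordinatewise_then_product)
  show "continuous_on Z f \<Longrightarrow> continuous_on Z (\<lambda>z. coord_vec i (f z) j)" for j
    by (cases "j = i") (auto simp: coord_vec_def)
qed

lemma orbit_cont: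
  assumes "continuous_on K f"
  shows "continuous_on (K \<times> UNIV) (\<lambda>(y, s). f (\<alpha> (coord_vec i s) y))"
  unfolding case_prod_beta
  by (rule continuous_on_compose2[OF assms])
    (auto intro!: \<alpha>_compose_cont coord_vec_cont continuous_on_fst continuous_on_snd)

lemma orbit_cont1:
  assumes "continuous_on K f" "y \<in> K"
  shows "continuous_on T (\<lambda>s. f (\<alpha> (coord_vec i s) y))"
  by (rule continuous_on_compose2[OF assms(1)])
    (use assms(2) in \<open>auto intro!: \<alpha>_compose_cont coord_vec_cont\<close>)

text \<open>The \<open>c\<close>-th Fourier coefficient of \<open>f\<close> along the
  \<open>i\<close>-th circle, which projects to the functions of weight \<open>c\<close> in that
  direction.\<close>

definition avg :: "nat \<Rightarrow> int \<Rightarrow> ((nat \<Rightarrow> real) \<Rightarrow> complex) \<Rightarrow> (nat \<Rightarrow> real) \<Rightarrow> complex" where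
  "avg i c f y = integral {0..1} (\<lambda>s. cis (- 2 * pi * of_int c * s) * f (\<alpha> (coord_vec i s) y))"

lemma cis_cont: "continuous_on Z f \<Longrightarrow> continuous_on Z (\<lambda>z. cis (f z))"
  unfolding cis_conv_exp by (intro continuous_intros)

lemma avg_integrand_cont:
  assumes "continuous_on K f" "y \<in> K"
  shows "continuous_on T (\<lambda>s. cis (- 2 * pi * of_int c * s) * f (\<alpha> (coord_vec i s) y))"
  by (intro continuous_intros cis_cont orbit_cont1 assms)

lemma avg_integrable:
  assumes "continuous_on K f" "y \<in> K"
  shows "(\<lambda>s. cis (- 2 * pi * of_int c * s) * f (\<alpha> (coord_vec i s) y)) integrable_on {0..1}"
  by (intro integrable_continuous_real avg_integrand_cont assms)

lemma avg_cont:
  assumes "continuous_on K f"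
  shows "continuous_on K (avg i c f)"
proof -
  have "continuous_on (K \<times> cbox 0 1) (\<lambda>(y, s). f (\<alpha> (coord_vec i s) y))"
    by (rule continuous_on_subset[OF orbit_cont[OF assms]]) auto
  then have "continuous_on (K \<times> cbox 0 1) (\<lambda>(y, s). cis (- 2 * pi * of_int c * s) * f (\<alpha> (coord_vec i s) y))"
    unfolding case_prod_beta by (intro continuous_intros cis_cont)
  from integral_continuous_on_param[OF this] show ?thesis unfolding avg_def by simp
qed

lemma avg_norm:
  assumes "continuous_on K f" "\<And>y. y \<in> K \<Longrightarrow> norm (f y) \<le> B" "y \<in> K"
  shows "norm (avg i c f y) \<le> B"
  using integral_bound[of 0 1 "\<lambda>s. cis (- 2 * pi * of_int c * s) * f (\<alpha> (coord_vec i s) y)" B]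
    avg_integrand_cont[OF assms(1,3)] assms(2,3)
  by (simp add: avg_def norm_mult)

lemma avg_equivariant:
  assumes "continuous_on K f" "y \<in> K" "\<And>y. y \<in> K \<Longrightarrow> f (\<alpha> \<theta> y) = z * f y"
  shows "avg i c f (\<alpha> \<theta> y) = z * avg i c f y"
proof -
  have "f (\<alpha> (coord_vec i s) (\<alpha> \<theta> y)) = z * f (\<alpha> (coord_vec i s) y)" for s
    using \<alpha>_commute[OF assms(2)] assms(2,3) by simp
  then show ?thesis unfolding avg_def
    by (simp add: mult.left_commute integral_mult_right)
qed

lemma avg_axis:
  assumes "continuous_on K f" "y \<in> K"
  shows "avg i c f (\<alpha> (coord_vec i a) y) = cis (2 * pi * of_int c * a) * avg i c f y"
proof -
  define w where "w s = cis (- 2 * pi * of_int c * s) * f (\<alpha> (coord_vec i s) y)" for s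
  have wc: "continuous_on UNIV w" unfolding w_def by (rule avg_integrand_cont[OF assms])
  have per: "w (s + 1) = w s" for s
  proof -
    have "\<alpha> (coord_vec i (s + 1)) y = \<alpha> (coord_vec i s) y"
      using assms(2) by (intro \<alpha>_cong_int) (auto simp: coord_vec_def)
    moreover have "cis (- 2 * pi * of_int c * (s + 1)) = cis (- 2 * pi * of_int c * s)"
    proof -
      have "cis (- 2 * pi * of_int c * (s + 1)) = cis (- 2 * pi * of_int c * s) * cis (2 * pi * of_int (- c))"
        by (simp add: cis_mult algebra_simps)
      then show ?thesis by (simp add: cis_2pi_eq_1_iff[of "of_int (- c)", simplified])
    qed
    ultimately show ?thesis by (simp add: w_def)
  qed
  have "cis (- 2 * pi * of_int c * s) * f (\<alpha> (coord_vec i s) (\<alpha> (coord_vec i a) y)) = cis (2 * pi * of_int c * a) * w (s + a)" for s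
  proof -
    have "(\<lambda>j. coord_vec i s j + coord_vec i a j) = coord_vec i (s + a)" by (auto simp: coord_vec_def)
    then have "\<alpha> (coord_vec i s) (\<alpha> (coord_vec i a) y) = \<alpha> (coord_vec i (s + a)) y"
      using \<alpha>_add[OF assms(2), of "coord_vec i s" "coord_vec i a"] by simp
    moreover have "cis (- 2 * pi * of_int c * s) = cis (2 * pi * of_int c * a) * cis (- 2 * pi * of_int c * (s + a))"
      by (simp add: cis_mult algebra_simps)
    ultimately show ?thesis by (simp add: w_def)
  qed
  then have "avg i c f (\<alpha> (coord_vec i a) y) = cis (2 * pi * of_int c * a) * integral {0..1} (\<lambda>s. w (s + a))"
    unfolding avg_def by (simp add: integral_mult_right)
  also have "integral {0..1} (\<lambda>s. w (s + a)) = integral {0..1} w"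
    by (rule integral_periodic_shift[OF wc per])
  also have "integral {0..1} w = avg i c f y" unfolding avg_def w_def[abs_def] ..
  finally show ?thesis .
qed

lemma avg_fix:
  assumes "\<And>s. f (\<alpha> (coord_vec i s) y) = cis (2 * pi * of_int c * s) * f y"
  shows "avg i c f y = f y"
proof -
  have "cis (- 2 * pi * of_int c * s) * f (\<alpha> (coord_vec i s) y) = f y" for s
    unfolding assms by (simp add: cis_mult flip: mult.assoc)
  then show ?thesis by (simp add: avg_def)
qed

lemma avg_add:
  assumes "continuous_on K f" "continuous_on K g" "y \<in> K"
  shows "avg i c (\<lambda>y. f y + g y) y = avg i c f y + avg i c g y"
  unfolding avg_def distrib_left by (intro integral_add avg_integrable assms)

lemma avg_diff:
  assumes "continuous_on K f" "continuous_on K g" "y \<in> K"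
  shows "avg i c (\<lambda>y. f y - g y) y = avg i c f y - avg i c g y"
  unfolding avg_def right_diff_distrib by (intro integral_diff avg_integrable assms)

text \<open>Equivariance under the first \<open>m\<close> circles only; it lets the torus be handled
  one circle, hence one one-variable integral, at a time.\<close>

definition equivariant_upto :: "nat \<Rightarrow> (nat \<Rightarrow> int) \<Rightarrow> ((nat \<Rightarrow> real) \<Rightarrow> complex) \<Rightarrow> bool" where
  "equivariant_upto m n f \<longleftrightarrow> continuous_on K f \<and>
     (\<forall>y\<in>K. \<forall>\<theta>. (\<forall>i\<ge>m. \<theta> i = 0) \<longrightarrow> f (\<alpha> \<theta> y) = \<xi> n \<theta> * f y)"

definition weight_space :: "(nat \<Rightarrow> int) \<Rightarrow> ((nat \<Rightarrow> real) \<Rightarrow> complex) set" where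
  "weight_space n = {f. continuous_on K f \<and> (\<forall>y\<in>K. \<forall>\<theta>. f (\<alpha> \<theta> y) = \<xi> n \<theta> * f y)}"

lemma weight_spaceD: "\<lbrakk>f \<in> weight_space n; y \<in> K\<rbrakk> \<Longrightarrow> f (\<alpha> \<theta> y) = \<xi> n \<theta> * f y"
  by (simp add: weight_space_def)

lemma weight_space_cont: "f \<in> weight_space n \<Longrightarrow> continuous_on K f"
  by (simp add: weight_space_def)

lemma equivariant_upto_l:
  assumes "equivariant_upto l n f"
  shows "f \<in> weight_space n"
proof -
  have "f (\<alpha> \<theta> y) = \<xi> n \<theta> * f y" if "y \<in> K" for y \<theta>
  proof -
    define \<eta> where "\<eta> i = (if i < l then \<theta> i else 0)" for i
    have "f (\<alpha> \<eta> y) = \<xi> n \<eta> * f y"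
      using assms that unfolding equivariant_upto_def \<eta>_def by simp
    moreover have "\<alpha> \<eta> y = \<alpha> \<theta> y" using that by (intro \<alpha>_cong_int) (auto simp: \<eta>_def)
    moreover have "\<xi> n \<eta> = \<xi> n \<theta>" by (rule torus_char_cong) (simp add: \<eta>_def)
    ultimately show ?thesis by simp
  qed
  then show ?thesis using assms by (simp add: weight_space_def equivariant_upto_def)
qed

text \<open>The circles commute, so averaging over circle \<open>m\<close> keeps the weights already
  obtained for the earlier circles and adds the weight \<open>c\<close>.\<close>

lemma avg_equivariant_upto:
  assumes f: "equivariant_upto m n f" and m: "m < l"
  shows "equivariant_upto (Suc m) (n(m := c)) (avg m c f)"
  unfolding equivariant_upto_def
proof (intro conjI ballI allI impI)
  have fc: "continuous_on K f" using f by (simp add: equivariant_upto_def)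
  then show "continuous_on K (avg m c f)" by (rule avg_cont)
  fix y and \<theta> :: "nat \<Rightarrow> real"
  assume y: "y \<in> K" and \<theta>: "\<forall>i\<ge>Suc m. \<theta> i = 0"
  define \<eta> where "\<eta> = \<theta>(m := 0)"
  have \<eta>0: "\<forall>i\<ge>m. \<eta> i = 0" using \<theta> by (auto simp: \<eta>_def Suc_le_eq)
  have split: "\<theta> = (\<lambda>i. \<eta> i + coord_vec m (\<theta> m) i)" by (auto simp: \<eta>_def coord_vec_def)
  have "avg m c f (\<alpha> \<theta> y) = avg m c f (\<alpha> \<eta> (\<alpha> (coord_vec m (\<theta> m)) y))"
    using \<alpha>_add[OF y, of \<eta> "coord_vec m (\<theta> m)"] split by simp
  also have "\<dots> = \<xi> n \<eta> * avg m c f (\<alpha> (coord_vec m (\<theta> m)) y)"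
    using f \<eta>0 y by (intro avg_equivariant fc) (auto simp: equivariant_upto_def)
  also have "\<dots> = \<xi> n \<eta> * cis (2 * pi * of_int c * \<theta> m) * avg m c f y"
    by (simp add: avg_axis[OF fc y])
  also have "cis (2 * pi * of_int c * \<theta> m) = \<xi> (n(m := c)) (coord_vec m (\<theta> m))"
    using m by (simp add: torus_char_axis)
  also have "\<xi> n \<eta> = \<xi> (n(m := c)) \<eta>"
  proof -
    have "(\<Sum>i<l. of_int (n i) * \<eta> i) = (\<Sum>i<l. of_int ((n(m := c)) i) * \<eta> i)"
      by (rule sum.cong) (auto simp: \<eta>_def)
    then show ?thesis by (simp add: torus_char_def)
  qed
  also have "\<xi> (n(m := c)) \<eta> * \<xi> (n(m := c)) (coord_vec m (\<theta> m)) = \<xi> (n(m := c)) \<theta>"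
    by (subst split) (simp only: torus_char_add)
  finally show "avg m c f (\<alpha> \<theta> y) = \<xi> (n(m := c)) \<theta> * avg m c f y" .
qed

lemma equivariant_upto_0:
  assumes "continuous_on K f" shows "equivariant_upto 0 n f"
  unfolding equivariant_upto_def
proof (intro conjI ballI allI impI assms)
  fix y and \<theta> :: "nat \<Rightarrow> real"
  assume "y \<in> K" "\<forall>i\<ge>0. \<theta> i = 0"
  then have "\<theta> = (\<lambda>_. 0)" by auto
  then show "f (\<alpha> \<theta> y) = \<xi> n \<theta> * f y" using \<alpha>_zero \<open>y \<in> K\<close> by simp
qed

text \<open>The circles are averaged one after another. A mean of unimodular multiples does not
  exceed the bound \<open>B\<close>, and on \<open>C\<close> the integrand is constant, so the
  values there survive.\<close>

lemma average_onto_weight_space: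
  assumes f: "continuous_on K f" and B: "\<And>y. y \<in> K \<Longrightarrow> norm (f y) \<le> B"
    and C: "C \<subseteq> K" "\<And>y \<theta>. y \<in> C \<Longrightarrow> \<alpha> \<theta> y \<in> C" "\<And>y \<theta>. y \<in> C \<Longrightarrow> f (\<alpha> \<theta> y) = \<xi> n \<theta> * f y"
  obtains g where "g \<in> weight_space n" "\<And>y. y \<in> K \<Longrightarrow> norm (g y) \<le> B" "\<And>y. y \<in> C \<Longrightarrow> g y = f y"
proof -
  have "\<exists>g. equivariant_upto m n g \<and> (\<forall>y\<in>K. norm (g y) \<le> B) \<and> (\<forall>y\<in>C. g y = f y)" if "m \<le> l" for m
    using that
  proof (induction m)
    case 0
    then show ?case using equivariant_upto_0[OF f] B by blast
  next
    case (Suc m)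
    then obtain g where g: "equivariant_upto m n g" "\<forall>y\<in>K. norm (g y) \<le> B" "\<forall>y\<in>C. g y = f y" by auto
    have gc: "continuous_on K g" using g(1) by (simp add: equivariant_upto_def)
    have "equivariant_upto (Suc m) (n(m := n m)) (avg m (n m) g)"
      using g(1) Suc.prems by (intro avg_equivariant_upto) auto
    moreover have "avg m (n m) g y = f y" if "y \<in> C" for y
    proof -
      have "avg m (n m) g y = g y"
        using C that g(3) torus_char_axis[of m l n] Suc.prems by (intro avg_fix) simp
      then show ?thesis using g(3) that by simp
    qed
    moreover have "norm (avg m (n m) g y) \<le> B" if "y \<in> K" for y using avg_norm[OF gc _ that] g(2) by blast
    ultimately show ?case by auto
  qed
  then obtain g where "equivariant_upto l n g" "\<forall>y\<in>K. norm (g y) \<le> B" "\<forall>y\<in>C. g y = f y" by blast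
  then show thesis using that equivariant_upto_l by blast
qed

definition unit_cube :: "(nat \<Rightarrow> real) set" where "unit_cube = {\<theta>. \<forall>i. \<theta> i \<in> {0..1}}"

lemma compact_unit_cube: "compact unit_cube"
proof -
  have "compactin (product_topology (\<lambda>i::nat. euclideanreal) UNIV) (PiE UNIV (\<lambda>_. {0..1}))"
    by (simp add: compactin_PiE)
  moreover have "PiE UNIV (\<lambda>_. {0..1}) = unit_cube" by (auto simp: unit_cube_def)
  ultimately show ?thesis by (simp add: euclidean_product_topology)
qed

lemma unit_cube_rep:
  assumes "y \<in> K"
  obtains \<eta> where "\<eta> \<in> unit_cube" "\<alpha> \<eta> y = \<alpha> \<theta> y" "\<And>n. \<xi> n \<eta> = \<xi> n \<theta>" 
proof
  let ?\<eta> = "\<lambda>i. frac (\<theta> i)"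
  show "?\<eta> \<in> unit_cube" by (auto simp: unit_cube_def less_imp_le frac_lt_1)
  show "\<alpha> ?\<eta> y = \<alpha> \<theta> y" using assms by (intro \<alpha>_cong_int) (auto simp: frac_def)
  show "\<xi> n ?\<eta> = \<xi> n \<theta>" for n
  proof -
    have "\<xi> n \<theta> = \<xi> n (\<lambda>i. of_int \<lfloor>\<theta> i\<rfloor> + ?\<eta> i)" by (simp add: frac_def)
    also have "\<dots> = \<xi> n (\<lambda>i. of_int \<lfloor>\<theta> i\<rfloor>) * \<xi> n ?\<eta>" by (rule torus_char_add)
    also have "\<xi> n (\<lambda>i. of_int \<lfloor>\<theta> i\<rfloor>) = 1" by (rule torus_char_int) simp
    finally show ?thesis by simp
  qed
qed

lemma torus_char_cont: "continuous_on Z (\<xi> n)"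
  unfolding torus_char_def
  by (intro cis_cont continuous_intros continuous_on_subset[OF continuous_on_product_coordinates]) auto

text \<open>The condition \<open>compat\<close> is what makes the equivariant extension of
  \<open>\<zeta>\<close> to the saturation \<open>C\<close> of \<open>S\<close> well defined. The
  Tietze theorem extends it further without equivariance, and averaging restores equivariance
  without changing it on \<open>C\<close>.\<close>

lemma extend_to_weight_space:
  assumes S: "compact S" "S \<subseteq> K" and \<zeta>: "continuous_on S \<zeta>"
    and B: "B \<ge> 0" "\<And>s. s \<in> S \<Longrightarrow> norm (\<zeta> s) \<le> B"
    and compat: "\<And>s \<theta>. \<lbrakk>s \<in> S; \<alpha> \<theta> s \<in> S\<rbrakk> \<Longrightarrow> \<zeta> (\<alpha> \<theta> s) = \<xi> n \<theta> * \<zeta> s"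
  obtains f where "f \<in> weight_space n" "\<And>s. s \<in> S \<Longrightarrow> f s = \<zeta> s" "\<And>y. y \<in> K \<Longrightarrow> norm (f y) \<le> B"
proof -
  let ?m = "\<lambda>(\<theta>, s). \<alpha> \<theta> s"
  define C where "C = ?m ` (unit_cube \<times> S)"
  have cpt: "compact (unit_cube \<times> S)" by (intro compact_Times compact_unit_cube S)
  have mc: "continuous_on (unit_cube \<times> S) ?m"
    by (rule continuous_on_subset[OF \<alpha>_cont]) (use S in auto)
  have C_cpt: "compact C" unfolding C_def by (rule compact_continuous_image[OF mc cpt])
  have C_K: "C \<subseteq> K" using S by (auto simp: C_def)
  have C_mem: "\<alpha> \<theta> s \<in> C" if s: "s \<in> S" for \<theta> s
  proof -
    obtain \<eta> where "\<eta> \<in> unit_cube" "\<alpha> \<eta> s = \<alpha> \<theta> s" using unit_cube_rep[of s \<theta>] S s by blast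
    then show ?thesis unfolding C_def using s by (auto intro!: image_eqI[of _ _ "(\<eta>, s)"])
  qed
  have C_rep: "\<exists>s\<in>S. \<exists>\<theta>. y = \<alpha> \<theta> s" if "y \<in> C" for y using that by (auto simp: C_def)
  have C_inv: "\<alpha> \<theta> y \<in> C" if y: "y \<in> C" for \<theta> y
  proof -
    obtain s \<eta> where s: "s \<in> S" "y = \<alpha> \<eta> s" using C_rep[OF y] by blast
    then have "\<alpha> \<theta> y = \<alpha> (\<lambda>i. \<theta> i + \<eta> i) s" using \<alpha>_add S by auto
    then show ?thesis using C_mem s by simp
  qed
  have wd: "\<xi> n \<theta> * \<zeta> s = \<xi> n \<eta> * \<zeta> t" if st: "s \<in> S" "t \<in> S" "\<alpha> \<theta> s = \<alpha> \<eta> t" for s t \<theta> \<eta>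
  proof -
    have "t = \<alpha> (\<lambda>i. - \<eta> i) (\<alpha> \<theta> s)" using st S \<alpha>_uminus[of t \<eta>] by auto
    also have "\<dots> = \<alpha> (\<lambda>i. - \<eta> i + \<theta> i) s" using \<alpha>_add[of s "\<lambda>i. - \<eta> i" \<theta>] st S by auto
    finally have t: "t = \<alpha> (\<lambda>i. - \<eta> i + \<theta> i) s" .
    then have "\<zeta> t = \<xi> n (\<lambda>i. - \<eta> i + \<theta> i) * \<zeta> s" using compat[OF st(1)] st(2) by metis
    moreover have "\<xi> n (\<lambda>i. \<eta> i + (- \<eta> i + \<theta> i)) = \<xi> n \<eta> * \<xi> n (\<lambda>i. - \<eta> i + \<theta> i)"
      by (rule torus_char_add)
    ultimately show ?thesis by simp
  qed
  define g where "g y = (SOME z. \<exists>s\<in>S. \<exists>\<theta>. y = \<alpha> \<theta> s \<and> z = \<xi> n \<theta> * \<zeta> s)" for y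
  have g: "g (\<alpha> \<theta> s) = \<xi> n \<theta> * \<zeta> s" if "s \<in> S" for s \<theta>
  proof -
    have "\<exists>z. \<exists>t\<in>S. \<exists>\<eta>. \<alpha> \<theta> s = \<alpha> \<eta> t \<and> z = \<xi> n \<eta> * \<zeta> t" using that by blast
    from someI_ex[OF this] obtain t \<eta> where "t \<in> S" "\<alpha> \<theta> s = \<alpha> \<eta> t" "g (\<alpha> \<theta> s) = \<xi> n \<eta> * \<zeta> t"
      unfolding g_def by blast
    then show ?thesis using wd[OF that] by metis
  qed
  have g_cont: "continuous_on C g"
  proof -
    \<comment> \<open>A continuous surjection from a compact space to a Hausdorff space is a
      quotient map, so continuity of \<open>g\<close> may be tested on pairs of a parameter and a
      point of \<open>S\<close>.\<close>
    have q: "quotient_map (top_of_set (unit_cube \<times> S)) (top_of_set C) ?m"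
    proof (rule T1_Spaces.continuous_imp_quotient_map)
      show "continuous_map (top_of_set (unit_cube \<times> S)) (top_of_set C) ?m"
        using mc by (auto simp: C_def)
      show "compact_space (top_of_set (unit_cube \<times> S))"
        using cpt by (simp add: compact_space_subtopology)
      show "Hausdorff_space (top_of_set C)" by (simp add: Hausdorff_space_subtopology)
    qed (auto simp: C_def)
    have "continuous_on (unit_cube \<times> S) (\<lambda>z. \<xi> n (fst z) * \<zeta> (snd z))"
      by (intro continuous_intros continuous_on_compose2[OF torus_char_cont[of UNIV]] continuous_on_compose2[OF \<zeta>]) auto
    moreover have "g (?m z) = \<xi> n (fst z) * \<zeta> (snd z)" if "z \<in> unit_cube \<times> S" for z
      using that g by (cases z) auto
    ultimately have "continuous_on (unit_cube \<times> S) (g \<circ> ?m)"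
      by (subst continuous_on_cong[OF refl, of _ _ "\<lambda>z. \<xi> n (fst z) * \<zeta> (snd z)"]) auto
    then show ?thesis using continuous_compose_quotient_map[OF q, of euclidean g] by simp
  qed
  have g_B: "norm (g y) \<le> B" if "y \<in> C" for y
    using C_rep[OF that] g B(2) by (auto simp: norm_mult)
  have g_eq: "g (\<alpha> \<theta> y) = \<xi> n \<theta> * g y" if y: "y \<in> C" for y \<theta>
  proof -
    obtain s \<eta> where s: "s \<in> S" "y = \<alpha> \<eta> s" using C_rep[OF y] by blast
    then have "\<alpha> \<theta> y = \<alpha> (\<lambda>i. \<theta> i + \<eta> i) s" using \<alpha>_add S by auto
    then show ?thesis using g s by (simp add: torus_char_add)
  qed
  have "closedin (top_of_set UNIV) C" using C_cpt compact_imp_closed by simp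
  then obtain h where h: "continuous_on UNIV h" "\<And>y. y \<in> C \<Longrightarrow> h y = g y" "\<And>y. norm (h y) \<le> B"
    using Tietze[OF g_cont _ B(1) g_B, of UNIV] by auto
  obtain f where f: "f \<in> weight_space n" "\<And>y. y \<in> K \<Longrightarrow> norm (f y) \<le> B" "\<And>y. y \<in> C \<Longrightarrow> f y = h y"
  proof (rule average_onto_weight_space[of h B C n])
    show "continuous_on K h" by (rule continuous_on_subset[OF h(1)]) simp
    show "h (\<alpha> \<theta> y) = \<xi> n \<theta> * h y" if "y \<in> C" for y \<theta> using h(2) g_eq C_inv that by simp
  qed (use h(3) C_K C_inv in auto)
  show thesis
  proof (rule that[OF f(1) _ f(2)])
    fix s assume s: "s \<in> S"
    then have "\<alpha> (\<lambda>_. 0) s = s" using \<alpha>_zero S by auto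
    then show "f s = \<zeta> s" using f(3) h(2) g[OF s, of "\<lambda>_. 0"] C_mem[OF s, of "\<lambda>_. 0"] by simp
  qed
qed

end

section \<open>Density of sums of weight functions, by a trigonometric kernel\<close>

text \<open>The kernel is nonnegative, has period 1 and peaks at the integers, while having only the
  integer frequencies from \<open>-M\<close> to \<open>M\<close>; convolution with it therefore
  involves finitely many Fourier coefficients.\<close>

lemma cos_power_trig_expansion:
  "complex_of_real (cos (pi * s) ^ (2 * M)) =
     (\<Sum>k\<le>2 * M. of_nat (2 * M choose k) / 4 ^ M * cis (- 2 * pi * of_int (int M - int k) * s))"
proof -
  have c: "complex_of_real (cos (pi * s)) = (cis (pi * s) + cis (- (pi * s))) / 2"
    by (simp add: complex_eq_iff)
  have "(cis (pi * s) + cis (- (pi * s))) ^ (2 * M) =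
      (\<Sum>k\<le>2 * M. of_nat (2 * M choose k) * cis (pi * s) ^ k * cis (- (pi * s)) ^ (2 * M - k))"
    by (rule binomial_ring)
  also have "\<dots> = (\<Sum>k\<le>2 * M. of_nat (2 * M choose k) * cis (- 2 * pi * of_int (int M - int k) * s))"
  proof (rule sum.cong[OF refl])
    fix k assume "k \<in> {..2 * M}"
    then have "cis (pi * s) ^ k * cis (- (pi * s)) ^ (2 * M - k) = cis (- 2 * pi * of_int (int M - int k) * s)"
      by (simp only: Complex.DeMoivre cis_mult) (rule arg_cong[of _ _ cis], simp add: of_nat_diff algebra_simps)
    then show "of_nat (2 * M choose k) * cis (pi * s) ^ k * cis (- (pi * s)) ^ (2 * M - k) =
        of_nat (2 * M choose k) * cis (- 2 * pi * of_int (int M - int k) * s)" by (simp add: mult.assoc)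
  qed
  finally have "(cis (pi * s) + cis (- (pi * s))) ^ (2 * M) / 4 ^ M =
      (\<Sum>k\<le>2 * M. of_nat (2 * M choose k) / 4 ^ M * cis (- 2 * pi * of_int (int M - int k) * s))"
    by (simp add: sum_divide_distrib)
  moreover have "complex_of_real (cos (pi * s) ^ (2 * M)) = (cis (pi * s) + cis (- (pi * s))) ^ (2 * M) / 4 ^ M"
    unfolding of_real_power c power_divide by (simp add: power_mult)
  ultimately show ?thesis by simp
qed


text \<open>The mass is at least \<open>\<delta> / 2\<close> times the power of the cosine at
  \<open>\<delta> / 2\<close>, which beats the power of the smaller cosine at
  \<open>\<delta>\<close> by an exponentially growing factor.\<close>

lemma cos_power_concentrates:
  assumes "0 < \<delta>" "\<delta> < 1/2" "e > 0"
  obtains M :: nat where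
    "cos (pi * \<delta>) ^ (2 * M) < e * integral {0..1} (\<lambda>s. cos (pi * s) ^ (2 * M))"
proof -
  let ?a = "cos (pi * \<delta>)" and ?b = "cos (pi * (\<delta> / 2))"
  have "0 \<le> pi * \<delta>" "pi * \<delta> \<le> pi * (1 / 2)" "pi * (\<delta> / 2) < pi * \<delta>" "0 \<le> pi * (\<delta> / 2)"
    using assms by (auto intro!: mult_left_mono)
  then have ab: "0 \<le> ?a" "?a < ?b"
    by (intro cos_ge_zero cos_monotone_0_pi; linarith)+
  then have "0 \<le> (?a / ?b)\<^sup>2" "(?a / ?b)\<^sup>2 < 1"
    by (auto simp: power_divide divide_less_eq_1 power_strict_mono)
  then have "(\<lambda>M. ((?a / ?b)\<^sup>2) ^ M) \<longlonglongrightarrow> 0" by (rule LIMSEQ_realpow_zero)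
  then have "\<forall>\<^sub>F M in sequentially. ((?a / ?b)\<^sup>2) ^ M < e * (\<delta> / 2)"
    using assms by (intro order_tendstoD(2)) auto
  then obtain M where M: "((?a / ?b)\<^sup>2) ^ M < e * (\<delta> / 2)" by (auto simp: eventually_sequentially)
  have int: "(\<lambda>s. cos (pi * s) ^ (2 * M)) integrable_on {u..v}" for u v
    by (intro integrable_continuous_real continuous_intros)
  have nonneg: "0 \<le> cos (pi * s) ^ (2 * M)" for s by (simp add: power_mult)
  have "\<delta> / 2 * ?b ^ (2 * M) = integral {0..\<delta> / 2} (\<lambda>s. ?b ^ (2 * M))" using assms by simp
  also have "\<dots> \<le> integral {0..\<delta> / 2} (\<lambda>s. cos (pi * s) ^ (2 * M))"
  proof (rule integral_le[OF _ int])
    fix s assume s: "s \<in> {0..\<delta> / 2}"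
    then have "?b \<le> cos (pi * s)" using assms by (intro cos_monotone_0_pi_le) (auto simp: field_simps)
    then show "?b ^ (2 * M) \<le> cos (pi * s) ^ (2 * M)" using ab by (intro power_mono) auto
  qed (intro integrable_continuous_real continuous_intros)
  also have "\<dots> \<le> integral {0..1} (\<lambda>s. cos (pi * s) ^ (2 * M))"
    using assms nonneg by (intro integral_subset_le int) auto
  finally have lower: "\<delta> / 2 * ?b ^ (2 * M) \<le> integral {0..1} (\<lambda>s. cos (pi * s) ^ (2 * M))" .
  have "?a ^ (2 * M) = ((?a / ?b)\<^sup>2) ^ M * ?b ^ (2 * M)"
    using ab by (simp add: power_mult[symmetric] power_divide)
  also have "\<dots> < e * (\<delta> / 2) * ?b ^ (2 * M)" using M ab by (intro mult_strict_right_mono) auto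
  also have "\<dots> \<le> e * integral {0..1} (\<lambda>s. cos (pi * s) ^ (2 * M))"
    using lower assms by (simp add: mult.assoc)
  finally show thesis by (rule that)
qed

context torus_on_compact
begin

inductive equi_sum :: "nat \<Rightarrow> ((nat \<Rightarrow> real) \<Rightarrow> complex) \<Rightarrow> bool" for m where
  zero: "equi_sum m (\<lambda>_. 0)"
| add: "\<lbrakk>equivariant_upto m n f; equi_sum m g\<rbrakk> \<Longrightarrow> equi_sum m (\<lambda>y. f y + g y)"

lemma equi_sum_cont: "equi_sum m g \<Longrightarrow> continuous_on K g"
  by (induction rule: equi_sum.induct) (auto intro!: continuous_intros simp: equivariant_upto_def)

lemma equi_sum_plus:
  assumes "equi_sum m f" "equi_sum m g"
  shows "equi_sum m (\<lambda>y. f y + g y)"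
  using assms(1)
proof (induction rule: equi_sum.induct)
  case zero
  then show ?case using assms(2) by simp
next
  case (add n f h)
  show ?case using equi_sum.add[OF add.hyps(1) add.IH] by (simp add: add.assoc)
qed

lemma equi_sum_scale:
  assumes "equi_sum m f" shows "equi_sum m (\<lambda>y. c * f y)"
  using assms
proof (induction rule: equi_sum.induct)
  case zero
  then show ?case using equi_sum.zero by simp
next
  case (add n f h)
  have "equivariant_upto m n (\<lambda>y. c * f y)"
    using add.hyps(1) unfolding equivariant_upto_def by (auto intro!: continuous_intros)
  from equi_sum.add[OF this add.IH] show ?case by (simp add: distrib_left)
qed

lemma equi_sum_sum: "(\<And>i. i \<in> I \<Longrightarrow> equi_sum m (f i)) \<Longrightarrow> equi_sum m (\<lambda>y. \<Sum>i\<in>I. f i y)"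
  by (induction I rule: infinite_finite_induct) (auto intro: equi_sum.zero equi_sum_plus)

lemma equi_sum_avg:
  assumes "equi_sum m g" "m < l"
  shows "\<exists>h. equi_sum (Suc m) h \<and> (\<forall>y\<in>K. avg m c g y = h y)"
  using assms(1)
proof (induction rule: equi_sum.induct)
  case zero
  have "avg m c (\<lambda>_. 0) y = 0" for y by (simp add: avg_def)
  then show ?case using equi_sum.zero by blast
next
  case (add n f g)
  then obtain h where h: "equi_sum (Suc m) h" "\<forall>y\<in>K. avg m c g y = h y" by blast
  have "equi_sum (Suc m) (\<lambda>y. avg m c f y + h y)"
    using equi_sum.add[OF avg_equivariant_upto[OF add.hyps(1) assms(2)] h(1)] .
  moreover have "\<forall>y\<in>K. avg m c (\<lambda>y. f y + g y) y = avg m c f y + h y"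
    using avg_add h(2) add.hyps equi_sum_cont by (auto simp: equivariant_upto_def)
  ultimately show ?case by blast
qed

text \<open>Convolving \<open>\<phi>\<close> along the \<open>m\<close>-th circle with the
  normalized cosine kernel gives the sum on the right, and the kernel concentrates where
  \<open>\<phi>\<close> hardly changes, uniformly in \<open>y\<close>.\<close>

lemma kernel_approximation:
  assumes \<phi>: "continuous_on K \<phi>" and e: "e > 0"
  obtains M :: nat and b :: "nat \<Rightarrow> complex"
  where "\<And>y. y \<in> K \<Longrightarrow> norm (\<phi> y - (\<Sum>k\<le>2 * M. b k * avg m (int M - int k) \<phi> y)) < e"
proof -
  obtain B where B: "B > 0" "\<And>y. y \<in> K \<Longrightarrow> norm (\<phi> y) \<le> B"
    using compact_imp_bounded[OF compact_continuous_image[OF \<phi> K]] by (auto simp: bounded_pos)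
  have "uniformly_continuous_on (K \<times> {-1..1}) (\<lambda>(y, s). \<phi> (\<alpha> (coord_vec m s) y))"
    by (rule compact_uniformly_continuous[OF continuous_on_subset[OF orbit_cont[OF \<phi>]]])
      (use K in \<open>auto intro: compact_Times\<close>)
  moreover have "e / 2 > 0" using e by simp
  ultimately obtain d where d1: "d > 0" "\<forall>z\<in>K \<times> {-1..1}. \<forall>z'\<in>K \<times> {-1..1}. dist z' z < d \<longrightarrow>
      dist (case z' of (y, s) \<Rightarrow> \<phi> (\<alpha> (coord_vec m s) y)) (case z of (y, s) \<Rightarrow> \<phi> (\<alpha> (coord_vec m s) y)) < e / 2"
    unfolding uniformly_continuous_on_def by meson
  have d: "d > 0" "\<And>y s y' s'. \<lbrakk>y \<in> K; y' \<in> K; s \<in> {-1..1}; s' \<in> {-1..1}; dist (y', s') (y, s) < d\<rbrakk> \<Longrightarrow>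
      dist (\<phi> (\<alpha> (coord_vec m s') y')) (\<phi> (\<alpha> (coord_vec m s) y)) < e / 2"
    using d1 by auto
  define \<delta> where "\<delta> = min (d / 2) (1/4)"
  have \<delta>: "0 < \<delta>" "\<delta> < 1/2" "\<delta> < d" using d(1) by (auto simp: \<delta>_def)
  have axis0: "coord_vec m 0 = (\<lambda>_. 0)" by (auto simp: coord_vec_def)
  have near: "norm (\<phi> (\<alpha> (coord_vec m s) y) - \<phi> y) \<le> e / 2" if "y \<in> K" "\<bar>s\<bar> \<le> \<delta>" for s y
  proof -
    have "s \<in> {-1..1}" using that(2) \<delta> by (auto simp: abs_le_iff)
    then show ?thesis
      using d(2)[of y y 0 s] that \<delta> \<alpha>_zero[OF that(1)]
      by (auto simp: axis0 dist_norm dist_Pair_Pair)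
  qed
  have shift: "\<alpha> (coord_vec m (s - 1)) y = \<alpha> (coord_vec m s) y" if "y \<in> K" for s y
    using that by (intro \<alpha>_cong_int) (auto simp: coord_vec_def)
  \<comment> \<open>Far from the integers \<open>\<phi>\<close> changes by at most
    \<open>2 * B\<close>; the factor \<open>e / (4 * B)\<close> limits that part of the integral to
    \<open>I * e / 2\<close>.\<close>
  obtain M where M: "cos (pi * \<delta>) ^ (2 * M) < e / (4 * B) * integral {0..1} (\<lambda>s. cos (pi * s) ^ (2 * M))"
    using cos_power_concentrates[OF \<delta>(1,2), of "e / (4 * B)"] e B(1) by auto
  define \<kappa> where "\<kappa> s = cos (pi * s) ^ (2 * M)" for s :: real
  define I where "I = integral {0..1} \<kappa>"
  have \<kappa>_cont: "continuous_on Z \<kappa>" for Z unfolding \<kappa>_def by (intro continuous_intros)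
  have \<kappa>0: "0 \<le> \<kappa> s" for s by (simp add: \<kappa>_def power_mult)
  have I: "cos (pi * \<delta>) ^ (2 * M) < e / (4 * B) * I" using M by (simp add: I_def \<kappa>_def[abs_def])
  have "0 \<le> cos (pi * \<delta>) ^ (2 * M)" by (simp add: power_mult)
  then have Ipos: "I > 0" using I e B(1) by (smt (verit) zero_less_mult_iff divide_pos_pos)
  define a where "a k = of_nat (2 * M choose k) / (4 ^ M :: complex)" for k
  define b where "b k = a k / of_real I" for k
  show thesis
  proof (rule that[of b M])
    fix y assume y: "y \<in> K"
    define w where "w s = \<phi> (\<alpha> (coord_vec m s) y)" for s
    have wc: "continuous_on Z w" for Z unfolding w_def by (rule orbit_cont1[OF \<phi> y])
    have intk: "(\<lambda>s. cis (- 2 * pi * of_int (int M - int k) * s) * w s) integrable_on {0..1}" for k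
      unfolding w_def by (rule avg_integrable[OF \<phi> y])
    have "(\<Sum>k\<le>2 * M. a k * avg m (int M - int k) \<phi> y) =
        (\<Sum>k\<le>2 * M. integral {0..1} (\<lambda>s. a k * (cis (- 2 * pi * of_int (int M - int k) * s) * w s)))"
      unfolding avg_def w_def by (simp only: integral_mult_right)
    also have "\<dots> = integral {0..1} (\<lambda>s. \<Sum>k\<le>2 * M. a k * (cis (- 2 * pi * of_int (int M - int k) * s) * w s))"
      by (rule integral_sum[symmetric], simp, intro integrable_on_mult_right intk)
    also have "\<dots> = integral {0..1} (\<lambda>s. of_real (\<kappa> s) * w s)"
      unfolding \<kappa>_def cos_power_trig_expansion a_def by (simp add: sum_distrib_right mult.assoc)
    finally have eq: "(\<Sum>k\<le>2 * M. a k * avg m (int M - int k) \<phi> y) = integral {0..1} (\<lambda>s. of_real (\<kappa> s) * w s)" .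
    have int1: "(\<lambda>s. of_real (\<kappa> s) * w s) integrable_on {0..1}"
      and int2: "(\<lambda>s. of_real (\<kappa> s) * \<phi> y) integrable_on {0..1}"
      by (intro integrable_continuous_real continuous_intros \<kappa>_cont wc)+
    have intI: "integral {0..1} (\<lambda>s. of_real (\<kappa> s) * \<phi> y) = of_real I * \<phi> y"
    proof -
      have "(\<kappa> has_integral I) {0..1}"
        unfolding I_def by (intro integrable_integral integrable_continuous_real \<kappa>_cont)
      then have "((\<lambda>s. of_real (\<kappa> s) * \<phi> y) has_integral (of_real I * \<phi> y)) {0..1}"
        by (intro has_integral_mult_left has_integral_of_real)
      then show ?thesis by (rule integral_unique)
    qed
    have "norm ((\<Sum>k\<le>2 * M. a k * avg m (int M - int k) \<phi> y) - of_real I * \<phi> y) =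
        norm (integral {0..1} (\<lambda>s. of_real (\<kappa> s) * w s - of_real (\<kappa> s) * \<phi> y))"
      by (simp only: eq integral_diff[OF int1 int2] intI)
    also have "\<dots> \<le> integral {0..1} (\<lambda>s. \<kappa> s * (e / 2) + cos (pi * \<delta>) ^ (2 * M) * (2 * B))"
    proof (rule Henstock_Kurzweil_Integration.integral_norm_bound_integral)
      show "(\<lambda>s. of_real (\<kappa> s) * w s - of_real (\<kappa> s) * \<phi> y) integrable_on {0..1}"
        by (intro integrable_diff int1 int2)
      show "(\<lambda>s. \<kappa> s * (e / 2) + cos (pi * \<delta>) ^ (2 * M) * (2 * B)) integrable_on {0..1}"
        by (intro integrable_continuous_real continuous_intros \<kappa>_cont)
      fix s :: real assume s: "s \<in> {0..1}"
      have nrm: "norm (of_real (\<kappa> s) * w s - of_real (\<kappa> s) * \<phi> y) = \<kappa> s * norm (w s - \<phi> y)"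
        using \<kappa>0[of s] by (simp add: right_diff_distrib[symmetric] norm_mult)
      show "norm (of_real (\<kappa> s) * w s - of_real (\<kappa> s) * \<phi> y) \<le> \<kappa> s * (e / 2) + cos (pi * \<delta>) ^ (2 * M) * (2 * B)"
      \<comment> \<open>Points near 1 are also near the peak: by periodicity \<open>s\<close> acts
        like \<open>s - 1\<close>.\<close>
      proof (cases "s \<le> \<delta> \<or> s \<ge> 1 - \<delta>")
        case True
        have "norm (w s - \<phi> y) \<le> e / 2"
        proof (cases "s \<le> \<delta>")
          case True
          then show ?thesis using near[OF y, of s] s by (simp add: w_def)
        next
          case False
          then show ?thesis using near[OF y, of "s - 1"] shift[OF y, of s] s True by (simp add: w_def)
        qed
        then have "\<kappa> s * norm (w s - \<phi> y) \<le> \<kappa> s * (e / 2)" using \<kappa>0 by (rule mult_left_mono)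
        moreover have "0 \<le> cos (pi * \<delta>) ^ (2 * M) * (2 * B)" using B(1) by (simp add: power_mult)
        ultimately show ?thesis unfolding nrm by linarith
      next
        case False
        have "cos (pi * s) \<le> cos (pi * \<delta>)"
          using False s \<delta> by (intro cos_monotone_0_pi_le) auto
        moreover have "- cos (pi * s) \<le> cos (pi * \<delta>)"
        proof -
          have "- cos (pi * s) = cos (pi * (1 - s))" by (simp add: right_diff_distrib cos_diff)
          also have "\<dots> \<le> cos (pi * \<delta>)" using False s \<delta> by (intro cos_monotone_0_pi_le) auto
          finally show ?thesis .
        qed
        ultimately have "\<bar>cos (pi * s)\<bar> \<le> cos (pi * \<delta>)" by linarith
        then have "\<bar>cos (pi * s)\<bar> ^ (2 * M) \<le> cos (pi * \<delta>) ^ (2 * M)" by (intro power_mono) auto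
        then have \<kappa>le: "\<kappa> s \<le> cos (pi * \<delta>) ^ (2 * M)" by (simp add: \<kappa>_def power_even_abs)
        have "norm (w s - \<phi> y) \<le> 2 * B"
          using norm_triangle_ineq4[of "w s" "\<phi> y"] B(2)[OF y] B(2)[OF \<alpha>_in[OF y, of "coord_vec m s"]]
          by (simp add: w_def)
        then have "\<kappa> s * norm (w s - \<phi> y) \<le> cos (pi * \<delta>) ^ (2 * M) * (2 * B)"
          using \<kappa>le \<kappa>0 by (intro mult_mono) (auto intro: order_trans)
        moreover have "0 \<le> \<kappa> s * (e / 2)" using \<kappa>0 e by simp
        ultimately show ?thesis unfolding nrm by linarith
      qed
    qed
    also have "\<dots> = I * (e / 2) + cos (pi * \<delta>) ^ (2 * M) * (2 * B)"
      unfolding I_def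
      by (subst integral_add) (auto intro!: integrable_continuous_real continuous_intros \<kappa>_cont)
    also have "\<dots> < I * (e / 2) + e / (4 * B) * I * (2 * B)"
      using mult_strict_right_mono[OF I, of "2 * B"] B(1) by linarith
    also have "\<dots> = I * e" using B(1) by (simp add: field_simps)
    finally have le: "norm ((\<Sum>k\<le>2 * M. a k * avg m (int M - int k) \<phi> y) - of_real I * \<phi> y) < I * e" .
    have "\<phi> y - (\<Sum>k\<le>2 * M. b k * avg m (int M - int k) \<phi> y) =
        - ((\<Sum>k\<le>2 * M. a k * avg m (int M - int k) \<phi> y) - of_real I * \<phi> y) / of_real I"
      using Ipos by (simp add: b_def sum_divide_distrib[symmetric] diff_divide_distrib)
    then have "norm (\<phi> y - (\<Sum>k\<le>2 * M. b k * avg m (int M - int k) \<phi> y)) =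
        norm ((\<Sum>k\<le>2 * M. a k * avg m (int M - int k) \<phi> y) - of_real I * \<phi> y) / I"
      using Ipos by (simp add: norm_divide norm_minus_commute)
    also have "\<dots> < e" using le Ipos by (simp add: divide_less_eq mult.commute)
    finally show "norm (\<phi> y - (\<Sum>k\<le>2 * M. b k * avg m (int M - int k) \<phi> y)) < e" .
  qed
qed

text \<open>Each Fourier coefficient of \<open>\<phi>\<close> along circle \<open>m\<close> is
  approximated by a sum equivariant under the earlier circles, and averaging that sum over circle
  \<open>m\<close> makes it equivariant there too.\<close>

lemma equi_sums_dense:
  assumes "m \<le> l" "continuous_on K \<phi>" "e > 0"
  shows "\<exists>g. equi_sum m g \<and> (\<forall>y\<in>K. norm (\<phi> y - g y) < e)"
  using assms
proof (induction m arbitrary: \<phi> e)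
  case 0
  have "equi_sum 0 (\<lambda>y. \<phi> y + 0)"
    using equivariant_upto_0[OF 0(2)] equi_sum.zero by (rule equi_sum.add)
  then show ?case using 0(3) by (intro exI[of _ \<phi>]) simp
next
  case (Suc m)
  have m: "m < l" using Suc.prems by simp
  note \<phi> = Suc.prems(2)
  have "e / 2 > 0" using Suc.prems(3) by simp
  from kernel_approximation[OF \<phi> this, of m] obtain b M
    where Mb: "\<And>y. y \<in> K \<Longrightarrow> norm (\<phi> y - (\<Sum>k\<le>2 * M. b k * avg m (int M - int k) \<phi> y)) < e / 2"
    by blast
  define S where "S = (\<Sum>k\<le>2 * M. norm (b k))"
  have S0: "S \<ge> 0" by (simp add: S_def sum_nonneg)
  define d where "d = e / 2 / (S + 1)"
  have d: "d > 0" using Suc.prems(3) S0 by (simp add: d_def)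
  have Sd: "S * d \<le> e / 2"
  proof -
    have "S * d \<le> (S + 1) * d" using d by simp
    also have "\<dots> = e / 2" unfolding d_def
      using S0 by (subst times_divide_eq_right, intro nonzero_mult_div_cancel_left) auto
    finally show ?thesis .
  qed
  define g where "g k = avg m (int M - int k) \<phi>" for k
  have gc: "continuous_on K (g k)" for k unfolding g_def by (rule avg_cont[OF \<phi>])
  have "\<exists>h. equi_sum (Suc m) h \<and> (\<forall>y\<in>K. norm (g k y - h y) \<le> d)" for k
  proof -
    let ?c = "int M - int k"
    obtain h where h: "equi_sum m h" "\<forall>y\<in>K. norm (g k y - h y) < d"
      using Suc.IH[OF _ gc d] m by (auto simp: less_imp_le)
    obtain h' where h': "equi_sum (Suc m) h'" "\<forall>y\<in>K. avg m ?c h y = h' y"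
      using equi_sum_avg[OF h(1) m] by blast
    have hc: "continuous_on K h" by (rule equi_sum_cont[OF h(1)])
    have "norm (g k y - h' y) \<le> d" if y: "y \<in> K" for y
    proof -
      \<comment> \<open>\<open>g k\<close> already has weight \<open>?c\<close> along circle
        \<open>m\<close>, so averaging fixes it and the approximation error does not grow.\<close>
      have "avg m ?c (g k) y = g k y"
        unfolding g_def by (rule avg_fix) (rule avg_axis[OF \<phi> y])
      then have "g k y - h' y = avg m ?c (\<lambda>y. g k y - h y) y"
        using avg_diff[OF gc hc y] h'(2) y by simp
      also have "norm \<dots> \<le> d"
        using h(2) by (intro avg_norm y continuous_intros gc hc) (auto simp: less_imp_le)
      finally show ?thesis .
    qed
    then show ?thesis using h'(1) by blast
  qed
  then obtain h where h: "\<And>k. equi_sum (Suc m) (h k)" "\<And>k y. y \<in> K \<Longrightarrow> norm (g k y - h k y) \<le> d" by metis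
  have "equi_sum (Suc m) (\<lambda>y. \<Sum>k\<le>2 * M. b k * h k y)"
    by (intro equi_sum_sum equi_sum_scale h(1))
  moreover have "norm (\<phi> y - (\<Sum>k\<le>2 * M. b k * h k y)) < e" if y: "y \<in> K" for y
  proof -
    have "norm ((\<Sum>k\<le>2 * M. b k * g k y) - (\<Sum>k\<le>2 * M. b k * h k y)) \<le> (\<Sum>k\<le>2 * M. norm (b k) * d)"
      unfolding sum_subtractf[symmetric] right_diff_distrib[symmetric]
      by (intro order_trans[OF norm_sum] sum_mono) (simp add: norm_mult mult_left_mono h(2)[OF y])
    also have "\<dots> = S * d" by (simp add: S_def sum_distrib_right)
    finally have "norm ((\<Sum>k\<le>2 * M. b k * g k y) - (\<Sum>k\<le>2 * M. b k * h k y)) \<le> e / 2" using Sd by linarith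
    moreover have "norm (\<phi> y - (\<Sum>k\<le>2 * M. b k * g k y)) < e / 2" using Mb[OF y] by (simp add: g_def)
    ultimately show ?thesis
      using norm_triangle_ineq[of "\<phi> y - (\<Sum>k\<le>2 * M. b k * g k y)" "(\<Sum>k\<le>2 * M. b k * g k y) - (\<Sum>k\<le>2 * M. b k * h k y)"]
      by simp
  qed
  ultimately show ?case by blast
qed

text \<open>A coordinate distinguishing the points is uniformly close to a finite sum of weight
  functions, on which the points agree.\<close>

lemma weight_spaces_separate:
  assumes y: "y \<in> K" "y' \<in> K" and eq: "\<And>n f. f \<in> weight_space n \<Longrightarrow> f y = f y'"
  shows "y = y'"
proof
  fix i
  show "y i = y' i"
  proof (rule ccontr)
    assume ne: "y i \<noteq> y' i"
    define e where "e = \<bar>y i - y' i\<bar> / 2"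
    have e: "e > 0" using ne by (simp add: e_def)
    have "continuous_on K (\<lambda>y. complex_of_real (y i))"
      by (intro continuous_intros continuous_on_subset[OF continuous_on_product_coordinates]) auto
    then obtain g where g: "equi_sum l g" "\<And>y. y \<in> K \<Longrightarrow> norm (complex_of_real (y i) - g y) < e"
      using equi_sums_dense[OF le_refl _ e] by blast
    have "g y = g y'" using g(1)
      by (induction rule: equi_sum.induct) (use eq equivariant_upto_l in auto)
    then have "norm (complex_of_real (y i) - complex_of_real (y' i)) < e + e"
      using g(2)[OF y(1)] g(2)[OF y(2)]
      by (metis dist_norm dist_commute dist_triangle_less_add)
    then show False by (simp add: e_def flip: of_real_diff)
  qed
qed

end

section \<open>Stabilizers, slices and finitely many separating weight functions\<close>

context torus_on_compact
begin

definition Stab :: "(nat \<Rightarrow> real) \<Rightarrow> (nat \<Rightarrow> real) set" where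
  "Stab y = {\<theta>. \<alpha> \<theta> y = y}"

text \<open>The annihilator of \<open>H\<close> in the character lattice. Setting the entries from
  \<open>l\<close> on to 0 picks one integer vector per character.\<close>

definition Lat :: "(nat \<Rightarrow> real) set \<Rightarrow> (nat \<Rightarrow> int) set" where
  "Lat H = {n. (\<forall>i\<ge>l. n i = 0) \<and> (\<forall>\<theta>\<in>H. \<xi> n \<theta> = 1)}"

lemma Stab_\<alpha>:
  assumes "y \<in> K" shows "Stab (\<alpha> \<eta> y) = Stab y"
proof -
  have "\<alpha> \<theta> (\<alpha> \<eta> y) = \<alpha> \<eta> y \<longleftrightarrow> \<alpha> \<theta> y = y" for \<theta>
    using \<alpha>_commute[OF assms, of \<theta> \<eta>] \<alpha>_uminus[OF assms, of \<eta>] \<alpha>_uminus[of "\<alpha> \<theta> y" \<eta>] assms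
    by (metis \<alpha>_in)
  then show ?thesis by (simp add: Stab_def)
qed

text \<open>On the one-point set \<open>{y}\<close> the constant 1 is compatible with weight
  \<open>n\<close> because \<open>n\<close> is trivial on the stabilizer.\<close>

lemma exists_weight_function:
  assumes y: "y \<in> K" and n: "n \<in> Lat (Stab y)"
  obtains f where "f \<in> weight_space n" "f y = 1"
proof -
  obtain f where "f \<in> weight_space n" "\<And>s. s \<in> {y} \<Longrightarrow> f s = 1"
  proof (rule extend_to_weight_space[of "{y}" "\<lambda>_. 1" 1 n])
    show "1 = \<xi> n \<theta> * 1" if "s \<in> {y}" "\<alpha> \<theta> s \<in> {y}" for s \<theta>
      using that n by (auto simp: Lat_def Stab_def)
  qed (use y in auto)
  then show thesis using that by blast
qed

text \<open>Duality for the closed subgroup \<open>Stab y\<close>, drawn from separation of points: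
  a weight function not vanishing at \<open>y\<close> has a character trivial on
  \<open>Stab y\<close>, hence on \<open>\<theta>\<close>, so no weight function distinguishes
  \<open>\<alpha> \<theta> y\<close> from \<open>y\<close>.\<close>

lemma Stab_dual:
  assumes y: "y \<in> K" and \<theta>: "\<And>n. n \<in> Lat (Stab y) \<Longrightarrow> \<xi> n \<theta> = 1"
  shows "\<theta> \<in> Stab y"
proof -
  have "f (\<alpha> \<theta> y) = f y" if f: "f \<in> weight_space n" for n f
  proof (cases "f y = 0")
    case True
    then show ?thesis using weight_spaceD[OF f y] by simp
  next
    case False
    define n' where "n' i = (if i < l then n i else 0)" for i
    have eq: "\<xi> n' = \<xi> n" unfolding torus_char_def n'_def by (intro ext) simp
    have "n' \<in> Lat (Stab y)"
      unfolding Lat_def mem_Collect_eq eq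
    proof (intro conjI ballI)
      show "\<forall>i\<ge>l. n' i = 0" by (simp add: n'_def)
      fix \<eta> assume "\<eta> \<in> Stab y"
      then have "f y = \<xi> n \<eta> * f y" using weight_spaceD[OF f y, of \<eta>] by (simp add: Stab_def)
      then show "\<xi> n \<eta> = 1" using False by simp
    qed
    then have "\<xi> n \<theta> = 1" using \<theta> eq by metis
    then show ?thesis using weight_spaceD[OF f y] by simp
  qed
  then have "\<alpha> \<theta> y = y" using y by (intro weight_spaces_separate) auto
  then show ?thesis by (simp add: Stab_def)
qed

text \<open>The characters in \<open>B\<close> identify the quotient by \<open>H\<close> with a
  torus of dimension \<open>card B\<close>: \<open>H\<close> is their common kernel, and their
  phases can be prescribed independently.\<close>

definition dual_basis :: "(nat \<Rightarrow> real) set \<Rightarrow> (nat \<Rightarrow> int) set \<Rightarrow> bool" where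
  "dual_basis H B \<longleftrightarrow> finite B \<and> B \<subseteq> Lat H \<and> (\<forall>\<theta>. (\<forall>n\<in>B. \<xi> n \<theta> = 1) \<longrightarrow> \<theta> \<in> H) \<and>
     (\<forall>t. \<exists>\<theta>::nat \<Rightarrow> real. \<forall>n\<in>B. (\<Sum>i<l. of_int (n i) * \<theta> i) = t n)"

lemma exists_dual_basis:
  assumes y: "y \<in> K"
  shows "\<exists>B. dual_basis (Stab y) B"
proof -
  have "\<exists>B. finite B \<and> B \<subseteq> Lat (Stab y) \<and>
    (\<forall>\<theta>::nat \<Rightarrow> real. (\<forall>n\<in>B. (\<Sum>i<l. of_int (n i) * \<theta> i) \<in> \<int>) \<longrightarrow> (\<forall>n\<in>Lat (Stab y). (\<Sum>i<l. of_int (n i) * \<theta> i) \<in> \<int>)) \<and>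
    (\<forall>t. \<exists>\<theta>::nat \<Rightarrow> real. \<forall>n\<in>B. (\<Sum>i<l. of_int (n i) * \<theta> i) = t n)"
  proof (rule lattice_dual_basis)
    show "(\<lambda>_. 0) \<in> Lat (Stab y)" by (simp add: Lat_def torus_char_def)
    show "(\<lambda>i. n i - m i) \<in> Lat (Stab y)" if nm: "n \<in> Lat (Stab y)" "m \<in> Lat (Stab y)" for n m
    proof -
      have "(\<Sum>i<l. of_int (n i - m i) * \<theta> i) \<in> \<int>" if "\<theta> \<in> Stab y" for \<theta>
      proof -
        have "(\<Sum>i<l. of_int (n i) * \<theta> i) \<in> \<int>" "(\<Sum>i<l. of_int (m i) * \<theta> i) \<in> \<int>"
          using nm that by (auto simp: Lat_def torus_char_eq_1_iff)
        moreover have "(\<Sum>i<l. of_int (n i - m i) * \<theta> i) = (\<Sum>i<l. of_int (n i) * \<theta> i) - (\<Sum>i<l. of_int (m i) * \<theta> i)"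
          by (simp add: left_diff_distrib sum_subtractf)
        ultimately show ?thesis by simp
      qed
      then show ?thesis using nm unfolding Lat_def torus_char_eq_1_iff by simp
    qed
  qed (auto simp: Lat_def)
  then obtain B where B: "finite B" "B \<subseteq> Lat (Stab y)"
    "\<And>\<theta>::nat \<Rightarrow> real. \<lbrakk>\<forall>n\<in>B. (\<Sum>i<l. of_int (n i) * \<theta> i) \<in> \<int>\<rbrakk> \<Longrightarrow> \<forall>n\<in>Lat (Stab y). (\<Sum>i<l. of_int (n i) * \<theta> i) \<in> \<int>"
    "\<And>t. \<exists>\<theta>::nat \<Rightarrow> real. \<forall>n\<in>B. (\<Sum>i<l. of_int (n i) * \<theta> i) = t n"
    by auto
  have "\<theta> \<in> Stab y" if "\<forall>n\<in>B. \<xi> n \<theta> = 1" for \<theta>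
  proof -
    have "\<forall>n\<in>B. (\<Sum>i<l. of_int (n i) * \<theta> i) \<in> \<int>" using that by (simp add: torus_char_eq_1_iff)
    from B(3)[OF this] have "\<xi> n \<theta> = 1" if "n \<in> Lat (Stab y)" for n
      using that by (simp add: torus_char_eq_1_iff)
    then show "\<theta> \<in> Stab y" by (rule Stab_dual[OF y])
  qed
  then show ?thesis using B(1,2,4) unfolding dual_basis_def by (intro exI[of _ B]) simp
qed

text \<open>Such a set meets each orbit at most once, and only through parameters on which the
  character \<open>n\<close> is 1. So every continuous function on it satisfies the compatibility
  condition of \<open>extend_to_weight_space\<close>.\<close>

definition slice :: "(nat \<Rightarrow> int) \<Rightarrow> (nat \<Rightarrow> real) set \<Rightarrow> bool" where
  "slice n S \<longleftrightarrow> compact S \<and> S \<subseteq> K \<and> (\<forall>s\<in>S. \<forall>\<theta>. \<alpha> \<theta> s \<in> S \<longrightarrow> \<alpha> \<theta> s = s \<and> \<xi> n \<theta> = 1)"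

lemma weight_space_add:
  "\<lbrakk>f \<in> weight_space n; g \<in> weight_space n\<rbrakk> \<Longrightarrow> (\<lambda>y. f y + g y) \<in> weight_space n"
  by (auto simp: weight_space_def distrib_left intro!: continuous_intros)

text \<open>It suffices to work with real parts: on \<open>S\<close> these are close to Lipschitz
  functions \<open>p j\<close>, and the \<open>N + 1\<close> functions \<open>p j\<close> avoid some
  small vector \<open>v\<close> simultaneously.\<close>

lemma perturb_nonvanishing:
  assumes S: "slice n S" and F: "\<And>j. F j \<in> weight_space n" and e: "e > 0"
  obtains F' where "\<And>j. F' j \<in> weight_space n" "\<And>j y. y \<in> K \<Longrightarrow> norm (F' j y - F j y) \<le> e"
    "\<And>s. s \<in> S \<Longrightarrow> \<exists>j\<le>N. F' j s \<noteq> 0"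
proof -
  have cS: "compact S" and SK: "S \<subseteq> K" using S by (auto simp: slice_def)
  have Fc: "continuous_on S (F j)" for j
    using weight_space_cont[OF F] SK continuous_on_subset by blast
  have e2: "e / 2 > 0" using e by simp
  have "\<exists>p L. coord_lipschitz N S L p \<and> continuous_on S p \<and> (\<forall>s\<in>S. \<bar>Re (F j s) - p s\<bar> < e / 2)" for j
    using lipschitz_approximation[OF cS _ continuous_on_Re[OF Fc] e2, of N j] K_fin SK by (metis subsetD)
  then obtain p L where p: "\<And>j. coord_lipschitz N S (L j) (p j)" "\<And>j. continuous_on S (p j)"
      "\<And>j s. s \<in> S \<Longrightarrow> \<bar>Re (F j s) - p j s\<bar> < e / 2"
    by metis
  define L' where "L' = (\<Sum>j\<le>N. L j)"
  have L0: "L j \<ge> 0" for j using p(1) by (simp add: coord_lipschitz_def)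
  have LL': "L j \<le> L'" if "j \<le> N" for j unfolding L'_def using that L0 by (intro member_le_sum) auto
  have "\<exists>R. \<forall>s\<in>S. \<bar>s i\<bar> \<le> R" for i
  proof -
    have "continuous_on S (\<lambda>s. s i)" by (rule continuous_on_subset[OF continuous_on_product_coordinates]) simp
    from compact_imp_bounded[OF compact_continuous_image[OF this cS]] show ?thesis by (auto simp: bounded_iff)
  qed
  then obtain R where R: "\<And>i s. s \<in> S \<Longrightarrow> \<bar>s i\<bar> \<le> R i" by metis
  obtain v :: "nat \<Rightarrow> real" where v: "\<And>j. 0 \<le> v j \<and> v j \<le> e / 2" "\<And>s. s \<in> S \<Longrightarrow> \<exists>j\<le>N. p j s \<noteq> v j"
  proof (rule lipschitz_avoids_small_vector[of S N "\<lambda>s. s" "\<Sum>i<N. \<bar>R i\<bar>" "\<lambda>s j. p j s" L' "e / 2"])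
    show "\<bar>s i\<bar> \<le> (\<Sum>i<N. \<bar>R i\<bar>)" if "s \<in> S" "i < N" for s i
    proof -
      have "\<bar>s i\<bar> \<le> \<bar>R i\<bar>" using R[OF that(1), of i] by linarith
      also have "\<dots> \<le> (\<Sum>i<N. \<bar>R i\<bar>)" using that(2) by (intro member_le_sum) auto
      finally show ?thesis .
    qed
    show "\<bar>p j x - p j y\<bar> \<le> L' * d"
      if xy: "x \<in> S" "y \<in> S" "d \<ge> 0" "\<forall>i<N. \<bar>x i - y i\<bar> \<le> d" "j \<le> N" for x y d j
    proof -
      have "\<bar>p j x - p j y\<bar> \<le> L j * d" using p(1)[of j] xy by (simp add: coord_lipschitz_def)
      also have "\<dots> \<le> L' * d" using LL'[OF xy(5)] xy(3) by (rule mult_right_mono)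
      finally show ?thesis .
    qed
    show "L' \<ge> 0" unfolding L'_def using L0 by (simp add: sum_nonneg)
  qed (use e2 in auto)
  \<comment> \<open>The real correction that turns the real part of \<open>F j\<close> into
    \<open>p j - v j\<close> on the slice. Its two parts are each at most
    \<open>e / 2\<close>.\<close>
  define \<zeta> where "\<zeta> j s = complex_of_real (p j s - v j - Re (F j s))" for j s
  have "\<exists>h. h \<in> weight_space n \<and> (\<forall>s\<in>S. h s = \<zeta> j s) \<and> (\<forall>y\<in>K. norm (h y) \<le> e)" for j
  proof -
    obtain h where "h \<in> weight_space n" "\<And>s. s \<in> S \<Longrightarrow> h s = \<zeta> j s" "\<And>y. y \<in> K \<Longrightarrow> norm (h y) \<le> e"
    proof (rule extend_to_weight_space[of S "\<zeta> j" e n])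
      show "continuous_on S (\<zeta> j)" unfolding \<zeta>_def by (intro continuous_intros p(2) Fc)
      show "norm (\<zeta> j s) \<le> e" if s: "s \<in> S" for s
        unfolding \<zeta>_def norm_of_real using p(3)[OF s, of j] v(1)[of j] by linarith
      show "\<zeta> j (\<alpha> \<theta> s) = \<xi> n \<theta> * \<zeta> j s" if "s \<in> S" "\<alpha> \<theta> s \<in> S" for s \<theta>
      proof -
        have "\<alpha> \<theta> s = s \<and> \<xi> n \<theta> = 1" using S that unfolding slice_def by blast
        then show ?thesis by simp
      qed
    qed (use cS SK e in auto)
    then show ?thesis by blast
  qed
  then obtain h where h: "\<And>j. h j \<in> weight_space n" "\<And>j s. s \<in> S \<Longrightarrow> h j s = \<zeta> j s"
      "\<And>j y. y \<in> K \<Longrightarrow> norm (h j y) \<le> e" by metis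
  show thesis
  proof (rule that[of "\<lambda>j y. F j y + h j y"])
    show "(\<lambda>y. F j y + h j y) \<in> weight_space n" for j using weight_space_add F h(1) by blast
    show "norm (F j y + h j y - F j y) \<le> e" if "y \<in> K" for j y using h(3)[OF that] by simp
    show "\<exists>j\<le>N. F j s + h j s \<noteq> 0" if s: "s \<in> S" for s
    proof -
      obtain j where j: "j \<le> N" "p j s \<noteq> v j" using v(2)[OF s] by blast
      have "Re (F j s + h j s) = p j s - v j" using h(2)[OF s, of j] by (simp add: \<zeta>_def)
      then have "F j s + h j s \<noteq> 0" using j(2) by (metis right_minus_eq zero_complex.sel(1))
      then show ?thesis using j(1) by blast
    qed
  qed
qed

lemma nonvanishing_gap:
  assumes "compact S" "S \<subseteq> K" "\<And>j. F j \<in> weight_space n" "\<And>s. s \<in> S \<Longrightarrow> \<exists>j\<le>N. F j s \<noteq> 0"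
  obtains d where "d > 0" "\<And>s. s \<in> S \<Longrightarrow> \<exists>j\<le>N. norm (F j s) \<ge> d"
proof (cases "S = {}")
  case True
  then show ?thesis using that[of 1] by simp
next
  case False
  define u where "u s = (\<Sum>j\<le>N. norm (F j s))" for s
  have "continuous_on S u" unfolding u_def
    using assms(2,3) by (intro continuous_intros) (auto intro: continuous_on_subset[OF weight_space_cont])
  then obtain s0 where s0: "s0 \<in> S" "\<And>s. s \<in> S \<Longrightarrow> u s0 \<le> u s"
    using continuous_attains_inf[OF assms(1) False] by blast
  have "u s0 > 0"
  proof -
    obtain j where "j \<le> N" "F j s0 \<noteq> 0" using assms(4)[OF s0(1)] by blast
    then show ?thesis unfolding u_def by (intro sum_pos2[of _ j]) auto
  qed
  define d where "d = u s0 / (real N + 1)"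
  have d: "d > 0" using \<open>u s0 > 0\<close> by (simp add: d_def)
  show ?thesis
  proof (rule that[OF d])
    fix s assume s: "s \<in> S"
    show "\<exists>j\<le>N. norm (F j s) \<ge> d"
    proof (rule ccontr)
      assume "\<not> ?thesis"
      then have lt: "norm (F j s) < d" if "j \<le> N" for j using that by (meson not_le)
      have "u s < (\<Sum>j\<le>N. d)" unfolding u_def using lt by (intro sum_strict_mono) auto
      also have "\<dots> = u s0" by (simp add: d_def field_simps)
      finally show False using s0(2)[OF s] by simp
    qed
  qed
qed

text \<open>A Baire category argument: nonvanishing on a fixed compact slice is an open
  condition, and a dense one by perturbation.\<close>

lemma simultaneous_nonvanishing:
  assumes S: "\<And>i::nat. slice n (S i)"
  obtains F where "\<And>j. F j \<in> weight_space n" "\<And>i s. s \<in> S i \<Longrightarrow> \<exists>j\<le>N. F j s \<noteq> 0"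
proof -
  define P where "P = (\<lambda>Fe :: (nat \<Rightarrow> (nat \<Rightarrow> real) \<Rightarrow> complex) \<times> real. snd Fe > 0 \<and> (\<forall>j. fst Fe j \<in> weight_space n))"
  \<comment> \<open>The tolerances at least halve, so all later changes together amount to at most
    twice the current tolerance, while the gap just achieved is four times as large; the limit keeps
    it.\<close>
  define Q where "Q = (\<lambda>i (Fe :: (nat \<Rightarrow> (nat \<Rightarrow> real) \<Rightarrow> complex) \<times> real) (Fe' :: (nat \<Rightarrow> (nat \<Rightarrow> real) \<Rightarrow> complex) \<times> real).
     (\<forall>j. \<forall>y\<in>K. norm (fst Fe' j y - fst Fe j y) \<le> snd Fe) \<and> snd Fe' \<le> snd Fe / 2 \<and>
     (\<forall>s\<in>S i. \<exists>j\<le>N. norm (fst Fe' j s) \<ge> 4 * snd Fe'))"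
  have "\<exists>f. \<forall>i. P (f i) \<and> Q i (f i) (f (Suc i))"
  proof (rule dependent_nat_choice)
    show "\<exists>x. P x" unfolding P_def
      by (rule exI[of _ "(\<lambda>_ _. 0, 1)"]) (simp add: weight_space_def)
    fix x i assume P: "P x"
    have W: "fst x j \<in> weight_space n" for j using P by (simp add: P_def)
    have e: "snd x > 0" using P by (simp add: P_def)
    obtain F' where F': "\<And>j. F' j \<in> weight_space n" "\<And>j y. y \<in> K \<Longrightarrow> norm (F' j y - fst x j y) \<le> snd x"
        "\<And>s. s \<in> S i \<Longrightarrow> \<exists>j\<le>N. F' j s \<noteq> 0"
      by (rule perturb_nonvanishing[OF S[of i] W e]) (rule that)
    obtain d where d: "d > 0" "\<And>s. s \<in> S i \<Longrightarrow> \<exists>j\<le>N. norm (F' j s) \<ge> d"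
      using nonvanishing_gap[of "S i" F' n] F' S[of i] by (auto simp: slice_def)
    have "P (F', min (snd x / 2) (d / 4))" using e d(1) F'(1) by (simp add: P_def)
    moreover have "Q i x (F', min (snd x / 2) (d / 4))"
      unfolding Q_def using F'(2) d(2) by fastforce
    ultimately show "\<exists>y. P y \<and> Q i x y" by blast
  qed
  then obtain f where f: "\<And>i. P (f i)" "\<And>i. Q i (f i) (f (Suc i))" by blast
  define F where "F i = fst (f i)" for i
  define e where "e i = snd (f i)" for i
  have epos: "e i > 0" and FW: "F i j \<in> weight_space n" for i j using f(1)[of i] by (auto simp: P_def F_def e_def)
  have step: "norm (F (Suc i) j y - F i j y) \<le> e i" if "y \<in> K" for i j y
    using f(2)[of i] that by (simp add: Q_def F_def e_def)
  have half: "e (Suc i) \<le> e i / 2" for i using f(2)[of i] by (simp add: Q_def e_def)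
  have gap: "\<exists>j\<le>N. norm (F (Suc i) j s) \<ge> 4 * e (Suc i)" if "s \<in> S i" for i s
    using f(2)[of i] that by (simp add: Q_def F_def e_def)
  have diff: "norm (F (i + k) j y - F i j y) \<le> 2 * e i - 2 * e (i + k)" if y: "y \<in> K" for i k j y
  proof (induction k)
    case (Suc k)
    have "norm (F (i + Suc k) j y - F i j y) \<le> norm (F (Suc (i + k)) j y - F (i + k) j y) + norm (F (i + k) j y - F i j y)"
      using norm_triangle_ineq[of "F (Suc (i + k)) j y - F (i + k) j y" "F (i + k) j y - F i j y"] by simp
    then show ?case using Suc step[OF y, of "i + k" j] half[of "i + k"] by simp
  qed simp
  have diff_le: "norm (F k j y - F i j y) \<le> 2 * e i" if "y \<in> K" "k \<ge> i" for i k j y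
    using diff[OF that(1), of i "k - i" j] that(2) epos[of k] by simp
  have e_bound: "e i \<le> e 0 * (1/2) ^ i" for i
  proof (induction i)
    case (Suc i) then show ?case using half[of i] by simp
  qed simp
  have e_lim: "(\<lambda>i. 2 * e i) \<longlonglongrightarrow> 0"
  proof (rule tendsto_sandwich[of "\<lambda>_. 0" _ _ "\<lambda>i. 2 * (e 0 * (1/2) ^ i)"])
    have "(\<lambda>i. (1/2::real) ^ i) \<longlonglongrightarrow> 0" by (rule LIMSEQ_realpow_zero) auto
    from tendsto_mult_left[OF tendsto_mult_left[OF this, of "e 0"], of 2]
    show "(\<lambda>i. 2 * (e 0 * (1/2) ^ i)) \<longlonglongrightarrow> 0" by simp
  qed (use e_bound epos in \<open>auto simp: less_imp_le\<close>)
  have conv: "convergent (\<lambda>i. F i j y)" if y: "y \<in> K" for j y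
  proof (rule Cauchy_convergent, rule CauchyI')
    fix r :: real assume "r > 0"
    then have "\<forall>\<^sub>F i in sequentially. 2 * e i < r / 2" by (intro order_tendstoD(2)[OF e_lim]) simp
    then obtain i where i: "2 * e i < r / 2" by (auto simp: eventually_sequentially)
    have "norm (F m j y - F k j y) < r" if "m \<ge> i" "k > m" for m k
    proof -
      have "norm (F m j y - F k j y) \<le> norm (F m j y - F i j y) + norm (F k j y - F i j y)"
        using norm_triangle_ineq4[of "F m j y - F i j y" "F k j y - F i j y"] by simp
      then show ?thesis using diff_le[OF y, of i m j] diff_le[OF y, of i k j] i that by linarith
    qed
    then show "\<exists>M. \<forall>m\<ge>M. \<forall>n>m. dist (F m j y) (F n j y) < r" unfolding dist_norm by blast
  qed
  define G where "G j y = lim (\<lambda>i. F i j y)" for j y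
  have G: "(\<lambda>i. F i j y) \<longlonglongrightarrow> G j y" if "y \<in> K" for j y
    using conv[OF that] by (simp add: G_def convergent_LIMSEQ_iff)
  have close: "norm (G j y - F i j y) \<le> 2 * e i" if y: "y \<in> K" for i j y
  proof (rule tendsto_upperbound)
    show "(\<lambda>k. norm (F k j y - F i j y)) \<longlonglongrightarrow> norm (G j y - F i j y)"
      by (intro tendsto_intros G[OF y])
    show "\<forall>\<^sub>F k in sequentially. norm (F k j y - F i j y) \<le> 2 * e i"
      using diff_le[OF y] by (auto simp: eventually_sequentially)
  qed simp
  show thesis
  proof (rule that[of G])
    fix j
    have "uniform_limit K (\<lambda>i. F i j) (G j) sequentially"
      unfolding uniform_limit_iff
    proof (intro allI impI)
      fix r :: real assume "r > 0"
      then have "\<forall>\<^sub>F i in sequentially. 2 * e i < r" by (rule order_tendstoD(2)[OF e_lim])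
      then show "\<forall>\<^sub>F i in sequentially. \<forall>y\<in>K. dist (F i j y) (G j y) < r"
      proof eventually_elim
        case (elim i)
        show ?case
        proof
          fix y assume y: "y \<in> K"
          show "dist (F i j y) (G j y) < r"
            using le_less_trans[OF close[OF y] elim] by (simp add: dist_norm norm_minus_commute)
        qed
      qed
    qed
    then have "continuous_on K (G j)"
      by (rule uniform_limit_theorem[rotated]) (auto intro!: always_eventually weight_space_cont FW)
    moreover have "G j (\<alpha> \<theta> y) = \<xi> n \<theta> * G j y" if y: "y \<in> K" for y \<theta>
    proof (rule LIMSEQ_unique[OF G[OF \<alpha>_in[OF y]]])
      show "(\<lambda>i. F i j (\<alpha> \<theta> y)) \<longlonglongrightarrow> \<xi> n \<theta> * G j y"
        unfolding weight_spaceD[OF FW y] by (intro tendsto_intros G[OF y])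
    qed
    ultimately show "G j \<in> weight_space n" by (simp add: weight_space_def)
  next
    fix i s assume s: "s \<in> S i"
    then obtain j where j: "j \<le> N" "norm (F (Suc i) j s) \<ge> 4 * e (Suc i)" using gap by blast
    have "s \<in> K" using S[of i] s by (auto simp: slice_def)
    from close[OF this, of j "Suc i"] have "G j s \<noteq> 0" using j(2) epos[of "Suc i"] by auto
    then show "\<exists>j\<le>N. G j s \<noteq> 0" using j(1) by blast
  qed
qed

lemma positive_char_eq_1:
  assumes "Im z = 0" "Re z > 0" "Im (torus_char l n \<theta> * z) = 0" "Re (torus_char l n \<theta> * z) \<ge> 0"
  shows "torus_char l n \<theta> = 1"
proof -
  have z: "z = of_real (Re z)" using assms(1) by (simp add: complex_eq_iff)
  have "torus_char l n \<theta> * z = of_real (Re (torus_char l n \<theta> * z))" using assms(3) by (simp add: complex_eq_iff)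
  moreover have "norm (torus_char l n \<theta> * z) = norm z" by (simp add: norm_mult)
  ultimately have "Re (torus_char l n \<theta> * z) = Re z"
    using z assms(2,4) by (metis norm_of_real abs_of_nonneg abs_of_pos)
  then have "torus_char l n \<theta> * z = z" using assms(1,3) by (simp add: complex_eq_iff)
  then show ?thesis using assms(2) by auto
qed

lemma rotate_to_norm:
  assumes "(\<Sum>i<l. of_int (n i) * \<theta> i) = - Arg z / (2 * pi)"
  shows "\<xi> n \<theta> * z = of_real (norm z)"
proof -
  have "\<xi> n \<theta> = cis (- Arg z)" unfolding torus_char_def assms by simp
  moreover have "z = of_real (norm z) * cis (Arg z)" by (metis rcis_cmod_Arg rcis_def)
  ultimately have "\<xi> n \<theta> * z = of_real (norm z) * (cis (- Arg z) * cis (Arg z))" by (metis mult.left_commute)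
  then show ?thesis by (simp add: cis_mult)
qed

lemma fixed_set_closed: "closed {y \<in> K. \<forall>\<theta>\<in>H. \<alpha> \<theta> y = y}"
proof -
  have Kc: "closed K" using K by (rule compact_imp_closed)
  have "closed {y \<in> K. dist (\<alpha> \<theta> y) y = 0}" for \<theta>
    by (intro continuous_closed_preimage_constant Kc continuous_intros \<alpha>_compose_cont) auto
  then have "closed (K \<inter> (\<Inter>\<theta>\<in>H. {y \<in> K. dist (\<alpha> \<theta> y) y = 0}))"
    using Kc by (intro closed_Int closed_INT ballI)
  moreover have "K \<inter> (\<Inter>\<theta>\<in>H. {y \<in> K. dist (\<alpha> \<theta> y) y = 0}) = {y \<in> K. \<forall>\<theta>\<in>H. \<alpha> \<theta> y = y}"
    by auto
  ultimately show ?thesis by simp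
qed

text \<open>Weight functions \<open>\<psi> n\<close> equal to 1 at \<open>y0\<close> stay away from
  0 nearby. There the phases of all \<open>\<psi> n\<close> can be rotated to 0 by one parameter,
  which is unique modulo the stabilizer because \<open>B\<close> is a dual basis.\<close>

lemma stratum_slice:
  assumes y0: "y0 \<in> K" and B: "dual_basis (Stab y0) B"
  obtains S U where "open U" "y0 \<in> U" "\<And>n. n \<in> B \<Longrightarrow> slice n S"
    "\<And>y. \<lbrakk>y \<in> U; y \<in> K; Stab y = Stab y0\<rbrakk> \<Longrightarrow> \<exists>\<theta>. \<alpha> \<theta> y \<in> S"
proof -
  let ?H = "Stab y0"
  have Kc: "closed K" using K by (rule compact_imp_closed)
  have fB: "finite B" and BL: "B \<subseteq> Lat ?H" and dual: "\<And>\<theta>. (\<forall>n\<in>B. \<xi> n \<theta> = 1) \<Longrightarrow> \<theta> \<in> ?H"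
    and solv: "\<And>t. \<exists>\<theta>::nat \<Rightarrow> real. \<forall>n\<in>B. (\<Sum>i<l. of_int (n i) * \<theta> i) = t n"
    using B unfolding dual_basis_def by blast+
  have "\<forall>n\<in>B. \<exists>f. f \<in> weight_space n \<and> f y0 = 1"
    using exists_weight_function[OF y0] BL by (metis subsetD)
  then obtain \<psi> where \<psi>: "\<And>n. n \<in> B \<Longrightarrow> \<psi> n \<in> weight_space n" "\<And>n. n \<in> B \<Longrightarrow> \<psi> n y0 = 1" by metis
  note \<psi>c = weight_space_cont[OF \<psi>(1)]
  \<comment> \<open>To be closed, \<open>S\<close> asks only that \<open>?H\<close> fix the points,
    not that it be their full stabilizer. A parameter joining two points of \<open>S\<close> still
    preserves positive values of all \<open>\<psi> n\<close>, hence lies in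
    \<open>?H\<close>.\<close>
  define S where "S = {y \<in> K. \<forall>\<theta>\<in>?H. \<alpha> \<theta> y = y} \<inter> (K \<inter> (\<Inter>n\<in>B. {y \<in> K. \<psi> n y \<in> {z. Im z = 0 \<and> Re z \<ge> 1/2}}))"
  have clz: "closed {z::complex. Im z = 0 \<and> Re z \<ge> 1/2}"
    by (intro closed_Collect_conj closed_Collect_eq closed_Collect_le continuous_intros)
  have "closed {y \<in> K. \<psi> n y \<in> {z. Im z = 0 \<and> Re z \<ge> 1/2}}" if "n \<in> B" for n
    using continuous_closed_preimage[OF \<psi>c[OF that] Kc clz] by (simp add: vimage_def Int_def)
  then have "closed S" unfolding S_def by (intro closed_Int fixed_set_closed Kc closed_INT ballI)
  then have Scpt: "compact S" using K compact_Int_closed[of K S] by (simp add: S_def Int_assoc Int_absorb1 Int_commute Int_left_commute)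
  have SK: "S \<subseteq> K" by (auto simp: S_def)
  have "\<exists>T. open T \<and> T \<inter> K = {y \<in> K. \<psi> n y \<in> {z. norm z > 1/2}}" if n: "n \<in> B" for n
  proof -
    have "open {z::complex. norm z > 1/2}" by (intro open_Collect_less continuous_intros)
    then obtain T where "open T" "T \<inter> K = \<psi> n -` {z. norm z > 1/2} \<inter> K"
      using \<psi>c[OF n] unfolding continuous_on_open_invariant by blast
    then show ?thesis by (intro exI[of _ T]) auto
  qed
  then obtain T where T: "\<And>n. n \<in> B \<Longrightarrow> open (T n)" "\<And>n. n \<in> B \<Longrightarrow> T n \<inter> K = {y \<in> K. norm (\<psi> n y) > 1/2}"
    by simp metis
  show thesis
  proof (rule that[of "\<Inter>n\<in>B. T n" S])
    show "open (\<Inter>n\<in>B. T n)" using fB T(1) by (intro open_INT) auto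
    show "y0 \<in> (\<Inter>n\<in>B. T n)"
    proof
      fix n assume n: "n \<in> B"
      have "y0 \<in> {y \<in> K. norm (\<psi> n y) > 1/2}" using \<psi>(2)[OF n] y0 by simp
      then show "y0 \<in> T n" using T(2)[OF n] by blast
    qed
  next
    fix n assume n: "n \<in> B"
    show "slice n S"
      unfolding slice_def
    proof (intro conjI Scpt SK ballI allI impI)
      fix s \<theta> assume s: "s \<in> S" "\<alpha> \<theta> s \<in> S"
      have sK: "s \<in> K" using s(1) SK by blast
      have one: "\<xi> m \<theta> = 1" if m: "m \<in> B" for m
      proof (rule positive_char_eq_1[of "\<psi> m s"])
        have "\<xi> m \<theta> * \<psi> m s = \<psi> m (\<alpha> \<theta> s)" using weight_spaceD[OF \<psi>(1)[OF m] sK] by simp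
        then show "Im (\<xi> m \<theta> * \<psi> m s) = 0" "Re (\<xi> m \<theta> * \<psi> m s) \<ge> 0"
          using s(2) m by (auto simp: S_def)
        show "Im (\<psi> m s) = 0" "Re (\<psi> m s) > 0" using s(1) m by (auto simp: S_def)
      qed
      then show "\<xi> n \<theta> = 1" using n by blast
      have "\<theta> \<in> ?H" using dual one by blast
      then show "\<alpha> \<theta> s = s" using s(1) by (auto simp: S_def)
    qed
  next
    fix y assume y: "y \<in> (\<Inter>n\<in>B. T n)" "y \<in> K" "Stab y = ?H"
    obtain \<theta> where \<theta>: "\<forall>n\<in>B. (\<Sum>i<l. of_int (n i) * \<theta> i) = - Arg (\<psi> n y) / (2 * pi)"
      using solv[of "\<lambda>n. - Arg (\<psi> n y) / (2 * pi)"] by blast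
    have "\<psi> n (\<alpha> \<theta> y) = of_real (norm (\<psi> n y))" if "n \<in> B" for n
      using weight_spaceD[OF \<psi>(1)[OF that] y(2), of \<theta>] rotate_to_norm[of n \<theta> "\<psi> n y"] \<theta> that by simp
    moreover have "norm (\<psi> n y) > 1/2" if "n \<in> B" for n using T(2)[OF that] y(1,2) that by blast
    moreover have "\<alpha> \<eta> (\<alpha> \<theta> y) = \<alpha> \<theta> y" if "\<eta> \<in> ?H" for \<eta>
      using that Stab_\<alpha>[OF y(2), of \<theta>] y(3) by (auto simp: Stab_def)
    ultimately have "\<alpha> \<theta> y \<in> S" using y(2) unfolding S_def by (auto simp: less_imp_le)
    then show "\<exists>\<theta>. \<alpha> \<theta> y \<in> S" by blast
  qed
qed

text \<open>By Lindelof countably many slices reach every orbit of the stratum, and a weight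
  function vanishes along a whole orbit or nowhere on it.\<close>

lemma stratum_functions:
  assumes y0: "y0 \<in> K" and B: "dual_basis (Stab y0) B" and n: "n \<in> B"
  obtains F where "\<And>j. F j \<in> weight_space n" "\<And>y. \<lbrakk>y \<in> K; Stab y = Stab y0\<rbrakk> \<Longrightarrow> \<exists>j\<le>N. F j y \<noteq> 0"
proof -
  define Z where "Z = {y \<in> K. Stab y = Stab y0}"
  have "\<forall>z\<in>Z. \<exists>S U. open U \<and> z \<in> U \<and> slice n S \<and> (\<forall>y\<in>U \<inter> Z. \<exists>\<theta>. \<alpha> \<theta> y \<in> S)"
  proof
    fix z assume "z \<in> Z"
    then have z: "z \<in> K" "Stab z = Stab y0" by (auto simp: Z_def)
    then have Bz: "dual_basis (Stab z) B" using B by simp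
    obtain S U where "open U" "z \<in> U" "\<And>n. n \<in> B \<Longrightarrow> slice n S"
      "\<And>y. \<lbrakk>y \<in> U; y \<in> K; Stab y = Stab z\<rbrakk> \<Longrightarrow> \<exists>\<theta>. \<alpha> \<theta> y \<in> S"
      by (rule stratum_slice[OF z(1) Bz]) (rule that)
    then show "\<exists>S U. open U \<and> z \<in> U \<and> slice n S \<and> (\<forall>y\<in>U \<inter> Z. \<exists>\<theta>. \<alpha> \<theta> y \<in> S)"
      using n z(2) by (intro exI[of _ S] exI[of _ U]) (auto simp: Z_def)
  qed
  then obtain S U where SU: "\<And>z. z \<in> Z \<Longrightarrow> open (U z)" "\<And>z. z \<in> Z \<Longrightarrow> z \<in> U z" "\<And>z. z \<in> Z \<Longrightarrow> slice n (S z)"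
      "\<And>z y. \<lbrakk>z \<in> Z; y \<in> U z; y \<in> Z\<rbrakk> \<Longrightarrow> \<exists>\<theta>. \<alpha> \<theta> y \<in> S z"
    by (metis IntI)
  obtain \<F> where \<F>: "\<F> \<subseteq> U ` Z" "countable \<F>" "\<Union>\<F> = \<Union>(U ` Z)"
    using Lindelof[of "U ` Z"] SU(1) by auto
  obtain C where C: "C \<subseteq> Z" "countable C" "\<F> = U ` C"
    using \<F>(1,2) countable_subset_image[of \<F> U Z] by auto
  have y0Z: "y0 \<in> Z" using y0 by (simp add: Z_def)
  then have "C \<noteq> {}" using \<F>(3) C(3) SU(2)[OF y0Z] by auto
  have inC: "from_nat_into C i \<in> Z" for i using from_nat_into[OF \<open>C \<noteq> {}\<close>] C(1) by blast
  obtain F where F: "\<And>j. F j \<in> weight_space n" "\<And>i s. s \<in> S (from_nat_into C i) \<Longrightarrow> \<exists>j\<le>N. F j s \<noteq> 0"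
    using simultaneous_nonvanishing[of n "\<lambda>i. S (from_nat_into C i)"] SU(3)[OF inC] by blast
  show thesis
  proof (rule that[OF F(1)])
    fix y assume "y \<in> K" "Stab y = Stab y0"
    then have y: "y \<in> Z" by (simp add: Z_def)
    then obtain z where z: "z \<in> C" "y \<in> U z" using SU(2)[OF y] \<F>(3) C(3) by blast
    obtain i where i: "z = from_nat_into C i" using from_nat_into_surj[OF C(2) z(1)] by metis
    obtain \<theta> where "\<alpha> \<theta> y \<in> S z" using SU(4)[OF _ z(2) y] z(1) C(1) by blast
    then obtain j where j: "j \<le> N" "F j (\<alpha> \<theta> y) \<noteq> 0" using F(2) i by blast
    then show "\<exists>j\<le>N. F j y \<noteq> 0" using weight_spaceD[OF F(1) \<open>y \<in> K\<close>, of j \<theta>] by auto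
  qed
qed

text \<open>Two families are used. The functions \<open>F n j\<close> have no common zero on the
  stratum and detect phases; the invariant functions \<open>f J i\<close> record the coordinates of
  the orbit point at which the selected phases are 0. Equal values let one parameter
  \<open>\<theta>\<close> normalize \<open>y\<close> and \<open>y'\<close> simultaneously.\<close>

lemma stratum_separating_functions:
  assumes y0: "y0 \<in> K"
  shows "\<exists>\<F>. finite \<F> \<and> (\<forall>(n, f)\<in>\<F>. f \<in> weight_space n) \<and>
    (\<forall>y\<in>K. \<forall>y'\<in>K. Stab y = Stab y0 \<longrightarrow> (\<forall>(n, f)\<in>\<F>. f y = f y') \<longrightarrow>
       Stab y' \<subseteq> Stab y0 \<and> (Stab y' = Stab y0 \<longrightarrow> y = y'))"
proof -
  let ?H = "Stab y0"
  have Kc: "closed K" using K by (rule compact_imp_closed)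
  obtain B where B: "dual_basis ?H B" using exists_dual_basis[OF y0] by blast
  have fB: "finite B" and BL: "B \<subseteq> Lat ?H" and dual: "\<And>\<theta>. (\<forall>n\<in>B. \<xi> n \<theta> = 1) \<Longrightarrow> \<theta> \<in> ?H"
    and solv: "\<And>t. \<exists>\<theta>::nat \<Rightarrow> real. \<forall>n\<in>B. (\<Sum>i<l. of_int (n i) * \<theta> i) = t n"
    using B unfolding dual_basis_def by blast+
  have "\<forall>n\<in>B. \<exists>F. (\<forall>j. F j \<in> weight_space n) \<and> (\<forall>y\<in>K. Stab y = ?H \<longrightarrow> (\<exists>j\<le>N. F j y \<noteq> 0))"
    using stratum_functions[OF y0 B] by metis
  then obtain F where FW: "\<And>n j. n \<in> B \<Longrightarrow> F n j \<in> weight_space n"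
      and F0: "\<And>n y. \<lbrakk>n \<in> B; y \<in> K; Stab y = ?H\<rbrakk> \<Longrightarrow> \<exists>j\<le>N. F n j y \<noteq> 0"
    by metis
  note Fc = weight_space_cont[OF FW]
  define S where "S J = {y \<in> K. \<forall>\<theta>\<in>?H. \<alpha> \<theta> y = y} \<inter>
      (K \<inter> (\<Inter>n\<in>B. {y \<in> K. F n (J n) y \<in> {z. Im z = 0 \<and> Re z \<ge> 0}}))" for J
  have clz: "closed {z::complex. Im z = 0 \<and> Re z \<ge> 0}"
    by (intro closed_Collect_conj closed_Collect_eq closed_Collect_le continuous_intros)
  have "closed {y \<in> K. F n (J n) y \<in> {z. Im z = 0 \<and> Re z \<ge> 0}}" if "n \<in> B" for n J
    using continuous_closed_preimage[OF Fc[OF that] Kc clz] by (simp add: vimage_def Int_def)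
  then have Scl: "closed (S J)" for J unfolding S_def by (intro closed_Int fixed_set_closed Kc closed_INT ballI)
  have SK: "S J \<subseteq> K" for J by (auto simp: S_def)
  have Scpt: "compact (S J)" for J using compact_Int_closed[OF K Scl[of J]] SK[of J] by (simp add: Int_absorb1)
  \<comment> \<open>The product vanishes exactly where some selected function does, so the
    coordinates times \<open>\<rho>\<close> agree on any two points of \<open>S J\<close> in one
    orbit.\<close>
  define \<rho> where "\<rho> J s = (\<Prod>n\<in>B. Re (F n (J n) s))" for J s
  have invariant: "s i * \<rho> J s = (\<alpha> \<theta> s) i * \<rho> J (\<alpha> \<theta> s)" if s: "s \<in> S J" "\<alpha> \<theta> s \<in> S J" for J s \<theta> i
  proof -
    have sK: "s \<in> K" using s SK by blast
    have F: "F n (J n) (\<alpha> \<theta> s) = \<xi> n \<theta> * F n (J n) s" if "n \<in> B" for n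
      using weight_spaceD[OF FW[OF that] sK] .
    show ?thesis
    proof (cases "\<forall>n\<in>B. Re (F n (J n) s) \<noteq> 0")
      case True
      have "\<xi> n \<theta> = 1" if n: "n \<in> B" for n
      proof (rule positive_char_eq_1[of "F n (J n) s"])
        show "Im (F n (J n) s) = 0" using s(1) n by (auto simp: S_def)
        have "Re (F n (J n) s) \<ge> 0" using s(1) n by (auto simp: S_def)
        then show "Re (F n (J n) s) > 0" using True n by force
        show "Im (\<xi> n \<theta> * F n (J n) s) = 0" "Re (\<xi> n \<theta> * F n (J n) s) \<ge> 0"
          unfolding F[OF n, symmetric] using s(2) n by (auto simp: S_def)
      qed
      then have "\<theta> \<in> ?H" using dual by blast
      then have "\<alpha> \<theta> s = s" using s(1) by (auto simp: S_def)
      then show ?thesis by simp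
    next
      case False
      then obtain n where n: "n \<in> B" "Re (F n (J n) s) = 0" by blast
      then have "F n (J n) s = 0" using s(1) by (auto simp: S_def complex_eq_iff)
      then have "Re (F n (J n) (\<alpha> \<theta> s)) = 0" using F[OF n(1)] by simp
      then have "\<rho> J s = 0" "\<rho> J (\<alpha> \<theta> s) = 0" unfolding \<rho>_def using n fB by (auto intro!: prod_zero)
      then show ?thesis by simp
    qed
  qed
  have "\<exists>f. f \<in> weight_space (\<lambda>_. 0) \<and> (\<forall>s\<in>S J. f s = of_real (s i * \<rho> J s))" for J i
  proof -
    have c: "continuous_on (S J) (\<lambda>s. complex_of_real (s i * \<rho> J s))"
      unfolding \<rho>_def
      by (intro continuous_intros continuous_on_subset[OF continuous_on_product_coordinates] continuous_on_subset[OF Fc SK]) auto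
    obtain M where M: "M > 0" "\<And>s. s \<in> S J \<Longrightarrow> norm (complex_of_real (s i * \<rho> J s)) \<le> M"
      using compact_imp_bounded[OF compact_continuous_image[OF c Scpt]] by (auto simp: bounded_pos)
    obtain f where "f \<in> weight_space (\<lambda>_. 0)" "\<And>s. s \<in> S J \<Longrightarrow> f s = complex_of_real (s i * \<rho> J s)"
    proof (rule extend_to_weight_space[OF Scpt SK c _ M(2)])
      show "complex_of_real ((\<alpha> \<theta> s) i * \<rho> J (\<alpha> \<theta> s)) = \<xi> (\<lambda>_. 0) \<theta> * complex_of_real (s i * \<rho> J s)"
        if "s \<in> S J" "\<alpha> \<theta> s \<in> S J" for s \<theta>
        using invariant[OF that] by (simp add: torus_char_def)
    qed (use M(1) in auto)
    then show ?thesis by blast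
  qed
  then obtain f where fW: "\<And>J i. f J i \<in> weight_space (\<lambda>_. 0)"
      and f: "\<And>J i s. s \<in> S J \<Longrightarrow> f J i s = of_real (s i * \<rho> J s)"
    by metis
  define \<F>1 where "\<F>1 = (\<lambda>(n, j). (n, F n j)) ` (B \<times> {..N})"
  define \<F>2 where "\<F>2 = (\<lambda>(J, i). ((\<lambda>_. 0) :: nat \<Rightarrow> int, f J i)) ` (PiE B (\<lambda>_. {..N}) \<times> {..<N})"
  have fin: "finite (\<F>1 \<union> \<F>2)" unfolding \<F>1_def \<F>2_def using fB by (auto intro!: finite_PiE)
  have W: "\<forall>(n, f)\<in>\<F>1 \<union> \<F>2. f \<in> weight_space n" using FW fW by (auto simp: \<F>1_def \<F>2_def)
  have "Stab y' \<subseteq> ?H \<and> (Stab y' = ?H \<longrightarrow> y = y')"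
    if y: "y \<in> K" "y' \<in> K" "Stab y = ?H" and eq: "\<forall>(n, f)\<in>\<F>1 \<union> \<F>2. f y = f y'" for y y'
  proof
    have eq1: "F n j y = F n j y'" if "n \<in> B" "j \<le> N" for n j
    proof -
      have "(n, F n j) \<in> \<F>1 \<union> \<F>2"
        unfolding \<F>1_def using that by (intro UnI1 image_eqI[of _ _ "(n, j)"]) auto
      from bspec[OF eq this] show ?thesis by simp
    qed
    have eq2: "f J i y = f J i y'" if "J \<in> PiE B (\<lambda>_. {..N})" "i < N" for J i
    proof -
      have "((\<lambda>_. 0), f J i) \<in> \<F>1 \<union> \<F>2"
        unfolding \<F>2_def using that by (intro UnI2 image_eqI[of _ _ "(J, i)"]) auto
      from bspec[OF eq this] show ?thesis by simp
    qed
    have "\<forall>n\<in>B. \<exists>j. j \<le> N \<and> F n j y \<noteq> 0" using F0[OF _ y(1,3)] by blast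
    then obtain J0 where J0: "\<And>n. n \<in> B \<Longrightarrow> J0 n \<le> N" "\<And>n. n \<in> B \<Longrightarrow> F n (J0 n) y \<noteq> 0" by metis
    define J where "J = restrict J0 B"
    have JP: "J \<in> PiE B (\<lambda>_. {..N})" using J0(1) by (auto simp: J_def)
    have J: "\<And>n. n \<in> B \<Longrightarrow> J n \<le> N" "\<And>n. n \<in> B \<Longrightarrow> F n (J n) y \<noteq> 0" using J0 by (auto simp: J_def)
    \<comment> \<open>The functions selected at \<open>y\<close> are also nonzero at
      \<open>y'\<close>, so their characters are trivial on \<open>Stab y'\<close>; the dual basis
      then confines \<open>Stab y'\<close> to \<open>?H\<close>.\<close>
    show "Stab y' \<subseteq> ?H"
    proof
      fix \<theta> assume \<theta>: "\<theta> \<in> Stab y'"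
      have "\<xi> n \<theta> = 1" if n: "n \<in> B" for n
        using weight_spaceD[OF FW[OF n] y(2), of "J n" \<theta>] \<theta> eq1[OF n J(1)[OF n]] J(2)[OF n] by (simp add: Stab_def)
      then show "\<theta> \<in> ?H" using dual by blast
    qed
    show "Stab y' = ?H \<longrightarrow> y = y'"
    proof
      assume y'H: "Stab y' = ?H"
      obtain \<theta> where \<theta>: "\<forall>n\<in>B. (\<Sum>i<l. of_int (n i) * \<theta> i) = - Arg (F n (J n) y) / (2 * pi)"
        using solv[of "\<lambda>n. - Arg (F n (J n) y) / (2 * pi)"] by blast
      have rot: "F n (J n) (\<alpha> \<theta> z) = of_real (norm (F n (J n) y))" if n: "n \<in> B" and z: "z = y \<or> z = y'" for n z
      proof -
        have "F n (J n) z = F n (J n) y" using z eq1[OF n J(1)[OF n]] by auto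
        moreover have "F n (J n) (\<alpha> \<theta> z) = \<xi> n \<theta> * F n (J n) z" using z y weight_spaceD[OF FW[OF n]] by auto
        ultimately show ?thesis using rotate_to_norm[of n \<theta> "F n (J n) y"] \<theta> n by simp
      qed
      have inS: "\<alpha> \<theta> z \<in> S J" if z: "z = y \<or> z = y'" for z
      proof -
        have zK: "z \<in> K" "Stab z = ?H" using z y y'H by auto
        then have "\<alpha> \<eta> (\<alpha> \<theta> z) = \<alpha> \<theta> z" if "\<eta> \<in> ?H" for \<eta>
          using that Stab_\<alpha>[OF zK(1), of \<theta>] by (auto simp: Stab_def)
        then show ?thesis using rot[OF _ z] zK(1) unfolding S_def by auto
      qed
      have \<rho>z: "\<rho> J (\<alpha> \<theta> z) = (\<Prod>n\<in>B. norm (F n (J n) y))" if z: "z = y \<or> z = y'" for z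
        unfolding \<rho>_def using rot[OF _ z] by (intro prod.cong) auto
      have \<rho>0: "(\<Prod>n\<in>B. norm (F n (J n) y)) \<noteq> 0" using fB J(2) by simp
      have "(\<alpha> \<theta> y) i = (\<alpha> \<theta> y') i" for i
      proof (cases "i < N")
        case True
        have "f J i (\<alpha> \<theta> y) = f J i (\<alpha> \<theta> y')"
          using weight_spaceD[OF fW y(1)] weight_spaceD[OF fW y(2)] eq2[OF JP True] by simp
        then have "(\<alpha> \<theta> y) i * \<rho> J (\<alpha> \<theta> y) = (\<alpha> \<theta> y') i * \<rho> J (\<alpha> \<theta> y')"
          using f[OF inS, of y i] f[OF inS, of y' i] by (simp only: of_real_eq_iff simp_thms)
        then show ?thesis using \<rho>z[of y] \<rho>z[of y'] \<rho>0 by simp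
      next
        case False
        then show ?thesis using K_fin[of "\<alpha> \<theta> y" i] K_fin[of "\<alpha> \<theta> y'" i] y by simp
      qed
      then have "\<alpha> \<theta> y = \<alpha> \<theta> y'" by blast
      then show "y = y'" using \<alpha>_uminus y by metis
    qed
  qed
  then show ?thesis using fin W by (intro exI[of _ "\<F>1 \<union> \<F>2"]) blast
qed

text \<open>For two points with equal values, the families of both strata give both inclusions
  between the stabilizers; once these agree, the family of the common stratum separates. Finitely
  many strata keep the union finite.\<close>

theorem finite_separating_weight_functions:
  assumes "finite (Stab ` K)"
  shows "\<exists>(m::nat) w f. (\<forall>j<m. f j \<in> weight_space (w j)) \<and>
    (\<forall>y\<in>K. \<forall>y'\<in>K. (\<forall>j<m. f j y = f j y') \<longrightarrow> y = y')"
proof -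
  have "\<forall>H\<in>Stab ` K. \<exists>\<F>. finite \<F> \<and> (\<forall>(n, f)\<in>\<F>. f \<in> weight_space n) \<and>
    (\<forall>y\<in>K. \<forall>y'\<in>K. Stab y = H \<longrightarrow> (\<forall>(n, f)\<in>\<F>. f y = f y') \<longrightarrow>
       Stab y' \<subseteq> H \<and> (Stab y' = H \<longrightarrow> y = y'))"
    using stratum_separating_functions by blast
  from bchoice[OF this] obtain \<F> where F0: "\<forall>H\<in>Stab ` K. finite (\<F> H) \<and> (\<forall>(n, f)\<in>\<F> H. f \<in> weight_space n) \<and>
    (\<forall>y\<in>K. \<forall>y'\<in>K. Stab y = H \<longrightarrow> (\<forall>(n, f)\<in>\<F> H. f y = f y') \<longrightarrow>
       Stab y' \<subseteq> H \<and> (Stab y' = H \<longrightarrow> y = y'))" ..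
  have F: "\<And>H. H \<in> Stab ` K \<Longrightarrow> finite (\<F> H)"
      "\<And>H n f. \<lbrakk>H \<in> Stab ` K; (n, f) \<in> \<F> H\<rbrakk> \<Longrightarrow> f \<in> weight_space n"
      "\<And>y y'. \<lbrakk>y \<in> K; y' \<in> K; \<forall>(n, f)\<in>\<F> (Stab y). f y = f y'\<rbrakk> \<Longrightarrow> Stab y' \<subseteq> Stab y \<and> (Stab y' = Stab y \<longrightarrow> y = y')"
  proof -
    show "finite (\<F> H)" if "H \<in> Stab ` K" for H using bspec[OF F0 that] by (rule conjunct1)
    show "f \<in> weight_space n" if "H \<in> Stab ` K" "(n, f) \<in> \<F> H" for H n f
      using bspec[OF F0 that(1)] that(2) by auto
    show "Stab y' \<subseteq> Stab y \<and> (Stab y' = Stab y \<longrightarrow> y = y')"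
      if "y \<in> K" "y' \<in> K" "\<forall>(n, f)\<in>\<F> (Stab y). f y = f y'" for y y'
      using bspec[OF F0 imageI[OF that(1)]] that by simp
  qed
  have fin: "finite (\<Union>H\<in>Stab ` K. \<F> H)" by (rule finite_UN_I[OF assms F(1)])
  obtain m :: nat and g where g: "(\<Union>H\<in>Stab ` K. \<F> H) = g ` {j. j < m}"
    using finite_imp_nat_seg_image_inj_on[OF fin] by metis
  show ?thesis
  proof (intro exI[of _ m] exI[of _ "\<lambda>j. fst (g j)"] exI[of _ "\<lambda>j. snd (g j)"] conjI allI ballI impI)
    fix j assume "j < m"
    then have "g j \<in> (\<Union>H\<in>Stab ` K. \<F> H)" using g by auto
    then obtain H where "H \<in> Stab ` K" "g j \<in> \<F> H" by (rule UN_E)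
    then show "snd (g j) \<in> weight_space (fst (g j))" using F(2)[of H "fst (g j)" "snd (g j)"] by simp
  next
    fix y y' assume y: "y \<in> K" "y' \<in> K" and eq: "\<forall>j<m. snd (g j) y = snd (g j) y'"
    have all: "f y = f y'" if "z \<in> K" "(n, f) \<in> \<F> (Stab z)" for z n f
    proof -
      have "(n, f) \<in> (\<Union>H\<in>Stab ` K. \<F> H)" using that by blast
      then obtain j where "j < m" "(n, f) = g j" using g by auto
      then show ?thesis using eq by (metis snd_conv)
    qed
    have "\<forall>(n, f)\<in>\<F> (Stab y). f y = f y'" using all[OF y(1)] by auto
    from F(3)[OF y this] have "Stab y' \<subseteq> Stab y \<and> (Stab y' = Stab y \<longrightarrow> y = y')" .
    moreover have "\<forall>(n, f)\<in>\<F> (Stab y'). f y' = f y" using all[OF y(2)] by (metis (mono_tags, lifting) case_prodI2)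
    from F(3)[OF y(2,1) this] have "Stab y \<subseteq> Stab y' \<and> (Stab y = Stab y' \<longrightarrow> y' = y)" .
    ultimately show "y = y'" by blast
  qed
qed

end

section \<open>Compact subsets of a subspace of a manifold embed in Euclidean space\<close>

lemma continuous_map_euclidean_componentwise:
  fixes f :: "'a \<Rightarrow> 'i \<Rightarrow> 'b::topological_space"
  shows "continuous_map X euclidean f \<longleftrightarrow> (\<forall>k. continuous_map X euclidean (\<lambda>x. f x k))"
  unfolding euclidean_product_topology[symmetric] by (simp add: continuous_map_componentwise_UNIV)

lemma manifold_local_chart:
  assumes M: "topological_manifold M" and hom: "X homeomorphic_space subtopology M S"
  obtains d where "\<And>x. x \<in> topspace X \<Longrightarrow> \<exists>U (\<phi> :: 'a \<Rightarrow> nat \<Rightarrow> real). openin X U \<and> x \<in> U \<and>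
     continuous_map (subtopology X U) euclidean \<phi> \<and> inj_on \<phi> U \<and> (\<forall>y\<in>U. \<forall>i\<ge>d. \<phi> y i = 0)"
proof -
  obtain g where g: "homeomorphic_map X (subtopology M S) g"
    using hom unfolding homeomorphic_space by blast
  have gc: "continuous_map X M g"
    using homeomorphic_imp_continuous_map[OF g] by (simp add: continuous_map_in_subtopology)
  have ginj: "inj_on g (topspace X)" using homeomorphic_imp_injective_map[OF g] .
  obtain d where d: "\<And>x. x \<in> topspace M \<Longrightarrow> \<exists>U V. openin M U \<and> x \<in> U \<and> openin (Euclidean_space d) V \<and>
        subtopology M U homeomorphic_space subtopology (Euclidean_space d) V"
    using M unfolding topological_manifold_def by blast
  show thesis
  proof (rule that[of d])
    fix x assume x: "x \<in> topspace X"
    have "g x \<in> topspace M" using gc x continuous_map_funspace by blast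
    then obtain U V where UV: "openin M U" "g x \<in> U" "openin (Euclidean_space d) V"
        "subtopology M U homeomorphic_space subtopology (Euclidean_space d) V"
      using d by blast
    obtain h where h: "homeomorphic_map (subtopology M U) (subtopology (Euclidean_space d) V) h"
      using UV(4) unfolding homeomorphic_space by blast
    have hc: "continuous_map (subtopology M U) (Euclidean_space d) h"
      using homeomorphic_imp_continuous_map[OF h] by (simp add: continuous_map_in_subtopology)
    then have hc': "continuous_map (subtopology M U) euclidean h"
      unfolding Euclidean_space_def by (simp add: continuous_map_in_subtopology euclidean_product_topology)
    have hinj: "inj_on h (topspace (subtopology M U))" using homeomorphic_imp_injective_map[OF h] .
    define W where "W = {y \<in> topspace X. g y \<in> U}"
    have "openin X W" unfolding W_def by (rule openin_continuous_map_preimage[OF gc UV(1)])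
    moreover have "x \<in> W" using x UV(2) by (simp add: W_def)
    moreover have gW: "continuous_map (subtopology X W) (subtopology M U) g"
      using gc by (auto simp: continuous_map_in_subtopology W_def continuous_map_from_subtopology)
    then have "continuous_map (subtopology X W) euclidean (h \<circ> g)" using hc' by (rule continuous_map_compose)
    moreover have gin: "g y \<in> topspace (subtopology M U)" if "y \<in> W" for y
      using that gW continuous_map_funspace[OF gW] by (auto simp: W_def)
    moreover have "inj_on (h \<circ> g) W"
    proof (rule comp_inj_on)
      show "inj_on g W" by (rule inj_on_subset[OF ginj]) (auto simp: W_def)
      show "inj_on h (g ` W)" by (rule inj_on_subset[OF hinj]) (use gin in blast)
    qed
    moreover have "\<forall>y\<in>W. \<forall>i\<ge>d. (h \<circ> g) y i = 0"
    proof (intro ballI allI impI)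
      fix y i assume "y \<in> W" "d \<le> i"
      then have "h (g y) \<in> topspace (Euclidean_space d)"
        using gin hc continuous_map_funspace by blast
      then show "(h \<circ> g) y i = 0" using \<open>d \<le> i\<close> by (simp add: topspace_Euclidean_space)
    qed
    ultimately show "\<exists>U (\<phi> :: 'a \<Rightarrow> nat \<Rightarrow> real). openin X U \<and> x \<in> U \<and>
     continuous_map (subtopology X U) euclidean \<phi> \<and> inj_on \<phi> U \<and> (\<forall>y\<in>U. \<forall>i\<ge>d. \<phi> y i = 0)"
      by blast
  qed
qed

text \<open>Multiplying the chart by a bump function \<open>r\<close> extends it by 0 to the whole
  space; recording \<open>r\<close> as well allows division, so the chart is recovered where
  \<open>r\<close> is positive.\<close>

lemma cut_off_chart:
  assumes cr: "completely_regular_space X" and hd: "Hausdorff_space X"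
    and U: "openin X U" "x \<in> U" and \<phi>: "continuous_map (subtopology X U) euclidean (\<phi> :: 'a \<Rightarrow> nat \<Rightarrow> real)"
    and inj: "inj_on \<phi> U" and z: "\<forall>y\<in>U. \<forall>i\<ge>d. \<phi> y i = 0"
  obtains r :: "'a \<Rightarrow> real" and \<psi> :: "'a \<Rightarrow> nat \<Rightarrow> real"
  where "continuous_map X euclideanreal r" "\<And>k. continuous_map X euclideanreal (\<lambda>y. \<psi> y k)" "r x > 0"
    "\<And>y y'. \<lbrakk>y \<in> topspace X; y' \<in> topspace X; r y > 0; r y = r y'; \<forall>k<d. \<psi> y k = \<psi> y' k\<rbrakk> \<Longrightarrow> y = y'"
proof -
  have xX: "x \<in> topspace X" using U openin_subset by blast
  have "closedin X (topspace X - U)" using U by blast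
  moreover have "compactin X {x}" using xX by simp
  moreover have "disjnt {x} (topspace X - U)" using U by simp
  ultimately obtain f where f: "continuous_map X euclideanreal f" "f ` (topspace X - U) \<subseteq> {0}" "f ` {x} \<subseteq> {1}"
    using Urysohn_completely_regular_compact_closed_alt[OF cr, of "{x}" "topspace X - U" 0 1] by blast
  \<comment> \<open>The truncation makes \<open>r\<close> vanish on the open set
    \<open>f < 1/2\<close>, which together with \<open>U\<close> covers the space, so the extension
    by 0 is continuous by pasting.\<close>
  define r where "r y = max 0 (2 * f y - 1)" for y
  define \<psi> where "\<psi> y k = (if y \<in> U then r y * \<phi> y k else 0)" for y k
  have rc: "continuous_map X euclideanreal r" unfolding r_def by (intro continuous_intros f(1))
  have off: "r y = 0" if "y \<in> topspace X" "y \<notin> U" for y using f(2) that by (auto simp: r_def)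
  have op: "openin X {y \<in> topspace X. f y \<in> {..<1/2}}"
    by (rule openin_continuous_map_preimage[OF f(1)]) simp
  have \<psi>c: "continuous_map X euclideanreal (\<lambda>y. \<psi> y k)" for k
  proof (rule pasting_lemma[of "{True, False}" X "\<lambda>b. if b then U else {y \<in> topspace X. f y \<in> {..<1/2}}" euclideanreal
        "\<lambda>b y. if b then r y * \<phi> y k else 0"])
    show "openin X (if b then U else {y \<in> topspace X. f y \<in> {..<1/2}})" for b
      by (cases b) (simp_all only: if_True if_False U(1) op)
    have "continuous_map (subtopology X U) euclideanreal (\<lambda>y. \<phi> y k)"
      using \<phi> unfolding continuous_map_euclidean_componentwise by blast
    then have "continuous_map (subtopology X U) euclideanreal (\<lambda>y. r y * \<phi> y k)"
      by (rule continuous_map_real_mult[OF continuous_map_from_subtopology[OF rc]])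
    then show "continuous_map (subtopology X (if b then U else {y \<in> topspace X. f y \<in> {..<1/2}})) euclideanreal
        (\<lambda>y. if b then r y * \<phi> y k else 0)" for b
      by (cases b) auto
    show "(if i then r y * \<phi> y k else 0) = (if j then r y * \<phi> y k else 0)"
      if "y \<in> topspace X \<inter> (if i then U else {y \<in> topspace X. f y \<in> {..<1/2}}) \<inter> (if j then U else {y \<in> topspace X. f y \<in> {..<1/2}})"
      for i j y
      using that by (auto simp: r_def split: if_splits)
    show "\<exists>j. j \<in> {True, False} \<and> y \<in> (if j then U else {y \<in> topspace X. f y \<in> {..<1/2}}) \<and>
        \<psi> y k = (if j then r y * \<phi> y k else 0)" if "y \<in> topspace X" for y
    proof (cases "y \<in> U")
      case True
      then show ?thesis by (intro exI[of _ True]) (simp add: \<psi>_def)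
    next
      case False
      then have "f y = 0" using f(2) that by blast
      then show ?thesis using False that by (intro exI[of _ False]) (simp add: \<psi>_def)
    qed
  qed
  show thesis
  proof (rule that[OF rc \<psi>c])
    show "r x > 0" using f(3) by (simp add: r_def)
    fix y y' assume y: "y \<in> topspace X" "y' \<in> topspace X" "r y > 0" "r y = r y'" "\<forall>k<d. \<psi> y k = \<psi> y' k"
    have yU: "y \<in> U" "y' \<in> U" using off y by (metis less_irrefl)+
    have "\<phi> y k = \<phi> y' k" for k
    proof (cases "k < d")
      case True
      then have "r y * \<phi> y k = r y * \<phi> y' k" using y yU by (simp add: \<psi>_def)
      then show ?thesis using y(3) by simp
    next
      case False
      then show ?thesis using z yU by simp
    qed
    then have "\<phi> y = \<phi> y'" by blast
    then show "y = y'" using inj yU by (simp add: inj_on_def)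
  qed
qed

text \<open>Finitely many cut-off charts have positive \<open>r\<close> somewhere at each point of
  \<open>C\<close>; together they separate, since agreement of \<open>r\<close> puts both points
  into the same chart.\<close>

theorem compact_subset_of_manifold_embeds:
  assumes cr: "completely_regular_space X" and hd: "Hausdorff_space X"
    and M: "topological_manifold M" and hom: "X homeomorphic_space subtopology M S" and C: "compactin X C"
  obtains N and e :: "'a \<Rightarrow> nat \<Rightarrow> real" where "continuous_map X euclidean e" "inj_on e C" "\<And>x i. i \<ge> N \<Longrightarrow> e x i = 0"
proof -
  obtain d where d: "\<And>x. x \<in> topspace X \<Longrightarrow> \<exists>U (\<phi> :: 'a \<Rightarrow> nat \<Rightarrow> real). openin X U \<and> x \<in> U \<and>
     continuous_map (subtopology X U) euclidean \<phi> \<and> inj_on \<phi> U \<and> (\<forall>y\<in>U. \<forall>i\<ge>d. \<phi> y i = 0)"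
    by (rule manifold_local_chart[OF M hom]) (rule that)
  have CX: "C \<subseteq> topspace X" using C compactin_subset_topspace by blast
  define good where "good x r \<psi> \<longleftrightarrow> continuous_map X euclideanreal r \<and> (\<forall>k. continuous_map X euclideanreal (\<lambda>y. \<psi> y k)) \<and> r x > 0 \<and>
    (\<forall>y y'. y \<in> topspace X \<longrightarrow> y' \<in> topspace X \<longrightarrow> r y > 0 \<longrightarrow> r y = r y' \<longrightarrow> (\<forall>k<d. \<psi> y k = \<psi> y' k) \<longrightarrow> y = y')"
    for x and r :: "'a \<Rightarrow> real" and \<psi> :: "'a \<Rightarrow> nat \<Rightarrow> real"
  have "\<exists>r \<psi>. good x r \<psi>" if x: "x \<in> C" for x
  proof -
    have "x \<in> topspace X" using CX x by blast
    then obtain U and \<phi> :: "'a \<Rightarrow> nat \<Rightarrow> real" where U: "openin X U" "x \<in> U"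
     "continuous_map (subtopology X U) euclidean \<phi>" "inj_on \<phi> U" "\<forall>y\<in>U. \<forall>i\<ge>d. \<phi> y i = 0"
      using d[of x] by blast
    from cut_off_chart[OF cr hd U] show ?thesis unfolding good_def by metis
  qed
  then obtain r \<psi> where good: "\<And>x. x \<in> C \<Longrightarrow> good x (r x) (\<psi> x)" by metis
  define W where "W x = {y \<in> topspace X. r x y \<in> {0<..}}" for x
  have "openin X (W x)" if "x \<in> C" for x
    unfolding W_def using good[OF that] by (intro openin_continuous_map_preimage) (auto simp: good_def)
  moreover have "C \<subseteq> \<Union>(W ` C)" using good CX by (auto simp: W_def good_def)
  ultimately obtain \<F> where F: "finite \<F>" "\<F> \<subseteq> W ` C" "C \<subseteq> \<Union>\<F>"
    using compactinD[OF C, of "W ` C"] by blast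
  then obtain D where D: "finite D" "D \<subseteq> C" "\<F> = W ` D" using finite_subset_image by metis
  obtain p :: nat and pt where pt: "D = pt ` {j. j < p}"
    using finite_imp_nat_seg_image_inj_on[OF D(1)] by metis
  have ptC: "pt j \<in> C" if "j < p" for j using pt D(2) that by blast
  \<comment> \<open>One block of \<open>d + 1\<close> entries per chart: first the bump function,
    then the \<open>d\<close> scaled chart coordinates, whose index is shifted by 1.\<close>
  define e where "e y i = (if i < p * (d + 1) then
      (if i mod (d + 1) = 0 then r (pt (i div (d + 1))) y else \<psi> (pt (i div (d + 1))) y (i mod (d + 1) - 1)) else 0)" for y i
  show thesis
  proof (rule that[of e "p * (d + 1)"])
    have "continuous_map X euclideanreal (\<lambda>y. e y i)" for i
    proof (cases "i < p * (d + 1)")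
      case True
      then have "i div (d + 1) < p" by (simp add: less_mult_imp_div_less)
      then have "good (pt (i div (d + 1))) (r (pt (i div (d + 1)))) (\<psi> (pt (i div (d + 1))))" using good ptC by blast
      then show ?thesis using True unfolding e_def good_def by (cases "i mod (d + 1) = 0") auto
    next
      case False
      then show ?thesis by (simp add: e_def)
    qed
    then show "continuous_map X euclidean e" unfolding continuous_map_euclidean_componentwise by blast
    show "inj_on e C"
    proof (rule inj_onI)
      fix y y' assume y: "y \<in> C" "y' \<in> C" and eq: "e y = e y'"
      obtain j where j: "j < p" "r (pt j) y > 0" using y(1) F(3) D(3) pt by (auto simp: W_def)
      have lt: "j * (d + 1) + k < p * (d + 1)" if "k \<le> d" for k
      proof -
        have "j * (d + 1) + k < (j + 1) * (d + 1)" using that by simp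
        also have "\<dots> \<le> p * (d + 1)" using j(1) by (intro mult_right_mono) auto
        finally show ?thesis .
      qed
      have dm: "(j * (d + 1) + k) div (d + 1) = j" "(j * (d + 1) + k) mod (d + 1) = k" if "k \<le> d" for k
        using div_mult_self3[of "d + 1" j k] mod_mult_self3[of j "d + 1" k] that by simp_all
      have "r (pt j) y = r (pt j) y'"
        using fun_cong[OF eq, of "j * (d + 1) + 0"] lt[of 0] dm[of 0] by (simp add: e_def)
      moreover have "\<psi> (pt j) y k = \<psi> (pt j) y' k" if "k < d" for k
        using fun_cong[OF eq, of "j * (d + 1) + (k + 1)"] lt[of "k + 1"] dm[of "k + 1"] that by (simp add: e_def)
      ultimately show "y = y'" using good[OF ptC[OF j(1)]] j(2) y CX unfolding good_def by blast
    qed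
    show "e x i = 0" if "i \<ge> p * (d + 1)" for x i using that by (simp add: e_def)
  qed
qed

section \<open>Eigenfunctions as a real linearization\<close>

text \<open>Meant for functions whose formula degenerates on \<open>A\<close>: there
  \<open>V\<close> in the logarithm is replaced by \<open>max (V x) c\<close> for small
  \<open>c\<close>.\<close>

lemma continuous_map_uniform_approx:
  fixes f :: "'a \<Rightarrow> real"
  assumes "\<And>e. e > 0 \<Longrightarrow> \<exists>g. continuous_map X euclideanreal g \<and> (\<forall>x\<in>topspace X. \<bar>f x - g x\<bar> < e)"
  shows "continuous_map X euclideanreal f"
  unfolding continuous_map_def
proof (intro conjI allI impI)
  fix U :: "real set" assume "openin euclideanreal U"
  then have U: "open U" by simp
  show "openin X {x \<in> topspace X. f x \<in> U}"
  proof (subst openin_subopen, clarify)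
    fix x assume x: "x \<in> topspace X" "f x \<in> U"
    obtain e where e: "e > 0" "\<And>v. \<bar>v - f x\<bar> < e \<Longrightarrow> v \<in> U"
      using U x(2) unfolding open_dist dist_real_def by blast
    obtain g where g: "continuous_map X euclideanreal g" "\<And>y. y \<in> topspace X \<Longrightarrow> \<bar>f y - g y\<bar> < e / 3"
      using assms[of "e / 3"] e(1) by auto
    have "openin X {y \<in> topspace X. g y \<in> {g x - e / 3<..<g x + e / 3}}"
      by (rule openin_continuous_map_preimage[OF g(1)]) auto
    moreover have "f y \<in> U" if y: "y \<in> topspace X" "g y \<in> {g x - e / 3<..<g x + e / 3}" for y
    proof (rule e(2))
      have "g x - e / 3 < g y" "g y < g x + e / 3" using y(2) by simp_all
      then show "\<bar>f y - f x\<bar> < e" using g(2)[OF y(1)] g(2)[OF x(1)] by linarith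
    qed
    ultimately show "\<exists>T. openin X T \<and> x \<in> T \<and> T \<subseteq> {x \<in> topspace X. f x \<in> U}"
      using x e(1) by (intro exI[of _ "{y \<in> topspace X. g y \<in> {g x - e / 3<..<g x + e / 3}}"]) auto
  qed
qed auto

text \<open>The real two-by-two matrix of multiplication by \<open>c\<close>, addressed by the
  parities of the indices: even ones carry real parts, odd ones imaginary parts.\<close>

definition complex_block :: "complex \<Rightarrow> nat \<Rightarrow> nat \<Rightarrow> real" where
  "complex_block c i j = (if even i \<longleftrightarrow> even j then Re c else if even i then - Im c else Im c)"

definition block_diag :: "nat \<Rightarrow> (nat \<Rightarrow> complex) \<Rightarrow> real mat" where
  "block_diag m c = Matrix.mat (2 * m) (2 * m)
     (\<lambda>(i, j). if i div 2 = j div 2 then complex_block (c (i div 2)) i j else 0)"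

lemma block_diag_carrier [simp]: "block_diag m c \<in> carrier_mat (2 * m) (2 * m)"
  by (simp add: block_diag_def)

lemma block_diag_entry:
  "\<lbrakk>i < 2 * m; j < 2 * m\<rbrakk> \<Longrightarrow> block_diag m c $$ (i, j) = (if i div 2 = j div 2 then complex_block (c (i div 2)) i j else 0)"
  by (simp add: block_diag_def)

lemma sum_pairs:
  fixes g :: "nat \<Rightarrow> real"
  assumes "q < m"
  shows "(\<Sum>k<2 * m. if q = k div 2 then g k else 0) = g (2 * q) + g (2 * q + 1)"
proof -
  have "(\<Sum>k<2 * m. if q = k div 2 then g k else 0) = (\<Sum>k\<in>{2 * q, 2 * q + 1}. if q = k div 2 then g k else 0)"
    using assms by (intro sum.mono_neutral_right) auto
  then show ?thesis by simp
qed

lemma block_diag_power: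
  assumes "i < 2 * m" "j < 2 * m"
  shows "(block_diag m c ^\<^sub>m k) $$ (i, j) = block_diag m (\<lambda>q. c q ^ k) $$ (i, j)"
  using assms(2)
proof (induction k arbitrary: j)
  case 0
  have "i = j \<longleftrightarrow> i div 2 = j div 2 \<and> (even i \<longleftrightarrow> even j)" by presburger
  then show ?case using assms 0 by (auto simp: block_diag_entry complex_block_def block_diag_def)
next
  case (Suc k)
  have q: "i div 2 < m" using assms(1) by simp
  have "(block_diag m c ^\<^sub>m Suc k) $$ (i, j) =
      (\<Sum>p<2 * m. block_diag m (\<lambda>q. c q ^ k) $$ (i, p) * block_diag m c $$ (p, j))"
    unfolding pow_mat_entry_Suc[OF block_diag_carrier assms(1) Suc.prems] using Suc.IH by simp
  also have "\<dots> = (\<Sum>p<2 * m. if i div 2 = p div 2 then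
      complex_block (c (i div 2) ^ k) i p * (if p div 2 = j div 2 then complex_block (c (p div 2)) p j else 0) else 0)"
    using assms(1) Suc.prems by (intro sum.cong) (auto simp: block_diag_entry)
  also have "\<dots> = block_diag m (\<lambda>q. c q ^ Suc k) $$ (i, j)"
    unfolding sum_pairs[OF q] using assms(1) Suc.prems
    by (auto simp: block_diag_entry complex_block_def algebra_simps)
  finally show ?case .
qed

lemma mat_exp_block_diag:
  assumes ij: "i < 2 * m" "j < 2 * m"
  shows "mat_exp (t \<cdot>\<^sub>m block_diag m c) $$ (i, j) = block_diag m (\<lambda>q. exp (of_real t * c q)) $$ (i, j)"
proof -
  let ?x = "of_real t * c (i div 2)"
  have ex: "(\<lambda>k. ?x ^ k /\<^sub>R fact k) sums exp ?x" by (rule exp_converges)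
  have "mat_exp (t \<cdot>\<^sub>m block_diag m c) $$ (i, j) = (\<Sum>k. (block_diag m c ^\<^sub>m k) $$ (i, j) / fact k * t ^ k)"
    using mat_exp_entry[OF block_diag_carrier ij] by (simp add: mat_exp_deriv_def)
  also have "\<dots> = (\<Sum>k. if i div 2 = j div 2 then complex_block (?x ^ k /\<^sub>R fact k) i j else 0)"
  proof (rule suminf_cong)
    fix k
    have sc: "complex_block (a *\<^sub>R z) i j = a * complex_block z i j" for a z by (simp add: complex_block_def)
    have "?x ^ k /\<^sub>R fact k = (t ^ k / fact k) *\<^sub>R (c (i div 2) ^ k)"
      by (simp add: power_mult_distrib scaleR_conv_of_real divide_inverse mult_ac)
    then have *: "complex_block (?x ^ k /\<^sub>R fact k) i j = (t ^ k / fact k) * complex_block (c (i div 2) ^ k) i j"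
      by (simp only: sc)
    show "(block_diag m c ^\<^sub>m k) $$ (i, j) / fact k * t ^ k =
        (if i div 2 = j div 2 then complex_block (?x ^ k /\<^sub>R fact k) i j else 0)"
      unfolding block_diag_power[OF ij] block_diag_entry[OF ij] * by simp
  qed
  also have "\<dots> = (if i div 2 = j div 2 then complex_block (exp ?x) i j else 0)"
  proof -
    have "(\<lambda>k. complex_block (?x ^ k /\<^sub>R fact k) i j) sums complex_block (exp ?x) i j"
      unfolding complex_block_def using sums_Re[OF ex] sums_Im[OF ex] sums_minus[OF sums_Im[OF ex]] by auto
    then show ?thesis by (auto simp: sums_iff)
  qed
  finally show ?thesis using ij by (simp add: block_diag_entry)
qed

definition realify :: "nat \<Rightarrow> (nat \<Rightarrow> complex) \<Rightarrow> nat \<Rightarrow> real" where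
  "realify m z i = (if i < 2 * m then if even i then Re (z (i div 2)) else Im (z (i div 2)) else 0)"

lemma linearizing_from_eigenfunctions:
  assumes z: "\<And>t x q. \<lbrakk>x \<in> topspace X; q < m\<rbrakk> \<Longrightarrow> z (\<Phi> t x) q = exp (of_real t * c q) * z x q"
  shows "linearizing X \<Phi> (2 * m) (\<lambda>x. realify m (z x))"
  unfolding linearizing_def
proof (intro conjI bexI[of _ "block_diag m c"] allI ballI block_diag_carrier)
  show "(\<lambda>x. realify m (z x)) \<in> topspace X \<rightarrow> topspace (Euclidean_space (2 * m))"
    by (auto simp: realify_def topspace_Euclidean_space)
  fix t x assume x: "x \<in> topspace X"
  let ?E = "mat_exp (t \<cdot>\<^sub>m block_diag m c)"
  have dim: "dim_row ?E = 2 * m" "dim_col ?E = 2 * m" by (simp_all add: mat_exp_def block_diag_def)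
  show "Matrix.vec (2 * m) (realify m (z (\<Phi> t x))) = ?E *\<^sub>v Matrix.vec (2 * m) (realify m (z x))"
  proof (rule eq_vecI)
    fix i assume "i < dim_vec (?E *\<^sub>v Matrix.vec (2 * m) (realify m (z x)))"
    then have i: "i < 2 * m" using dim by simp
    then have q: "i div 2 < m" by simp
    have "(?E *\<^sub>v Matrix.vec (2 * m) (realify m (z x))) $ i = (\<Sum>j<2 * m. ?E $$ (i, j) * realify m (z x) j)"
      using i dim by (simp add: scalar_prod_def lessThan_atLeast0)
    also have "\<dots> = (\<Sum>j<2 * m. if i div 2 = j div 2 then complex_block (exp (of_real t * c (i div 2))) i j * realify m (z x) j else 0)"
      using i by (intro sum.cong) (auto simp: mat_exp_block_diag block_diag_entry)
    also have "\<dots> = realify m (z (\<Phi> t x)) i"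
      unfolding sum_pairs[OF q] using i q z[OF x q] by (auto simp: realify_def complex_block_def)
    finally show "Matrix.vec (2 * m) (realify m (z (\<Phi> t x))) $ i = (?E *\<^sub>v Matrix.vec (2 * m) (realify m (z x))) $ i"
      using i by simp
  qed (simp add: dim)
qed

lemma realify_inj:
  assumes "realify m z = realify m w" "q < m"
  shows "z q = w q"
proof -
  have "2 * q < 2 * m" "2 * q + 1 < 2 * m" using assms(2) by auto
  then show ?thesis
    using fun_cong[OF assms(1), of "2 * q"] fun_cong[OF assms(1), of "2 * q + 1"]
    by (simp add: realify_def complex_eq_iff)
qed

lemma realify_continuous:
  assumes "\<And>q. q < m \<Longrightarrow> continuous_map X euclidean (\<lambda>x. z x q)"
  shows "continuous_map X euclidean (\<lambda>x. realify m (z x))"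
  unfolding continuous_map_euclidean_componentwise
proof
  fix i
  show "continuous_map X euclideanreal (\<lambda>x. realify m (z x) i)"
  proof (cases "i < 2 * m")
    case True
    then have c: "continuous_map X euclidean (\<lambda>x. z x (i div 2))" using assms by simp
    have "continuous_map X euclideanreal (\<lambda>x. Re (z x (i div 2)))" "continuous_map X euclideanreal (\<lambda>x. Im (z x (i div 2)))"
      using continuous_map_compose[OF c, of euclideanreal Re] continuous_map_compose[OF c, of euclideanreal Im]
      by (auto simp: o_def continuous_on_Re continuous_on_Im)
    then show ?thesis using True by (simp add: realify_def)
  next
    case False
    then show ?thesis by (simp add: realify_def)
  qed
qed

section \<open>The torus as a quotient group\<close>

lemma real_vector_group_simps [simp]:
  "carrier (real_vector_group l) = topspace (Euclidean_space l)"
  "x \<otimes>\<^bsub>real_vector_group l\<^esub> y = (\<lambda>i. x i + y i)"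
  "\<one>\<^bsub>real_vector_group l\<^esub> = (\<lambda>i. 0)"
  by (simp_all add: real_vector_group_def)

lemma comm_group_real_vector_group: "comm_group (real_vector_group l)"
proof (rule comm_groupI)
  fix x assume "x \<in> carrier (real_vector_group l)"
  then show "\<exists>y\<in>carrier (real_vector_group l). y \<otimes>\<^bsub>real_vector_group l\<^esub> x = \<one>\<^bsub>real_vector_group l\<^esub>"
    by (intro bexI[of _ "\<lambda>i. - x i"]) (auto simp: topspace_Euclidean_space)
qed (auto simp: topspace_Euclidean_space add.assoc add.commute)

lemma normal_integer_lattice: "integer_lattice l \<lhd> real_vector_group l"
proof -
  interpret comm_group "real_vector_group l" by (rule comm_group_real_vector_group)
  have inv: "inv\<^bsub>real_vector_group l\<^esub> x = (\<lambda>i. - x i)" if "x \<in> topspace (Euclidean_space l)" for x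
    using that by (intro inv_equality) (auto simp: topspace_Euclidean_space)
  have "subgroup (integer_lattice l) (real_vector_group l)"
    by (rule subgroupI) (auto simp: integer_lattice_def topspace_Euclidean_space inv intro!: exI[of _ "\<lambda>_. 0"])
  then show ?thesis by (rule subgroup_imp_normal)
qed

lemma torus_proj_add:
  assumes "x \<in> topspace (Euclidean_space l)" "y \<in> topspace (Euclidean_space l)"
  shows "torus_proj l (\<lambda>i. x i + y i) = torus_proj l x \<otimes>\<^bsub>torus_group l\<^esub> torus_proj l y"
proof -
  interpret normal "integer_lattice l" "real_vector_group l" by (rule normal_integer_lattice)
  show ?thesis using rcos_sum[of x y] assms by (simp add: torus_proj_def torus_group_def FactGroup_def)
qed

lemma torus_proj_carrier:
  "x \<in> topspace (Euclidean_space l) \<Longrightarrow> torus_proj l x \<in> carrier (torus_group l)"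
  by (auto simp: torus_proj_def torus_group_def FactGroup_def RCOSETS_def)

lemma torus_proj_surj:
  assumes "T \<in> carrier (torus_group l)"
  obtains x where "x \<in> topspace (Euclidean_space l)" "T = torus_proj l x"
  using assms by (auto simp: torus_proj_def torus_group_def FactGroup_def RCOSETS_def)

lemma torus_proj_eq_iff:
  assumes "x \<in> topspace (Euclidean_space l)" "y \<in> topspace (Euclidean_space l)"
  shows "torus_proj l x = torus_proj l y \<longleftrightarrow> (\<forall>i. x i - y i \<in> \<int>)"
proof -
  interpret normal "integer_lattice l" "real_vector_group l" by (rule normal_integer_lattice)
  have mem: "z \<in> torus_proj l y \<longleftrightarrow> z \<in> topspace (Euclidean_space l) \<and> (\<forall>i. z i - y i \<in> \<int>)" if "y \<in> topspace (Euclidean_space l)" for z y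
  proof
    assume "z \<in> torus_proj l y"
    then show "z \<in> topspace (Euclidean_space l) \<and> (\<forall>i. z i - y i \<in> \<int>)"
      using that by (auto simp: torus_proj_def r_coset_def integer_lattice_def topspace_Euclidean_space)
  next
    assume z: "z \<in> topspace (Euclidean_space l) \<and> (\<forall>i. z i - y i \<in> \<int>)"
    then have "(\<lambda>i. z i - y i) \<in> integer_lattice l"
      using that by (simp add: integer_lattice_def topspace_Euclidean_space)
    then show "z \<in> torus_proj l y"
      unfolding torus_proj_def r_coset_def by (auto intro!: bexI[of _ "\<lambda>i. z i - y i"])
  qed
  show ?thesis
  proof
    assume "torus_proj l x = torus_proj l y"
    moreover have "x \<in> torus_proj l x" using mem[OF assms(1)] assms(1) by simp
    ultimately show "\<forall>i. x i - y i \<in> \<int>" using mem[OF assms(2)] by simp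
  next
    assume xy: "\<forall>i. x i - y i \<in> \<int>"
    have "(\<forall>i. z i - x i \<in> \<int>) \<longleftrightarrow> (\<forall>i. z i - y i \<in> \<int>)" for z
    proof
      assume "\<forall>i. z i - x i \<in> \<int>"
      then show "\<forall>i. z i - y i \<in> \<int>" using xy by (metis Ints_add diff_add_cancel add_diff_eq)
    next
      assume "\<forall>i. z i - y i \<in> \<int>"
      then show "\<forall>i. z i - x i \<in> \<int>" using xy by (metis Ints_diff diff_diff_eq2 diff_add_cancel add_diff_cancel_right')
    qed
    then show "torus_proj l x = torus_proj l y" using mem[OF assms(1)] mem[OF assms(2)] by blast
  qed
qed

lemma torus_one: "\<one>\<^bsub>torus_group l\<^esub> = torus_proj l (\<lambda>_. 0)"
proof -
  interpret normal "integer_lattice l" "real_vector_group l" by (rule normal_integer_lattice)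
  have "integer_lattice l #>\<^bsub>real_vector_group l\<^esub> \<one>\<^bsub>real_vector_group l\<^esub> = integer_lattice l"
    by (rule coset_mult_one) (rule subset)
  then show ?thesis by (simp add: torus_proj_def torus_group_def FactGroup_def)
qed

lemma torus_proj_continuous: "continuous_map (Euclidean_space l) (torus_topology l) (torus_proj l)"
  unfolding torus_topology_def by (rule quotient_imp_continuous_map[OF quotient_map_quotient_topology])

definition trunc :: "nat \<Rightarrow> (nat \<Rightarrow> real) \<Rightarrow> nat \<Rightarrow> real" where
  "trunc l \<theta> i = (if i < l then \<theta> i else 0)"

lemma trunc_in: "trunc l \<theta> \<in> topspace (Euclidean_space l)"
  by (simp add: trunc_def topspace_Euclidean_space)

lemma trunc_id: "\<theta> \<in> topspace (Euclidean_space l) \<Longrightarrow> trunc l \<theta> = \<theta>"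
  by (auto simp: trunc_def topspace_Euclidean_space)

lemma trunc_continuous: "continuous_map euclidean (Euclidean_space l) (trunc l)"
proof -
  have "continuous_map euclidean (Euclidean_space l) (\<lambda>\<theta> i. if i < l then \<theta> i else 0)"
    unfolding continuous_map_componentwise_Euclidean_space
    by (simp add: continuous_on_product_coordinates)
  then show ?thesis by (simp add: trunc_def[abs_def])
qed

section \<open>From a torus action and a phase to a linearization\<close>

context attracting_flow
begin

text \<open>The meeting point of both directions: a torus action on \<open>A\<close> and a
  linearization of \<open>X\<close> each yield such separating eigenfunctions, and from them the
  action or the linearization is rebuilt.\<close>

definition linear_coordinates :: "nat \<Rightarrow> (nat \<Rightarrow> 'a \<Rightarrow> complex) \<Rightarrow> (nat \<Rightarrow> real) \<Rightarrow> bool" where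
  "linear_coordinates m f \<omega> \<longleftrightarrow>
     (\<forall>j<m. continuous_map (subtopology X A) euclidean (f j)) \<and>
     (\<forall>j<m. \<forall>t. \<forall>a\<in>A. f j (\<Phi> t a) = cis (\<omega> j * t) * f j a) \<and>
     (\<forall>a\<in>A. \<forall>b\<in>A. (\<forall>j<m. f j a = f j b) \<longrightarrow> a = b)"

text \<open>The converse direction: weight functions of the torus action, pulled back along the phase map, separate
  \<open>A\<close>, while \<open>V\<close> times an embedding of the level set \<open>V = 1\<close> separates the orbits outside \<open>A\<close>.\<close>

lemma linear_coordinates_on_A:
  assumes e: "continuous_map X euclidean (e :: 'a \<Rightarrow> nat \<Rightarrow> real)" "inj_on e A" "\<And>x i. i \<ge> N \<Longrightarrow> e x i = 0"
    and act: "torus_action l (subtopology X A) \<Theta>"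
    and fin: "finitely_many_orbit_types l (subtopology X A) \<Theta>"
    and sub: "one_parameter_subgroup l (subtopology X A) \<Theta> \<Phi>"
  shows "\<exists>m f \<omega>. linear_coordinates m f \<omega>"
proof -
  have topA: "topspace (subtopology X A) = A" using A_subset by auto
  \<comment> \<open>The action is transported to the image of \<open>A\<close> in Euclidean space,
    where the results on tori acting on compact sets apply.\<close>
  define K where "K = e ` A"
  define D where "D = inv_into A e"
  have D: "D (e a) = a" if "a \<in> A" for a using that e(2) by (simp add: D_def)
  have D_in: "D y \<in> A" "e (D y) = y" if "y \<in> K" for y
    using that by (auto simp: K_def D_def inv_into_into f_inv_into_f)
  have eA: "continuous_map (subtopology X A) (top_of_set K) e"
    using e(1) by (auto simp: continuous_map_in_subtopology K_def continuous_map_from_subtopology)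
  have cptA: "compact_space (subtopology X A)" using A_compact by (simp add: compact_space_subtopology)
  have K_cpt: "compact K" using image_compactin[OF A_compact e(1)] by (simp add: K_def)
  have D_cont: "continuous_map (top_of_set K) (subtopology X A) D"
  proof -
    have "homeomorphic_map (subtopology X A) (top_of_set K) e"
      using eA cptA e(2) A_subset
      by (intro continuous_imp_homeomorphic_map)
        (auto simp: K_def topA Hausdorff_space_subtopology intro: inj_on_subset)
    then obtain g where g: "homeomorphic_maps (subtopology X A) (top_of_set K) e g"
      using homeomorphic_map_maps by blast
    then have "continuous_map (top_of_set K) (subtopology X A) g" by (simp add: homeomorphic_maps_def)
    moreover have "g y = D y" if "y \<in> topspace (top_of_set K)" for y
      using g that D unfolding homeomorphic_maps_def topA K_def by auto
    ultimately show ?thesis by (rule continuous_map_eq)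
  qed
  define p where "p \<theta> = torus_proj l (trunc l \<theta>)" for \<theta>
  have p_carrier: "p \<theta> \<in> carrier (torus_group l)" for \<theta> unfolding p_def by (intro torus_proj_carrier trunc_in)
  have p_cont: "continuous_map euclidean (torus_topology l) p"
    using continuous_map_compose[OF trunc_continuous torus_proj_continuous] by (simp add: p_def[abs_def] o_def)
  have \<Theta>c: "continuous_map (prod_topology (torus_topology l) (subtopology X A)) (subtopology X A) (\<lambda>(g, y). \<Theta> g y)"
    and \<Theta>1: "\<And>y. y \<in> A \<Longrightarrow> \<Theta> \<one>\<^bsub>torus_group l\<^esub> y = y"
    and \<Theta>m: "\<And>g h y. \<lbrakk>g \<in> carrier (torus_group l); h \<in> carrier (torus_group l); y \<in> A\<rbrakk> \<Longrightarrow>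
        \<Theta> (g \<otimes>\<^bsub>torus_group l\<^esub> h) y = \<Theta> g (\<Theta> h y)"
    using act unfolding torus_action_def continuous_action_def topA by auto
  have \<Theta>_in: "\<Theta> g y \<in> A" if "g \<in> carrier (torus_group l)" "y \<in> A" for g y
  proof -
    have "(g, y) \<in> topspace (prod_topology (torus_topology l) (subtopology X A))"
      using that A_topspace by (simp add: topspace_torus_topology)
    from funcset_mem[OF continuous_map_funspace[OF \<Theta>c] this] show ?thesis by simp
  qed
  define \<alpha> where "\<alpha> \<theta> y = e (\<Theta> (p \<theta>) (D y))" for \<theta> y
  interpret T: torus_on_compact l N K \<alpha>
  proof
    show "compact K" by fact
    show "y i = 0" if "y \<in> K" "i \<ge> N" for y i using that e(3) by (auto simp: K_def)
    have "continuous_map (prod_topology euclidean (top_of_set K)) (prod_topology (torus_topology l) (subtopology X A))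
        (\<lambda>z. (p (fst z), D (snd z)))"
      using continuous_map_compose[OF continuous_map_fst[of euclidean "top_of_set K"] p_cont]
        continuous_map_compose[OF continuous_map_snd[of "euclidean :: (nat \<Rightarrow> real) topology" "top_of_set K"] D_cont]
      by (simp add: continuous_map_pairwise o_def)
    from continuous_map_compose[OF continuous_map_compose[OF this \<Theta>c] eA]
    have "continuous_map (prod_topology euclidean (top_of_set K)) (top_of_set K) (\<lambda>(\<theta>, y). \<alpha> \<theta> y)"
      by (simp add: o_def \<alpha>_def case_prod_unfold)
    moreover have "prod_topology (euclidean :: (nat \<Rightarrow> real) topology) (top_of_set K) = top_of_set (UNIV \<times> K)"
      by (simp add: prod_topology_subtopology_eu[symmetric, of UNIV K, simplified])
    ultimately have "continuous_map (top_of_set (UNIV \<times> K)) (top_of_set K) (\<lambda>(\<theta>, y). \<alpha> \<theta> y)"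
      by (simp only:)
    then show "continuous_on (UNIV \<times> K) (\<lambda>(\<theta>, y). \<alpha> \<theta> y)"
      using continuous_map_into_fulltopology continuous_map_iff_continuous by blast
    show "\<alpha> \<theta> y \<in> K" if "y \<in> K" for \<theta> y
      unfolding \<alpha>_def K_def using \<Theta>_in[OF p_carrier D_in(1)[OF that]] by blast
    show "\<alpha> (\<lambda>i. \<theta> i + \<eta> i) y = \<alpha> \<theta> (\<alpha> \<eta> y)" if y: "y \<in> K" for \<theta> \<eta> y
    proof -
      have "trunc l (\<lambda>i. \<theta> i + \<eta> i) = (\<lambda>i. trunc l \<theta> i + trunc l \<eta> i)" by (auto simp: trunc_def)
      then have "p (\<lambda>i. \<theta> i + \<eta> i) = p \<theta> \<otimes>\<^bsub>torus_group l\<^esub> p \<eta>"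
        unfolding p_def using torus_proj_add[OF trunc_in trunc_in] by simp
      then show ?thesis unfolding \<alpha>_def
        using \<Theta>m[OF p_carrier p_carrier D_in(1)[OF y]] D[OF \<Theta>_in[OF p_carrier D_in(1)[OF y]]] by simp
    qed
    show "\<alpha> \<theta> y = y" if y: "y \<in> K" and \<theta>: "\<And>i. i < l \<Longrightarrow> \<theta> i \<in> \<int>" for \<theta> y
    proof -
      have "p \<theta> = \<one>\<^bsub>torus_group l\<^esub>"
        unfolding p_def torus_one
        by (subst torus_proj_eq_iff) (auto simp: trunc_in topspace_Euclidean_space, auto simp: trunc_def \<theta>)
      then show ?thesis unfolding \<alpha>_def using \<Theta>1 D_in[OF y] by simp
    qed
  qed
  \<comment> \<open>The lifted stabilizers are preimages of the stabilizers in the torus under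
    \<open>p\<close>, so there are no more of them.\<close>
  have "finite (T.Stab ` K)"
  proof (rule finite_subset)
    show "finite ((\<lambda>G. {\<theta>. p \<theta> \<in> G}) ` ((\<lambda>y. {g \<in> carrier (torus_group l). \<Theta> g y = y}) ` topspace (subtopology X A)))"
      using fin unfolding finitely_many_orbit_types_def by (rule finite_imageI)
    show "T.Stab ` K \<subseteq> (\<lambda>G. {\<theta>. p \<theta> \<in> G}) ` ((\<lambda>y. {g \<in> carrier (torus_group l). \<Theta> g y = y}) ` topspace (subtopology X A))"
    proof clarify
      fix y assume y: "y \<in> K"
      have "T.Stab y = {\<theta>. p \<theta> \<in> {g \<in> carrier (torus_group l). \<Theta> g (D y) = D y}}"
      proof -
        have "e (\<Theta> (p \<theta>) (D y)) = y \<longleftrightarrow> \<Theta> (p \<theta>) (D y) = D y" for \<theta>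
          using D_in[OF y] D[OF \<Theta>_in[OF p_carrier D_in(1)[OF y]]] by metis
        then show ?thesis by (auto simp: T.Stab_def \<alpha>_def p_carrier)
      qed
      then show "T.Stab y \<in> (\<lambda>G. {\<theta>. p \<theta> \<in> G}) ` ((\<lambda>y. {g \<in> carrier (torus_group l). \<Theta> g y = y}) ` topspace (subtopology X A))"
        using D_in(1)[OF y] unfolding topA by blast
    qed
  qed
  then obtain m w f where f: "\<And>j::nat. j < m \<Longrightarrow> f j \<in> T.weight_space (w j)"
    and f_sep: "\<forall>y\<in>K. \<forall>y'\<in>K. (\<forall>j<m. f j y = f j y') \<longrightarrow> y = y'"
    using T.finite_separating_weight_functions by blast
  obtain \<nu> where \<nu>: "\<nu> \<in> topspace (Euclidean_space l)"
      "\<And>t y. y \<in> A \<Longrightarrow> \<Phi> t y = \<Theta> (torus_proj l (\<lambda>i. \<nu> i * t)) y"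
    using sub unfolding one_parameter_subgroup_def topA by blast
  have "linear_coordinates m (\<lambda>j a. f j (e a)) (\<lambda>j. 2 * pi * (\<Sum>i<l. of_int (w j i) * \<nu> i))"
    unfolding linear_coordinates_def
  proof (intro conjI allI impI ballI)
    fix j assume j: "j < m"
    have "continuous_map (top_of_set K) euclidean (f j)" using T.weight_space_cont[OF f[OF j]] by simp
    from continuous_map_compose[OF eA this]
    show "continuous_map (subtopology X A) euclidean (\<lambda>a. f j (e a))" by (simp add: o_def)
  next
    fix j t a assume j: "j < m" and a: "a \<in> A"
    have "(\<lambda>i. \<nu> i * t) \<in> topspace (Euclidean_space l)" using \<nu>(1) by (simp add: topspace_Euclidean_space)
    then have "e (\<Phi> t a) = \<alpha> (\<lambda>i. \<nu> i * t) (e a)"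
      using \<nu>(2)[OF a] D[OF a] by (simp add: \<alpha>_def p_def trunc_id)
    then have "f j (e (\<Phi> t a)) = torus_char l (w j) (\<lambda>i. \<nu> i * t) * f j (e a)"
      using T.weight_spaceD[OF f[OF j]] a by (simp add: K_def)
    also have "torus_char l (w j) (\<lambda>i. \<nu> i * t) = cis (2 * pi * (\<Sum>i<l. of_int (w j i) * \<nu> i) * t)"
      by (simp add: torus_char_def sum_distrib_right mult.assoc)
    finally show "f j (e (\<Phi> t a)) = cis (2 * pi * (\<Sum>i<l. of_int (w j i) * \<nu> i) * t) * f j (e a)" .
  next
    fix a b assume ab: "a \<in> A" "b \<in> A" "\<forall>j<m. f j (e a) = f j (e b)"
    then have "e a = e b" using f_sep by (simp add: K_def)
    then show "a = b" using ab D by metis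
  qed
  then show ?thesis by blast
qed

text \<open>The exponents are imaginary for the functions on \<open>A\<close> and -1 for
  \<open>V\<close> and \<open>u\<close>. The factor \<open>V\<close> in \<open>u\<close> supplies
  the decay and forces continuity at \<open>A\<close>, while flowing to the level set for the time
  \<open>ln (V x)\<close> cancels the time dependence of the rest.\<close>

lemma linearizable_converse:
  assumes emb: "\<And>C. compactin X C \<Longrightarrow> \<exists>N (e :: 'a \<Rightarrow> nat \<Rightarrow> real). continuous_map X euclidean e \<and> inj_on e C \<and> (\<forall>x. \<forall>i\<ge>N. e x i = 0)"
    and phase: "has_asymptotic_phase X \<Phi> A"
    and act: "torus_action l (subtopology X A) \<Theta>"
    and fin: "finitely_many_orbit_types l (subtopology X A) \<Theta>"
    and sub: "one_parameter_subgroup l (subtopology X A) \<Theta> \<Phi>"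
  shows "\<exists>n F. linearizing X \<Phi> n F \<and> continuous_map X euclidean F \<and> inj_on F (topspace X)"
proof -
  obtain V where V: "continuous_map X euclideanreal V" "\<And>x. x \<in> topspace X \<Longrightarrow> V x \<ge> 0"
    "\<And>x. x \<in> topspace X \<Longrightarrow> V x = 0 \<longleftrightarrow> x \<in> A"
    "\<And>t x. x \<in> topspace X \<Longrightarrow> V (\<Phi> t x) = exp (- t) * V x"
    "\<And>c. compactin X {x \<in> topspace X. V x \<le> c}"
    by (rule exponential_lyapunov_function) (rule that)
  \<comment> \<open>One embedding of this sublevel set serves both \<open>A\<close> and the level
    set where \<open>V = 1\<close>.\<close>
  define C where "C = {x \<in> topspace X. V x \<le> 1}"
  obtain N and e :: "'a \<Rightarrow> nat \<Rightarrow> real" where e: "continuous_map X euclidean e" "inj_on e C" "\<And>x i. i \<ge> N \<Longrightarrow> e x i = 0"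
    using emb[OF V(5)[of 1]] unfolding C_def by blast
  have AC: "A \<subseteq> C" using V(3) A_topspace by (force simp: C_def)
  obtain m f \<omega> where "linear_coordinates m f \<omega>"
    using linear_coordinates_on_A[OF e(1) inj_on_subset[OF e(2) AC] _ act fin sub, of N] e(3) by blast
  then have f: "\<And>j. j < m \<Longrightarrow> continuous_map (subtopology X A) euclidean (f j)"
    "\<And>j t a. \<lbrakk>j < m; a \<in> A\<rbrakk> \<Longrightarrow> f j (\<Phi> t a) = cis (\<omega> j * t) * f j a"
    "\<And>a b. \<lbrakk>a \<in> A; b \<in> A; \<forall>j<m. f j a = f j b\<rbrakk> \<Longrightarrow> a = b"
    unfolding linear_coordinates_def by simp_all
  obtain P where P: "continuous_map X (subtopology X A) P" "\<And>a. a \<in> A \<Longrightarrow> P a = a"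
      "\<And>t x. x \<in> topspace X \<Longrightarrow> P (\<Phi> t x) = \<Phi> t (P x)"
    using phase unfolding has_asymptotic_phase_def by blast
  have P_in: "P x \<in> A" if "x \<in> topspace X" for x
    using continuous_map_funspace[OF P(1)] that by auto
  have ecoord: "continuous_map X euclideanreal (\<lambda>x. e x i)" for i
    using e(1) unfolding continuous_map_euclidean_componentwise by blast
  have "\<exists>B. \<forall>x\<in>C. \<bar>e x i\<bar> \<le> B" for i
  proof -
    have "compact ((\<lambda>x. e x i) ` C)" using image_compactin[OF V(5)[of 1] ecoord[of i]] by (simp add: C_def)
    then show ?thesis using compact_imp_bounded by (fastforce simp: bounded_iff)
  qed
  then obtain B where B: "\<And>i x. x \<in> C \<Longrightarrow> \<bar>e x i\<bar> \<le> B i" by metis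
  text \<open>Where \<open>V x = 0\<close> the junk value \<open>ln 0 = 0\<close> is multiplied by \<open>V x = 0\<close>.\<close>
  define u where "u i x = V x * e (\<Phi> (ln (V x)) x) i" for i x
  have late_in_C: "\<Phi> (ln c) x \<in> C" if x: "x \<in> topspace X" "V x \<le> c" "c > 0" for c x
    using x V(2)[of x] by (simp add: C_def V(4) exp_minus field_simps)
  have u_le: "\<bar>V x * e (\<Phi> (ln (max (V x) c)) x) i\<bar> \<le> V x * \<bar>B i\<bar>" if x: "x \<in> topspace X" and c: "c > 0" for x c i
  proof -
    have "max (V x) c > 0" using c by (simp add: less_max_iff_disj)
    then have "\<bar>e (\<Phi> (ln (max (V x) c)) x) i\<bar> \<le> B i" using late_in_C[OF x, of "max (V x) c"] by (intro B) simp
    then have "\<bar>e (\<Phi> (ln (max (V x) c)) x) i\<bar> \<le> \<bar>B i\<bar>" by linarith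
    then show ?thesis using V(2)[OF x] by (simp add: abs_mult mult_left_mono)
  qed
  have u_cont: "continuous_map X euclideanreal (u i)" for i
  proof (rule continuous_map_uniform_approx)
    fix \<epsilon> :: real assume \<epsilon>: "\<epsilon> > 0"
    \<comment> \<open>Where \<open>V x < c\<close>, both functions to be compared are at most
      \<open>c * \<bar>B i\<bar>\<close>, which is at most a third of
      \<open>\<epsilon>\<close>.\<close>
    define c where "c = \<epsilon> / (3 * (\<bar>B i\<bar> + 1))"
    have c: "c > 0" using \<epsilon> by (simp add: c_def)
    have cB: "2 * (c * \<bar>B i\<bar>) < \<epsilon>"
    proof -
      have "c * \<bar>B i\<bar> \<le> c * (\<bar>B i\<bar> + 1)" using c by simp
      also have "\<dots> = \<epsilon> / 3" by (simp add: c_def field_simps add_pos_nonneg)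
      finally show ?thesis using \<epsilon> by simp
    qed
    define g where "g x = V x * e (\<Phi> (ln (max (V x) c)) x) i" for x
    have mc: "continuous_map X euclideanreal (\<lambda>x. max (V x) c)" by (intro continuous_intros V(1))
    have "continuous_map X (top_of_set {0<..}) (\<lambda>x. max (V x) c)"
      using mc c by (auto simp: continuous_map_in_subtopology)
    moreover have "continuous_map (top_of_set {0<..}) euclideanreal ln"
      by (auto intro!: continuous_on_ln)
    ultimately have "continuous_map X euclideanreal (ln \<circ> (\<lambda>x. max (V x) c))" by (rule continuous_map_compose)
    then have "continuous_map X X (\<lambda>x. \<Phi> (ln (max (V x) c)) x)"
      using flow_compose[of X "\<lambda>x. ln (max (V x) c)" "\<lambda>x. x"] by (simp add: o_def)
    from continuous_map_compose[OF this ecoord[of i]]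
    have "continuous_map X euclideanreal g"
      unfolding g_def by (intro continuous_map_real_mult V(1)) (simp add: o_def)
    moreover have "\<bar>u i x - g x\<bar> < \<epsilon>" if x: "x \<in> topspace X" for x
    proof (cases "V x \<ge> c")
      case True
      then show ?thesis using \<epsilon> by (simp add: u_def g_def max_def)
    next
      case False
      have "\<bar>u i x\<bar> \<le> V x * \<bar>B i\<bar>"
      proof (cases "V x = 0")
        case True then show ?thesis by (simp add: u_def)
      next
        case False
        then have "V x > 0" using V(2)[OF x] by simp
        then show ?thesis using u_le[OF x, of "V x" i] by (simp add: u_def)
      qed
      moreover have "\<bar>g x\<bar> \<le> V x * \<bar>B i\<bar>" unfolding g_def by (rule u_le[OF x c])
      moreover have "V x * \<bar>B i\<bar> \<le> c * \<bar>B i\<bar>" using False by (intro mult_right_mono) auto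
      ultimately show ?thesis using cB by linarith
    qed
    ultimately show "\<exists>g. continuous_map X euclideanreal g \<and> (\<forall>x\<in>topspace X. \<bar>u i x - g x\<bar> < \<epsilon>)" by blast
  qed
  have u_flow: "u i (\<Phi> t x) = exp (- t) * u i x" if x: "x \<in> topspace X" for i t x
  proof (cases "V x = 0")
    case True
    then show ?thesis using V(4)[OF x] by (simp add: u_def)
  next
    case False
    then have "V x > 0" using V(2)[OF x] by simp
    then have "ln (exp (- t) * V x) = ln (V x) - t" by (simp add: ln_mult)
    moreover have "\<Phi> (ln (V x) - t) (\<Phi> t x) = \<Phi> (ln (V x)) x" using flow_add[OF x, of "ln (V x) - t" t] by simp
    ultimately show ?thesis using V(4)[OF x] by (simp add: u_def)
  qed
  \<comment> \<open>\<open>V\<close> itself is a coordinate: it decides membership in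
    \<open>A\<close>, allows \<open>u\<close> to be divided by it, and gives back the time that
    leads to the level set.\<close>
  define z where "z x q = (if q < m then f q (P x) else if q = m then of_real (V x) else of_real (u (q - Suc m) x))" for x q
  define c where "c q = (if q < m then \<i> * of_real (\<omega> q) else - 1)" for q
  let ?n = "Suc m + N"
  have z_flow: "z (\<Phi> t x) q = exp (of_real t * c q) * z x q" if x: "x \<in> topspace X" "q < ?n" for t x q
  proof (cases "q < m")
    case True
    have "cis (\<omega> q * t) = exp (of_real t * c q)" using True by (simp add: c_def cis_conv_exp mult_ac)
    then show ?thesis using True f(2)[OF True P_in[OF x(1)]] P(3)[OF x(1)] by (simp add: z_def)
  next
    case False
    have "exp (of_real t * c q) = of_real (exp (- t))" using False by (simp add: c_def flip: exp_of_real)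
    then show ?thesis using False V(4)[OF x(1)] u_flow[OF x(1)] by (auto simp: z_def)
  qed
  have z_cont: "continuous_map X euclidean (\<lambda>x. z x q)" if "q < ?n" for q
  proof -
    have r: "continuous_map X euclidean (\<lambda>x. complex_of_real (h x))" if "continuous_map X euclideanreal h" for h
      using continuous_map_compose[OF that, of euclidean complex_of_real] by (simp add: o_def continuous_on_of_real)
    show ?thesis
    proof (cases "q < m")
      case True
      from continuous_map_compose[OF P(1) f(1)[OF True]] show ?thesis using True by (simp add: z_def o_def)
    next
      case False
      then show ?thesis using r[OF V(1)] r[OF u_cont[of "q - Suc m"]] by (cases "q = m") (simp_all add: z_def)
    qed
  qed
  have "inj_on (\<lambda>x. realify ?n (z x)) (topspace X)"
  proof (rule inj_onI)
    fix x y assume xy: "x \<in> topspace X" "y \<in> topspace X" and eq: "realify ?n (z x) = realify ?n (z y)"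
    have zeq: "z x q = z y q" if "q < ?n" for q using realify_inj[OF eq that] .
    have Veq: "V x = V y" using zeq[of m] by (simp add: z_def)
    show "x = y"
    proof (cases "V x = 0")
      case True
      then have A: "x \<in> A" "y \<in> A" using V(3)[OF xy(1)] V(3)[OF xy(2)] Veq True by auto
      have "f j x = f j y" if "j < m" for j using zeq[of j] that P(2) A by (simp add: z_def)
      then show ?thesis using f(3) A by blast
    next
      case False
      then have pos: "V x > 0" using V(2)[OF xy(1)] by simp
      let ?x = "\<Phi> (ln (V x)) x" and ?y = "\<Phi> (ln (V x)) y"
      have "e ?x i = e ?y i" for i
      proof (cases "i < N")
        case True
        have "u i x = u i y" using zeq[of "Suc m + i"] True by (simp add: z_def)
        then show ?thesis using pos Veq by (simp add: u_def)
      next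
        case False
        then show ?thesis using e(3) by simp
      qed
      then have "e ?x = e ?y" by blast
      moreover have "?x \<in> C" "?y \<in> C" using late_in_C[OF xy(1)] late_in_C[OF xy(2)] pos Veq by auto
      ultimately have "?x = ?y" using e(2) by (simp add: inj_on_def)
      then have "\<Phi> (- ln (V x)) ?x = \<Phi> (- ln (V x)) ?y" by simp
      then show ?thesis using flow_add[OF xy(1), of "- ln (V x)" "ln (V x)"] flow_add[OF xy(2), of "- ln (V x)" "ln (V x)"] xy
        by simp
    qed
  qed
  then show ?thesis
    using linearizing_from_eigenfunctions[of X ?n z \<Phi> c, OF z_flow] realify_continuous[of ?n X z, OF z_cont] by blast
qed

end

section \<open>From frequencies to a torus action on \<open>A\<close>\<close>

text \<open>Coefficients must be integers to serve as weights of characters. If a multiple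
  \<open>q * \<omega> m\<close> is an integral combination, the basis is divided by \<open>q\<close>
  and the old coefficients are multiplied by \<open>q\<close>; otherwise \<open>\<omega> m\<close>
  joins the basis.\<close>

lemma rational_basis:
  fixes \<omega> :: "nat \<Rightarrow> real"
  shows "\<exists>l (\<nu> :: nat \<Rightarrow> real) (a :: nat \<Rightarrow> nat \<Rightarrow> int). (\<forall>j<m. \<omega> j = (\<Sum>k<l. of_int (a j k) * \<nu> k)) \<and>
    (\<forall>c :: nat \<Rightarrow> int. (\<Sum>k<l. of_int (c k) * \<nu> k) = 0 \<longrightarrow> (\<forall>k<l. c k = 0))"
proof (induction m)
  case 0
  then show ?case by (intro exI[of _ 0]) simp
next
  case (Suc m)
  then obtain l and \<nu> :: "nat \<Rightarrow> real" and a :: "nat \<Rightarrow> nat \<Rightarrow> int" where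
    a: "\<And>j. j < m \<Longrightarrow> \<omega> j = (\<Sum>k<l. of_int (a j k) * \<nu> k)"
    and ind: "\<And>c :: nat \<Rightarrow> int. (\<Sum>k<l. of_int (c k) * \<nu> k) = 0 \<Longrightarrow> \<forall>k<l. c k = 0"
    by auto
  show ?case
  proof (cases "\<exists>q (c :: nat \<Rightarrow> int). q \<noteq> 0 \<and> of_int q * \<omega> m = (\<Sum>k<l. of_int (c k) * \<nu> k)")
    case True
    then obtain q and c :: "nat \<Rightarrow> int" where q: "q \<noteq> 0" "of_int q * \<omega> m = (\<Sum>k<l. of_int (c k) * \<nu> k)" by blast
    define \<nu>' where "\<nu>' k = \<nu> k / of_int q" for k
    define a' where "a' j k = (if j = m then c k else q * a j k)" for j k
    show ?thesis
    proof (intro exI[of _ l] exI[of _ \<nu>'] exI[of _ a'] conjI allI impI)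
      fix j assume "j < Suc m"
      show "\<omega> j = (\<Sum>k<l. of_int (a' j k) * \<nu>' k)"
      proof (cases "j = m")
        case True
        have "(\<Sum>k<l. of_int (a' j k) * \<nu>' k) = (\<Sum>k<l. of_int (c k) * \<nu> k) / of_int q"
          using True by (simp add: a'_def \<nu>'_def sum_divide_distrib)
        then show ?thesis using True q(1) by (simp add: q(2)[symmetric])
      next
        case False
        then have "\<omega> j = (\<Sum>k<l. of_int (a j k) * \<nu> k)" using a \<open>j < Suc m\<close> by simp
        also have "\<dots> = (\<Sum>k<l. of_int (a' j k) * \<nu>' k)"
          using False q(1) by (intro sum.cong) (auto simp: a'_def \<nu>'_def)
        finally show ?thesis .
      qed
    next
      fix c' :: "nat \<Rightarrow> int" and k assume z: "(\<Sum>k<l. of_int (c' k) * \<nu>' k) = 0" and k: "k < l"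
      have "(\<Sum>k<l. of_int (c' k) * \<nu> k) = of_int q * (\<Sum>k<l. of_int (c' k) * \<nu>' k)"
        using q(1) by (simp add: \<nu>'_def sum_distrib_left)
      then show "c' k = 0" using ind[of c'] z k by simp
    qed
  next
    case False
    define \<nu>' where "\<nu>' = \<nu>(l := \<omega> m)"
    define a' where "a' j k = (if j = m then (if k = l then 1 else 0) else if k = l then 0 else a j k)" for j k
    show ?thesis
    proof (intro exI[of _ "Suc l"] exI[of _ \<nu>'] exI[of _ a'] conjI allI impI)
      fix j assume j: "j < Suc m"
      show "\<omega> j = (\<Sum>k<Suc l. of_int (a' j k) * \<nu>' k)"
        using a[of j] j by (cases "j = m") (auto simp: a'_def \<nu>'_def intro!: sum.cong)
    next
      fix c :: "nat \<Rightarrow> int" and k assume z: "(\<Sum>k<Suc l. of_int (c k) * \<nu>' k) = 0" and k: "k < Suc l"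
      have z': "(\<Sum>k<l. of_int (c k) * \<nu> k) + of_int (c l) * \<omega> m = 0" using z by (simp add: \<nu>'_def)
      have "c l = 0"
      proof (rule ccontr)
        assume "c l \<noteq> 0"
        moreover have "of_int (- c l) * \<omega> m = (\<Sum>k<l. of_int (c k) * \<nu> k)" using z' by simp
        ultimately show False using False by (metis neg_equal_0_iff_equal)
      qed
      then show "c k = 0" using ind[of c] z' k by (cases "k = l") auto
    qed
  qed
qed

text \<open>Independence of the indexed family is converted into injectivity plus independence of
  the set of values over the integers, the form in which Kronecker's theorem is stated.\<close>

lemma kronecker_density:
  fixes \<nu> \<theta> :: "nat \<Rightarrow> real"
  assumes ind: "\<And>c :: nat \<Rightarrow> int. (\<Sum>k<l. of_int (c k) * \<nu> k) = 0 \<Longrightarrow> \<forall>k<l. c k = 0" and e: "e > 0"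
  obtains t h where "\<And>i. i < l \<Longrightarrow> \<bar>t * \<nu> i - of_int (h i) - \<theta> i\<bar> < e"
proof -
  interpret Modules.module "(\<lambda>r. (*) (real_of_int r))"
    by (simp add: Modules.module.intro distrib_left mult.commute)
  have inj: "inj_on \<nu> {..<l}"
  proof (rule inj_onI, rule ccontr)
    fix i j assume ij: "i \<in> {..<l}" "j \<in> {..<l}" "\<nu> i = \<nu> j" "i \<noteq> j"
    define c :: "nat \<Rightarrow> int" where "c k = (if k = i then 1 else 0) - (if k = j then 1 else 0)" for k
    have "(\<Sum>k<l. of_int (c k) * \<nu> k) = (\<Sum>k<l. if k = i then \<nu> k else 0) - (\<Sum>k<l. if k = j then \<nu> k else 0)"
      unfolding sum_subtractf[symmetric] by (intro sum.cong) (auto simp: c_def)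
    also have "\<dots> = 0" using ij by simp
    finally have "c i = 0" using ind[of c] ij by simp
    then show False using ij by (simp add: c_def)
  qed
  have "independent (\<nu> ` {..<l})"
  proof
    assume "dependent (\<nu> ` {..<l})"
    then obtain t u where t: "finite t" "t \<subseteq> \<nu> ` {..<l}" "(\<Sum>v\<in>t. real_of_int (u v) * v) = 0" "\<exists>v\<in>t. u v \<noteq> 0"
      unfolding dependent_explicit by blast
    define c where "c k = (if \<nu> k \<in> t then u (\<nu> k) else 0)" for k
    have "(\<Sum>k<l. of_int (c k) * \<nu> k) = (\<Sum>v\<in>\<nu> ` {..<l}. (if v \<in> t then real_of_int (u v) else 0) * v)"
      unfolding sum.reindex[OF inj] by (intro sum.cong) (auto simp: c_def)
    also have "\<dots> = (\<Sum>v\<in>t. real_of_int (u v) * v)"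
      using t(2) by (intro sum.mono_neutral_cong_right) auto
    finally have c0: "\<forall>k<l. c k = 0" using ind[of c] t(3) by simp
    obtain v where v: "v \<in> t" "u v \<noteq> 0" using t(4) by blast
    then obtain k where k: "k < l" "v = \<nu> k" using t(2) by auto
    have "c k = u v" using v(1) k(2) by (simp add: c_def)
    then show False using c0 k(1) v(2) by simp
  qed
  then show thesis using Kronecker_thm_1[of \<nu> l e \<theta>] inj e that by metis
qed

context attracting_flow
begin

text \<open>A point of \<open>A\<close> is encoded by its eigenfunction values, on which the torus
  acts by the characters \<open>c j\<close>. Once \<open>reach\<close> shows that the encoded set is
  preserved, the action laws, continuity and orbit types are all read off the characters.\<close>

lemma torus_action_from_frequencies:
  assumes "linear_coordinates m f \<omega>"
  shows "\<exists>l \<Theta>. torus_action l (subtopology X A) \<Theta> \<and>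
    finitely_many_orbit_types l (subtopology X A) \<Theta> \<and> one_parameter_subgroup l (subtopology X A) \<Theta> \<Phi>"
proof -
  have f: "\<And>j. j < m \<Longrightarrow> continuous_map (subtopology X A) euclidean (f j)"
    "\<And>j t a. \<lbrakk>j < m; a \<in> A\<rbrakk> \<Longrightarrow> f j (\<Phi> t a) = cis (\<omega> j * t) * f j a"
    "\<And>a b. \<lbrakk>a \<in> A; b \<in> A; \<And>j. j < m \<Longrightarrow> f j a = f j b\<rbrakk> \<Longrightarrow> a = b"
    using assms unfolding linear_coordinates_def by simp_all
  have topA: "topspace (subtopology X A) = A" using A_subset by auto
  obtain l and \<nu> :: "nat \<Rightarrow> real" and c :: "nat \<Rightarrow> nat \<Rightarrow> int" where
    c: "\<And>j. j < m \<Longrightarrow> \<omega> j / (2 * pi) = (\<Sum>k<l. of_int (c j k) * \<nu> k)"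
    and ind: "\<And>c :: nat \<Rightarrow> int. (\<Sum>k<l. of_int (c k) * \<nu> k) = 0 \<Longrightarrow> \<forall>k<l. c k = 0"
    using rational_basis[of m "\<lambda>j. \<omega> j / (2 * pi)"] by auto
  have freq: "cis (\<omega> j * t) = torus_char l (c j) (\<lambda>k. t * \<nu> k)" if "j < m" for j t
  proof -
    have "\<omega> j = 2 * pi * (\<Sum>k<l. of_int (c j k) * \<nu> k)" using c[OF that] by (simp add: field_simps)
    then show ?thesis by (simp add: torus_char_def sum_distrib_left sum_distrib_right mult_ac)
  qed
  define G where "G a j = (if j < m then f j a else 0)" for a j
  have G_cont: "continuous_map (subtopology X A) euclidean G"
    unfolding continuous_map_euclidean_componentwise G_def using f(1) by simp
  have G_inj: "inj_on G A"
  proof (rule inj_onI)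
    fix a b assume ab: "a \<in> A" "b \<in> A" and eq: "G a = G b"
    have "f j a = f j b" if "j < m" for j using fun_cong[OF eq, of j] that by (simp add: G_def)
    then show "a = b" using f(3) ab by blast
  qed
  have cptA: "compact_space (subtopology X A)" using A_compact by (simp add: compact_space_subtopology)
  have GA_cpt: "compact (G ` A)"
    using image_compactin[OF cptA[unfolded compact_space_def] G_cont] topA by simp
  \<comment> \<open>Times \<open>t i\<close> for which \<open>t i * \<nu>\<close> approaches
    \<open>\<theta>\<close> modulo integers move \<open>a\<close> within \<open>A\<close>; the value
    tuples converge to the required one, and the set of tuples is closed.\<close>
  have reach: "\<exists>b\<in>A. \<forall>j<m. f j b = torus_char l (c j) \<theta> * f j a" if a: "a \<in> A" for a \<theta>
  proof -
    have "\<exists>p. \<forall>k<l. \<bar>fst p * \<nu> k - of_int (snd p k) - \<theta> k\<bar> < 1 / real (Suc i)" for i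
    proof -
      have pos: "1 / real (Suc i) > 0" by simp
      obtain t h where "\<And>k. k < l \<Longrightarrow> \<bar>t * \<nu> k - of_int (h k) - \<theta> k\<bar> < 1 / real (Suc i)"
        using kronecker_density[OF ind pos, where \<theta> = \<theta>] by blast
      then show ?thesis by (intro exI[of _ "(t, h)"]) simp
    qed
    then obtain p where p: "\<And>i k. k < l \<Longrightarrow> \<bar>fst (p i) * \<nu> k - of_int (snd (p i) k) - \<theta> k\<bar> < 1 / real (Suc i)"
      by metis
    define t where "t i = fst (p i)" for i
    define h where "h i = snd (p i)" for i
    have th: "\<bar>t i * \<nu> k - of_int (h i k) - \<theta> k\<bar> < 1 / real (Suc i)" if "k < l" for i k
      using p[OF that] by (simp add: t_def h_def)
    define \<delta> where "\<delta> i k = t i * \<nu> k - of_int (h i k)" for i k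
    have \<delta>lim: "(\<lambda>i. \<delta> i k) \<longlonglongrightarrow> \<theta> k" if k: "k < l" for k
    proof -
      have "(\<lambda>i. 1 / real (Suc i)) \<longlonglongrightarrow> 0" using LIMSEQ_inverse_real_of_nat by (simp add: inverse_eq_divide)
      then have "(\<lambda>i. \<delta> i k - \<theta> k) \<longlonglongrightarrow> 0"
        by (rule Lim_null_comparison[rotated]) (use th[OF k] in \<open>auto simp: \<delta>_def less_imp_le intro!: always_eventually\<close>)
      then show ?thesis by (rule LIM_zero_cancel)
    qed
    have char: "torus_char l (c j) (\<lambda>k. t i * \<nu> k) = torus_char l (c j) (\<delta> i)" for i j
    proof -
      have "torus_char l (c j) (\<lambda>k. t i * \<nu> k) = torus_char l (c j) (\<lambda>k. of_int (h i k) + \<delta> i k)"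
        by (simp add: \<delta>_def)
      also have "\<dots> = torus_char l (c j) (\<lambda>k. of_int (h i k)) * torus_char l (c j) (\<delta> i)" by (rule torus_char_add)
      also have "torus_char l (c j) (\<lambda>k. of_int (h i k)) = 1" by (rule torus_char_int) simp
      finally show ?thesis by simp
    qed
    have fj: "f j (\<Phi> (t i) a) = torus_char l (c j) (\<delta> i) * f j a" if "j < m" for i j
      using f(2)[OF that a] freq[OF that] char by simp
    define w where "w j = (if j < m then torus_char l (c j) \<theta> * f j a else 0)" for j
    have lim: "(\<lambda>i. G (\<Phi> (t i) a)) \<longlonglongrightarrow> w"
    proof (rule tendsto_fun_coordinatewise)
      fix j
      have "(\<lambda>i. torus_char l (c j) (\<delta> i)) \<longlonglongrightarrow> torus_char l (c j) \<theta>"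
        unfolding torus_char_def cis_conv_exp by (intro tendsto_intros \<delta>lim) auto
      then show "(\<lambda>i. G (\<Phi> (t i) a) j) \<longlonglongrightarrow> w j"
        by (cases "j < m") (auto simp: G_def w_def fj intro!: tendsto_intros)
    qed
    have mem: "G (\<Phi> (t i) a) \<in> G ` A" for i using flow_A[OF a] by blast
    have "w \<in> G ` A"
      by (rule closed_sequentially[OF compact_imp_closed[OF GA_cpt] _ lim]) (rule mem)
    then obtain b where b: "b \<in> A" "w = G b" by blast
    have "f j b = torus_char l (c j) \<theta> * f j a" if "j < m" for j
      using fun_cong[OF b(2), of j] that by (simp add: w_def G_def)
    then show ?thesis using b(1) by blast
  qed
  \<comment> \<open>The character on cosets, through an arbitrary representative; representatives
    differ by integers, so the choice is harmless.\<close>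
  define \<chi>' where "\<chi>' j T = torus_char l (c j) (SOME \<theta>. \<theta> \<in> topspace (Euclidean_space l) \<and> T = torus_proj l \<theta>)" for j T
  have \<chi>': "\<chi>' j (torus_proj l \<theta>) = torus_char l (c j) \<theta>" if \<theta>: "\<theta> \<in> topspace (Euclidean_space l)" for j \<theta>
  proof -
    define \<eta> where "\<eta> = (SOME \<eta>. \<eta> \<in> topspace (Euclidean_space l) \<and> torus_proj l \<theta> = torus_proj l \<eta>)"
    have "\<eta> \<in> topspace (Euclidean_space l) \<and> torus_proj l \<theta> = torus_proj l \<eta>"
      unfolding \<eta>_def by (rule someI[of _ \<theta>]) (use \<theta> in simp)
    then have "\<forall>i. \<theta> i - \<eta> i \<in> \<int>" using torus_proj_eq_iff[OF \<theta>] by blast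
    then have "torus_char l (c j) (\<lambda>i. (\<theta> i - \<eta> i) + \<eta> i) = torus_char l (c j) \<eta>"
      unfolding torus_char_add using torus_char_int[of l "\<lambda>i. \<theta> i - \<eta> i" "c j"] by simp
    then show ?thesis by (simp add: \<chi>'_def \<eta>_def[symmetric])
  qed
  define \<Theta> where "\<Theta> T x = (SOME b. b \<in> A \<and> (\<forall>j<m. f j b = \<chi>' j T * f j x))" for T x
  have \<Theta>: "\<Theta> T x \<in> A" "\<And>j. j < m \<Longrightarrow> f j (\<Theta> T x) = \<chi>' j T * f j x"
    if T: "T \<in> carrier (torus_group l)" and x: "x \<in> A" for T x
  proof -
    obtain \<theta> where "\<theta> \<in> topspace (Euclidean_space l)" "T = torus_proj l \<theta>" using torus_proj_surj[OF T] .
    then have "\<exists>b. b \<in> A \<and> (\<forall>j<m. f j b = \<chi>' j T * f j x)" using reach[OF x, of \<theta>] \<chi>' by auto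
    from someI_ex[OF this] show "\<Theta> T x \<in> A" "\<And>j. j < m \<Longrightarrow> f j (\<Theta> T x) = \<chi>' j T * f j x"
      unfolding \<Theta>_def by auto
  qed
  have \<chi>'_one: "\<chi>' j \<one>\<^bsub>torus_group l\<^esub> = 1" for j
    unfolding torus_one by (subst \<chi>') (auto simp: topspace_Euclidean_space)
  have \<chi>'_mult: "\<chi>' j (S \<otimes>\<^bsub>torus_group l\<^esub> T) = \<chi>' j S * \<chi>' j T"
    and mult_closed: "S \<otimes>\<^bsub>torus_group l\<^esub> T \<in> carrier (torus_group l)"
    if S: "S \<in> carrier (torus_group l)" and T: "T \<in> carrier (torus_group l)" for j S T
  proof -
    obtain \<theta> where \<theta>: "\<theta> \<in> topspace (Euclidean_space l)" "S = torus_proj l \<theta>" using torus_proj_surj[OF S] .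
    obtain \<eta> where \<eta>: "\<eta> \<in> topspace (Euclidean_space l)" "T = torus_proj l \<eta>" using torus_proj_surj[OF T] .
    have sum: "(\<lambda>i. \<theta> i + \<eta> i) \<in> topspace (Euclidean_space l)" using \<theta>(1) \<eta>(1) by (simp add: topspace_Euclidean_space)
    have eq: "S \<otimes>\<^bsub>torus_group l\<^esub> T = torus_proj l (\<lambda>i. \<theta> i + \<eta> i)"
      using torus_proj_add[OF \<theta>(1) \<eta>(1)] \<theta>(2) \<eta>(2) by simp
    show "\<chi>' j (S \<otimes>\<^bsub>torus_group l\<^esub> T) = \<chi>' j S * \<chi>' j T"
    proof -
      have "\<chi>' j S = torus_char l (c j) \<theta>" "\<chi>' j T = torus_char l (c j) \<eta>"
        using \<chi>'[OF \<theta>(1)] \<chi>'[OF \<eta>(1)] \<theta>(2) \<eta>(2) by simp_all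
      then show ?thesis by (simp add: eq \<chi>'[OF sum] torus_char_add)
    qed
    show "S \<otimes>\<^bsub>torus_group l\<^esub> T \<in> carrier (torus_group l)" unfolding eq by (rule torus_proj_carrier[OF sum])
  qed
  have \<chi>'_cont: "continuous_map (torus_topology l) euclidean (\<chi>' j)" for j
    unfolding torus_topology_def
  proof (rule continuous_compose_quotient_map[OF quotient_map_quotient_topology])
    have "continuous_on (topspace (Euclidean_space l)) (torus_char l (c j))"
      unfolding torus_char_def cis_conv_exp
      by (intro continuous_intros continuous_on_subset[OF continuous_on_product_coordinates]) auto
    then have "continuous_map (Euclidean_space l) euclidean (torus_char l (c j))"
      by (simp add: continuous_map_Euclidean_space_iff)
    then show "continuous_map (Euclidean_space l) euclidean (\<chi>' j \<circ> torus_proj l)"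
      by (rule continuous_map_eq) (simp add: \<chi>')
  qed
  have "torus_action l (subtopology X A) \<Theta>"
    unfolding torus_action_def continuous_action_def topA
  proof (intro conjI ballI)
    fix y assume y: "y \<in> A"
    have one: "\<one>\<^bsub>torus_group l\<^esub> \<in> carrier (torus_group l)"
      unfolding torus_one by (rule torus_proj_carrier) (simp add: topspace_Euclidean_space)
    show "\<Theta> \<one>\<^bsub>torus_group l\<^esub> y = y"
      using \<Theta>[OF one y] y by (intro f(3)) (auto simp: \<chi>'_one)
    fix S T assume ST: "S \<in> carrier (torus_group l)" "T \<in> carrier (torus_group l)"
    show "\<Theta> (S \<otimes>\<^bsub>torus_group l\<^esub> T) y = \<Theta> S (\<Theta> T y)"
      using \<Theta>[OF mult_closed[OF ST] y] \<Theta>[OF ST(2) y] \<Theta>[OF ST(1) \<Theta>(1)[OF ST(2) y]] \<chi>'_mult[OF ST]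
      by (intro f(3)) (auto simp: mult.assoc)
  next
    have "homeomorphic_map (subtopology X A) (top_of_set (G ` A)) G"
      using G_cont cptA G_inj A_subset
      by (intro continuous_imp_homeomorphic_map)
        (auto simp: topA Hausdorff_space_subtopology continuous_map_in_subtopology intro: inj_on_subset)
    then obtain g where g: "homeomorphic_maps (subtopology X A) (top_of_set (G ` A)) G g"
      using homeomorphic_map_maps by blast
    have gG: "g (G a) = a" if "a \<in> A" for a using g that A_topspace[OF that] by (simp add: homeomorphic_maps_def topA)
    let ?P = "prod_topology (torus_topology l) (subtopology X A)"
    \<comment> \<open>The action seen through the embedding \<open>G\<close>, where it is visibly
      continuous.\<close>
    define H where "H z j = (if j < m then \<chi>' j (fst z) * f j (snd z) else 0)" for z j
    have Hz: "H z = G (\<Theta> (fst z) (snd z))" if z: "z \<in> topspace ?P" for z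
    proof -
      have "fst z \<in> carrier (torus_group l)" "snd z \<in> A"
        using z by (auto simp: topspace_torus_topology topA)
      from \<Theta>(2)[OF this] show ?thesis by (auto simp: H_def G_def)
    qed
    have Hin: "H z \<in> G ` A" if z: "z \<in> topspace ?P" for z
      unfolding Hz[OF z] using \<Theta>(1)[of "fst z" "snd z"] z by (auto simp: topspace_torus_topology topA)
    have "continuous_map ?P euclidean (\<lambda>z. H z j)" for j
    proof (cases "j < m")
      case True
      have "continuous_map ?P euclidean (\<lambda>z. \<chi>' j (fst z))" "continuous_map ?P euclidean (\<lambda>z. f j (snd z))"
        using continuous_map_compose[OF continuous_map_fst \<chi>'_cont[of j], of "subtopology X A"]
          continuous_map_compose[OF continuous_map_snd f(1)[OF True], of "torus_topology l"]
        by (simp_all add: o_def)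
      then show ?thesis using True by (simp add: H_def continuous_map_atin tendsto_mult)
    next
      case False
      then show ?thesis by (simp add: H_def)
    qed
    then have "continuous_map ?P euclidean H" by (simp add: continuous_map_euclidean_componentwise)
    then have "continuous_map ?P (top_of_set (G ` A)) H"
      using Hin by (auto simp: continuous_map_in_subtopology)
    moreover have "continuous_map (top_of_set (G ` A)) (subtopology X A) g" using g by (simp add: homeomorphic_maps_def)
    ultimately have "continuous_map ?P (subtopology X A) (g \<circ> H)" by (rule continuous_map_compose)
    then show "continuous_map ?P (subtopology X A) (\<lambda>(g, y). \<Theta> g y)"
    proof (rule continuous_map_eq)
      fix z assume z: "z \<in> topspace ?P"
      then have "\<Theta> (fst z) (snd z) \<in> A"
        using \<Theta>(1)[of "fst z" "snd z"] by (auto simp: topspace_torus_topology topA)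
      then show "(g \<circ> H) z = (case z of (g, y) \<Rightarrow> \<Theta> g y)" using Hz[OF z] gG by (simp add: case_prod_unfold)
    qed
  qed
  moreover have "finitely_many_orbit_types l (subtopology X A) \<Theta>"
    unfolding finitely_many_orbit_types_def topA
  proof (rule finite_subset)
    \<comment> \<open>A stabilizer depends only on which eigenfunctions are nonzero at the point, so
      there are at most \<open>2 ^ m\<close> of them.\<close>
    let ?H = "\<lambda>J. {T \<in> carrier (torus_group l). \<forall>j\<in>J. \<chi>' j T = 1}"
    show "finite (?H ` Pow {..<m})" by simp
    have eqH: "{T \<in> carrier (torus_group l). \<Theta> T y = y} = ?H {j. j < m \<and> f j y \<noteq> 0}" if y: "y \<in> A" for y
    proof -
      have "\<Theta> T y = y \<longleftrightarrow> (\<forall>j\<in>{j. j < m \<and> f j y \<noteq> 0}. \<chi>' j T = 1)" if T: "T \<in> carrier (torus_group l)" for T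
      proof
        assume eq: "\<Theta> T y = y"
        show "\<forall>j\<in>{j. j < m \<and> f j y \<noteq> 0}. \<chi>' j T = 1"
        proof clarify
          fix j assume "j < m" "f j y \<noteq> 0"
          then show "\<chi>' j T = 1" using \<Theta>(2)[OF T y, of j] eq by simp
        qed
      next
        assume "\<forall>j\<in>{j. j < m \<and> f j y \<noteq> 0}. \<chi>' j T = 1"
        then have "f j (\<Theta> T y) = f j y" if "j < m" for j
          using \<Theta>(2)[OF T y that] that by (cases "f j y = 0") auto
        then show "\<Theta> T y = y" using f(3) \<Theta>(1)[OF T y] y by blast
      qed
      then show ?thesis by blast
    qed
    show "(\<lambda>y. {g \<in> carrier (torus_group l). \<Theta> g y = y}) ` A \<subseteq> ?H ` Pow {..<m}"
    proof (rule image_subsetI)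
      fix y assume y: "y \<in> A"
      show "{g \<in> carrier (torus_group l). \<Theta> g y = y} \<in> ?H ` Pow {..<m}"
        by (rule image_eqI[where x = "{j. j < m \<and> f j y \<noteq> 0}"], rule eqH[OF y]) auto
    qed
  qed
  moreover have "one_parameter_subgroup l (subtopology X A) \<Theta> \<Phi>"
    unfolding one_parameter_subgroup_def topA
  proof (intro bexI[of _ "trunc l \<nu>"] allI ballI)
    fix t y assume y: "y \<in> A"
    have tr: "(\<lambda>i. trunc l \<nu> i * t) \<in> topspace (Euclidean_space l)" by (simp add: trunc_def topspace_Euclidean_space)
    have "f j (\<Phi> t y) = f j (\<Theta> (torus_proj l (\<lambda>i. trunc l \<nu> i * t)) y)" if j: "j < m" for j
    proof -
      have "torus_char l (c j) (\<lambda>i. trunc l \<nu> i * t) = torus_char l (c j) (\<lambda>k. t * \<nu> k)"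
        by (rule torus_char_cong) (simp add: trunc_def)
      then show ?thesis
        using \<Theta>(2)[OF torus_proj_carrier[OF tr] y j] \<chi>'[OF tr] f(2)[OF j y] freq[OF j] by simp
    qed
    then show "\<Phi> t y = \<Theta> (torus_proj l (\<lambda>i. trunc l \<nu> i * t)) y"
      using f(3) flow_A[OF y] \<Theta>(1)[OF torus_proj_carrier[OF tr] y] by blast
  qed (rule trunc_in)
  ultimately show ?thesis by blast
qed

end

text \<open>The eigenfunctions are the Fourier coefficients \<open>g k \<omega> a\<close> of the
  orbit of \<open>a\<close>. They separate because summing them over the frequencies gives back
  \<open>F a\<close> at time 0.\<close>

lemma (in linearized_flow) eigenfunctions_on_A:
  assumes B: "B \<in> carrier_mat n n" and E: "E = (\<lambda>t k j. mat_exp (t \<cdot>\<^sub>m B) $$ (k, j))"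
  shows "\<exists>m f \<omega>. linear_coordinates m f \<omega>"
proof -
  obtain P c where P: "finite P" "P \<subseteq> A" "\<And>p. p \<in> P \<Longrightarrow> linear_form {..<n} F (c p)"
    "\<And>t x k. \<lbrakk>x \<in> A; k < n\<rbrakk> \<Longrightarrow> F (\<Phi> t x) k = (\<Sum>p\<in>P. c p x * F (\<Phi> t p) k)"
    by (rule finite_orbit_basis[OF A_subset]) (rule that)
  obtain M where M: "\<And>x k. x \<in> A \<Longrightarrow> \<bar>F x k\<bar> \<le> M" using F_bounded_compact[OF A_compact] by metis
  have trig: "trig_poly (\<lambda>t. of_real (F (\<Phi> t p) k))" if p: "p \<in> A" and k: "k < n" for p k
  proof -
    have eq: "(\<Sum>j<n. mat_exp (t \<cdot>\<^sub>m B) $$ (k, j) * F p j) = F (\<Phi> t p) k" if "k < n" for k t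
      using F_flow[OF A_topspace[OF p] that] by (simp add: E)
    have "\<exists>M. \<forall>t. \<bar>\<Sum>j<n. mat_exp (t \<cdot>\<^sub>m B) $$ (k, j) * F p j\<bar> \<le> M" if "k < n" for k
      unfolding eq[OF that] using M[OF flow_A[OF p]] by blast
    from bounded_mat_exp_orbit_trig_poly[OF B this k] show ?thesis unfolding eq[OF k] .
  qed
  have "\<forall>p k. \<exists>\<Omega> b. p \<in> A \<longrightarrow> k < n \<longrightarrow> finite \<Omega> \<and> (\<forall>t. complex_of_real (F (\<Phi> t p) k) = (\<Sum>\<omega>\<in>\<Omega>. b \<omega> * cis (\<omega> * t)))"
    using trig unfolding trig_poly_def by blast
  then obtain \<Omega>' b where b: "\<And>p k. \<lbrakk>p \<in> A; k < n\<rbrakk> \<Longrightarrow> finite (\<Omega>' p k)"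
      "\<And>p k t. \<lbrakk>p \<in> A; k < n\<rbrakk> \<Longrightarrow> complex_of_real (F (\<Phi> t p) k) = (\<Sum>\<omega>\<in>\<Omega>' p k. b p k \<omega> * cis (\<omega> * t))"
    by metis
  define \<Omega> where "\<Omega> = (\<Union>p\<in>P. \<Union>k\<in>{..<n}. \<Omega>' p k)"
  have fin: "finite \<Omega>" unfolding \<Omega>_def using P(1,2) b(1) by (intro finite_UN_I) auto
  define b' where "b' p k \<omega> = (if \<omega> \<in> \<Omega>' p k then b p k \<omega> else 0)" for p k \<omega>
  have b': "complex_of_real (F (\<Phi> t p) k) = (\<Sum>\<omega>\<in>\<Omega>. b' p k \<omega> * cis (\<omega> * t))" if p: "p \<in> P" and k: "k < n" for p k t
  proof -
    have "p \<in> A" using p P(2) by blast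
    have sub: "\<Omega>' p k \<subseteq> \<Omega>" unfolding \<Omega>_def using p k by blast
    show ?thesis unfolding b(2)[OF \<open>p \<in> A\<close> k] b'_def by (rule sum_extend[OF fin sub])
  qed
  \<comment> \<open>Defined through the basis orbits, so that the finite set of frequencies serves
    all of \<open>A\<close> and continuity in \<open>a\<close> follows from that of
    \<open>c p\<close>.\<close>
  define g where "g k \<omega> a = (\<Sum>p\<in>P. of_real (c p a) * b' p k \<omega>)" for k \<omega> a
  have gF: "complex_of_real (F (\<Phi> t a) k) = (\<Sum>\<omega>\<in>\<Omega>. g k \<omega> a * cis (\<omega> * t))" if a: "a \<in> A" and k: "k < n" for a k t
  proof -
    have "complex_of_real (F (\<Phi> t a) k) = (\<Sum>p\<in>P. of_real (c p a) * (\<Sum>\<omega>\<in>\<Omega>. b' p k \<omega> * cis (\<omega> * t)))"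
      using P(4)[OF a k, of t] b'[OF _ k] by simp
    also have "\<dots> = (\<Sum>\<omega>\<in>\<Omega>. g k \<omega> a * cis (\<omega> * t))"
      unfolding g_def sum_distrib_left sum_distrib_right by (subst sum.swap) (simp add: mult.assoc)
    finally show ?thesis .
  qed
  \<comment> \<open>Expanding the orbit of \<open>a\<close> at time \<open>t + s\<close> in two ways
    and comparing coefficients, which are unique, gives the eigenfunction equation.\<close>
  have g_flow: "g k \<omega> (\<Phi> s a) = cis (\<omega> * s) * g k \<omega> a" if a: "a \<in> A" and k: "k < n" and \<omega>: "\<omega> \<in> \<Omega>" for a k \<omega> s
  proof -
    have "(\<Sum>\<omega>\<in>\<Omega>. (g k \<omega> (\<Phi> s a) - cis (\<omega> * s) * g k \<omega> a) * cis (\<omega> * t)) = 0" for t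
    proof -
      have "(\<Sum>\<omega>\<in>\<Omega>. g k \<omega> (\<Phi> s a) * cis (\<omega> * t)) = complex_of_real (F (\<Phi> (t + s) a) k)"
        using gF[OF flow_A[OF a] k] flow_add[OF A_topspace[OF a]] by simp
      also have "\<dots> = (\<Sum>\<omega>\<in>\<Omega>. cis (\<omega> * s) * g k \<omega> a * cis (\<omega> * t))"
        unfolding gF[OF a k] by (intro sum.cong) (auto simp: cis_mult distrib_left mult_ac add.commute)
      finally show ?thesis by (simp add: left_diff_distrib sum_subtractf)
    qed
    from trig_poly_independent[OF fin this \<omega>] show ?thesis by simp
  qed
  have "finite ({..<n} \<times> \<Omega>)" using fin by simp
  then obtain m :: nat and idx where idx: "{..<n} \<times> \<Omega> = idx ` {j. j < m}"
    using finite_imp_nat_seg_image_inj_on by metis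
  have idx_in: "fst (idx j) < n" "snd (idx j) \<in> \<Omega>" if "j < m" for j
  proof -
    have "idx j \<in> {..<n} \<times> \<Omega>" using idx that by blast
    then show "fst (idx j) < n" "snd (idx j) \<in> \<Omega>" by auto
  qed
  have "linear_coordinates m (\<lambda>j. g (fst (idx j)) (snd (idx j))) (\<lambda>j. snd (idx j))"
    unfolding linear_coordinates_def
  proof (intro conjI allI impI ballI)
    fix j assume j: "j < m"
    have "continuous_map X euclidean (\<lambda>a. complex_of_real (c p a) * b' p k \<omega>)" if "p \<in> P" for p k \<omega>
      using continuous_map_compose[OF linear_form_F_cont[OF P(3)[OF that]], of euclidean "\<lambda>r. complex_of_real r * b' p k \<omega>"]
      by (simp add: o_def continuous_on_mult continuous_on_of_real)
    then have "continuous_map X euclidean (g k \<omega>)" for k \<omega>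
      unfolding g_def using P(1) by (intro continuous_map_sum) auto
    then show "continuous_map (subtopology X A) euclidean (g (fst (idx j)) (snd (idx j)))"
      by (rule continuous_map_from_subtopology)
  next
    fix j t a assume j: "j < m" and a: "a \<in> A"
    show "g (fst (idx j)) (snd (idx j)) (\<Phi> t a) = cis (snd (idx j) * t) * g (fst (idx j)) (snd (idx j)) a"
      using g_flow[OF a idx_in[OF j]] .
  next
    fix a a' assume a: "a \<in> A" "a' \<in> A" and eq: "\<forall>j<m. g (fst (idx j)) (snd (idx j)) a = g (fst (idx j)) (snd (idx j)) a'"
    have eq': "g k \<omega> a = g k \<omega> a'" if "k < n" "\<omega> \<in> \<Omega>" for k \<omega>
    proof -
      have "(k, \<omega>) \<in> idx ` {j. j < m}" unfolding idx[symmetric] using that by simp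
      then obtain j where "j < m" "idx j = (k, \<omega>)" by force
      then show ?thesis using eq by force
    qed
    show "a = a'"
    proof (rule F_eqI[OF A_topspace[OF a(1)] A_topspace[OF a(2)]])
      fix k assume k: "k < n"
      have "complex_of_real (F (\<Phi> 0 a) k) = complex_of_real (F (\<Phi> 0 a') k)"
        unfolding gF[OF a(1) k] gF[OF a(2) k] using eq'[OF k] by (intro sum.cong) auto
      then show "F a k = F a' k" using A_topspace a by simp
    qed
  qed
  then show ?thesis by blast
qed

section \<open>Passage to \<open>Euclidean_space\<close> and assembly\<close>

lemma mat_exp_mult_vec_entry:
  assumes "B \<in> carrier_mat n n" "k < n"
  shows "(mat_exp (t \<cdot>\<^sub>m B) *\<^sub>v Matrix.vec n u) $ k = (\<Sum>j<n. mat_exp (t \<cdot>\<^sub>m B) $$ (k, j) * u j)"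
  using assms by (simp add: mat_exp_def scalar_prod_def lessThan_atLeast0)

lemma continuous_map_Euclidean_space_euclidean:
  "continuous_map X (Euclidean_space n) F \<longleftrightarrow>
     continuous_map X euclidean F \<and> (\<forall>x\<in>topspace X. \<forall>i\<ge>n. F x i = 0)"
  unfolding Euclidean_space_def
  by (auto simp: continuous_map_in_subtopology euclidean_product_topology)

lemma compactin_Euclidean_space:
  "compactin (Euclidean_space n) K \<longleftrightarrow> compact K \<and> K \<subseteq> topspace (Euclidean_space n)"
  unfolding Euclidean_space_def by (auto simp: compactin_subtopology euclidean_product_topology)

lemma embedding_map_Euclidean_space:
  assumes "F \<in> topspace X \<rightarrow> topspace (Euclidean_space n)"
  shows "embedding_map X (Euclidean_space n) F \<longleftrightarrow> embedding_map X euclidean F"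
proof -
  have "subtopology (Euclidean_space n) (F ` topspace X) = subtopology euclidean (F ` topspace X)"
    using assms unfolding Euclidean_space_def
    by (simp add: subtopology_subtopology euclidean_product_topology Int_absorb1 image_subset_iff Pi_iff topspace_Euclidean_space)
  then show ?thesis by (simp add: embedding_map_def)
qed

lemma (in attracting_flow) linearized_flowI:
  assumes lin: "linearizing X \<Phi> n F" and F: "continuous_map X (Euclidean_space n) F" "inj_on F (topspace X)"
  obtains B where "B \<in> carrier_mat n n"
    "linearized_flow X \<Phi> A n F (\<lambda>t k j. mat_exp (t \<cdot>\<^sub>m B) $$ (k, j))"
proof -
  obtain B where B: "B \<in> carrier_mat n n" "\<And>t x. x \<in> topspace X \<Longrightarrow>
      Matrix.vec n (F (\<Phi> t x)) = mat_exp (t \<cdot>\<^sub>m B) *\<^sub>v Matrix.vec n (F x)"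
    using lin unfolding linearizing_def by blast
  have "linearized_flow X \<Phi> A n F (\<lambda>t k j. mat_exp (t \<cdot>\<^sub>m B) $$ (k, j))"
  proof unfold_locales
    show "continuous_map X euclidean F" "\<And>x k. \<lbrakk>x \<in> topspace X; n \<le> k\<rbrakk> \<Longrightarrow> F x k = 0"
      using F(1) by (auto simp: continuous_map_Euclidean_space_euclidean)
    show "inj_on F (topspace X)" by fact
    fix t x k assume x: "x \<in> topspace X" and k: "k < n"
    have "F (\<Phi> t x) k = Matrix.vec n (F (\<Phi> t x)) $ k" using k by simp
    also have "\<dots> = (\<Sum>j<n. mat_exp (t \<cdot>\<^sub>m B) $$ (k, j) * F x j)"
      unfolding B(2)[OF x] by (rule mat_exp_mult_vec_entry[OF B(1) k])
    finally show "F (\<Phi> t x) k = (\<Sum>j<n. mat_exp (t \<cdot>\<^sub>m B) $$ (k, j) * F x j)" .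
  qed
  then show thesis using that B(1) by blast
qed

theorem theorem3:
  fixes X :: "'a topology" and M :: "'m topology" and S :: "'m set"
    and \<Phi> :: "real \<Rightarrow> 'a \<Rightarrow> 'a" and A :: "'a set"
  assumes "locally_compact_space X"
    and "topological_manifold M"
    and "S \<subseteq> topspace M"
    and "X homeomorphic_space subtopology M S"
    and "continuous_flow X \<Phi>"
    and "compact_invariant X \<Phi> A"
    and "globally_asymptotically_stable X \<Phi> A"
  shows "(linearizable_by_embedding X \<Phi> \<longleftrightarrow>
            has_asymptotic_phase X \<Phi> A \<and>
            (\<exists>l \<Theta>. torus_action l (subtopology X A) \<Theta> \<and>
                   finitely_many_orbit_types l (subtopology X A) \<Theta> \<and>
                   one_parameter_subgroup l (subtopology X A) \<Theta> \<Phi>)) \<and>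
         (\<forall>n F. continuous_map X (Euclidean_space n) F \<and> inj_on F (topspace X) \<and>
                linearizing X \<Phi> n F \<longrightarrow>
                compact_preimages X (Euclidean_space n) F \<and>
                embedding_map X (Euclidean_space n) F)"
proof -
  have hd: "Hausdorff_space X"
    using assms(2) homeomorphic_Hausdorff_space[OF assms(4)]
    by (simp add: topological_manifold_def Hausdorff_space_subtopology)
  interpret attracting_flow X \<Phi> A by unfold_locales (fact assms hd)+
  have embeds: "\<exists>N (e :: 'a \<Rightarrow> nat \<Rightarrow> real). continuous_map X euclidean e \<and> inj_on e C \<and> (\<forall>x. \<forall>i\<ge>N. e x i = 0)"
    if "compactin X C" for C
    using compact_subset_of_manifold_embeds[OF completely_regular hd assms(2,4) that] by metis
  have proper: "compact_preimages X (Euclidean_space n) F \<and> embedding_map X (Euclidean_space n) F"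
    if F: "continuous_map X (Euclidean_space n) F" "inj_on F (topspace X)" "linearizing X \<Phi> n F" for n F
  proof -
    obtain B where "linearized_flow X \<Phi> A n F (\<lambda>t k j. mat_exp (t \<cdot>\<^sub>m B) $$ (k, j))"
      using linearized_flowI[OF F(3,1,2)] by blast
    then interpret linearized_flow X \<Phi> A n F "\<lambda>t k j. mat_exp (t \<cdot>\<^sub>m B) $$ (k, j)" .
    show ?thesis
      using preimage_compact embedding embedding_map_Euclidean_space[of F X n] continuous_map_funspace[OF F(1)]
      by (auto simp: compact_preimages_def compactin_Euclidean_space)
  qed
  have "has_asymptotic_phase X \<Phi> A \<and> (\<exists>l \<Theta>. torus_action l (subtopology X A) \<Theta> \<and>
      finitely_many_orbit_types l (subtopology X A) \<Theta> \<and> one_parameter_subgroup l (subtopology X A) \<Theta> \<Phi>)"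
    if lin: "linearizable_by_embedding X \<Phi>"
  proof -
    obtain n F where F: "linearizing X \<Phi> n F" "embedding_map X (Euclidean_space n) F"
      using lin unfolding linearizable_by_embedding_def by blast
    have Fc: "continuous_map X (Euclidean_space n) F"
      using F(2) unfolding embedding_map_def
      by (metis homeomorphic_imp_continuous_map continuous_map_into_fulltopology)
    have Fi: "inj_on F (topspace X)"
      using F(2) unfolding embedding_map_def by (rule homeomorphic_imp_injective_map)
    obtain B where B: "B \<in> carrier_mat n n" "linearized_flow X \<Phi> A n F (\<lambda>t k j. mat_exp (t \<cdot>\<^sub>m B) $$ (k, j))"
      using linearized_flowI[OF F(1) Fc Fi] by blast
    then interpret linearized_flow X \<Phi> A n F "\<lambda>t k j. mat_exp (t \<cdot>\<^sub>m B) $$ (k, j)" by simp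
    obtain m f \<omega> where "linear_coordinates m f \<omega>" using eigenfunctions_on_A[OF B(1) refl] by blast
    from torus_action_from_frequencies[OF this] show ?thesis using asymptotic_phase by blast
  qed
  moreover have "linearizable_by_embedding X \<Phi>"
    if H: "has_asymptotic_phase X \<Phi> A" "torus_action l (subtopology X A) \<Theta>"
      "finitely_many_orbit_types l (subtopology X A) \<Theta>" "one_parameter_subgroup l (subtopology X A) \<Theta> \<Phi>" for l \<Theta>
  proof -
    obtain n F where F: "linearizing X \<Phi> n F" "continuous_map X euclidean F" "inj_on F (topspace X)"
      using linearizable_converse[OF embeds H] by blast
    have "continuous_map X (Euclidean_space n) F"
      using F(1,2) by (auto simp: continuous_map_Euclidean_space_euclidean linearizing_def topspace_Euclidean_space Pi_iff)
    \<comment> \<open>The construction provides only a continuous injection; that it is an embedding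
      follows from properness.\<close>
    then show ?thesis using proper[OF _ F(3,1)] F(1) unfolding linearizable_by_embedding_def by blast
  qed
  ultimately show ?thesis using proper by blast
qed

end
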